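(* For every integer $n\ge 1$ there is a group isomorphism $\pi_n(\mathbb{S}^n)\cong\mathbb{Z}$; consequently the zeroth stable stem satisfies $\pi_0^S\cong\mathbb{Z}$.
   Context: $\mathbb{S}^n$ is the $n$-sphere and $\pi_n$ the $n$-th (based) homotopy group. The $k$-th stable stem is $\pi_k^S:=\operatorname{colim}_r \pi_{k+r}(\mathbb{S}^r)$, the colimit taken along the suspension homomorphisms $\Sigma:\pi_{k+r}(\mathbb{S}^r)\to\pi_{k+r+1}(\mathbb{S}^{r+1})$. *)

theory Defs
  imports "HOL-Analysis.Analysis" "HOL-Algebra.Elementary_Groups"
begin

section \<open>Homotopy groups\<close>

text \<open>
  The unit cube \<open>[0,1]^n\<close>, encoded (like the library's \<^const>\<open>nsphere\<close>) by functions on \<^typ>\<open>nat\<close>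
  that vanish from coordinate \<open>n\<close> onwards. This lets all dimensions share one type.
\<close>

definition cube :: "nat \<Rightarrow> (nat \<Rightarrow> real) set" where
  "cube n = {x. (\<forall>i<n. 0 \<le> x i \<and> x i \<le> 1) \<and> (\<forall>i\<ge>n. x i = 0)}"

definition cube_boundary :: "nat \<Rightarrow> (nat \<Rightarrow> real) set" where
  "cube_boundary n = {x \<in> cube n. \<exists>i<n. x i = 0 \<or> x i = 1}"

abbreviation cube_space :: "nat \<Rightarrow> (nat \<Rightarrow> real) topology" where
  "cube_space n \<equiv> subtopology (powertop_real UNIV) (cube n)"

text \<open>
  Maps of pairs from the cube and its boundary to \<open>X\<close> and the base point \<open>a\<close>, and homotopy
  through such maps. Values off the cube are irrelevant: maps that agree on the cube are homotopic.
\<close>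

definition cube_loops :: "nat \<Rightarrow> 'a topology \<Rightarrow> 'a \<Rightarrow> ((nat \<Rightarrow> real) \<Rightarrow> 'a) set" where
  "cube_loops n X a = {f. continuous_map (cube_space n) X f \<and> (\<forall>x\<in>cube_boundary n. f x = a)}"

definition loop_homotopy ::
    "nat \<Rightarrow> 'a topology \<Rightarrow> 'a \<Rightarrow> (((nat \<Rightarrow> real) \<Rightarrow> 'a) \<times> ((nat \<Rightarrow> real) \<Rightarrow> 'a)) set" where
  "loop_homotopy n X a =
     {(f, g). homotopic_with (\<lambda>h. \<forall>x\<in>cube_boundary n. h x = a) (cube_space n) X f g}"

definition loop_concat ::
    "((nat \<Rightarrow> real) \<Rightarrow> 'a) \<Rightarrow> ((nat \<Rightarrow> real) \<Rightarrow> 'a) \<Rightarrow> (nat \<Rightarrow> real) \<Rightarrow> 'a" where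
  "loop_concat f g x =
     (if x 0 \<le> 1/2 then f (x(0 := 2 * x 0)) else g (x(0 := 2 * x 0 - 1)))"

text \<open>Only meaningful as a group for \<open>n \<ge> 1\<close>.\<close>

definition homotopy_group ::
    "nat \<Rightarrow> 'a topology \<Rightarrow> 'a \<Rightarrow> ((nat \<Rightarrow> real) \<Rightarrow> 'a) set monoid" where
  "homotopy_group n X a =
     \<lparr>carrier = cube_loops n X a // loop_homotopy n X a,
      monoid.mult = (\<lambda>A B. \<Union>f\<in>A. \<Union>g\<in>B. loop_homotopy n X a `` {loop_concat f g}),
      one = loop_homotopy n X a `` {\<lambda>_. a}\<rparr>"

lemma equiv_loop_homotopy: "equiv (cube_loops n X a) (loop_homotopy n X a)"
proof (rule equivI)
  show "loop_homotopy n X a \<subseteq> cube_loops n X a \<times> cube_loops n X a"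
    unfolding loop_homotopy_def cube_loops_def
    by (auto dest: homotopic_with_imp_continuous_maps homotopic_with_imp_property)
  show "refl_on (cube_loops n X a) (loop_homotopy n X a)"
    by (auto simp: refl_on_def loop_homotopy_def cube_loops_def)
  show "sym (loop_homotopy n X a)"
    by (auto simp: sym_def loop_homotopy_def intro: homotopic_with_symD)
  show "trans (loop_homotopy n X a)"
    by (auto simp: trans_def loop_homotopy_def intro: homotopic_with_trans)
qed


section \<open>Suspension\<close>

definition sphere_base :: "nat \<Rightarrow> real" where
  "sphere_base = (\<lambda>i. if i = 0 then 1 else 0)"

abbreviation sphere_homotopy_group ::
    "nat \<Rightarrow> nat \<Rightarrow> ((nat \<Rightarrow> real) \<Rightarrow> nat \<Rightarrow> real) set monoid" where
  "sphere_homotopy_group n r \<equiv> homotopy_group n (nsphere r) sphere_base"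

text \<open>
  The standard identification of the reduced suspension of the \<open>r\<close>-sphere with the \<open>(r+1)\<close>-sphere,
  as a map from the product of the \<open>r\<close>-sphere with \<open>[0,1]\<close>. With \<open>b\<close> the base point and \<open>e\<close> the new
  unit vector (coordinate \<open>r + 1\<close>), the path \<open>t \<mapsto> reduced_susp r y t\<close> starts at \<open>b\<close> and runs once
  around the circle with diameter \<open>[b, y]\<close> in the affine plane through \<open>b\<close> spanned by \<open>y - b\<close> and \<open>e\<close>.
  These circles meet only in \<open>b\<close> and cover the \<open>(r+1)\<close>-sphere, so exactly the points with \<open>y = b\<close>,
  \<open>t = 0\<close> or \<open>t = 1\<close> are collapsed (to \<open>b\<close>).
\<close>

definition reduced_susp :: "nat \<Rightarrow> (nat \<Rightarrow> real) \<Rightarrow> real \<Rightarrow> nat \<Rightarrow> real" where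
  "reduced_susp r y t = (\<lambda>i.
     if i = Suc r then sin (2 * pi * t) * (sqrt (\<Sum>j\<le>r. (y j - sphere_base j)\<^sup>2) / 2)
     else (sphere_base i + y i) / 2 + cos (2 * pi * t) * ((sphere_base i - y i) / 2))"

lemma reduced_susp_collapse:
  assumes "y \<in> topspace (nsphere r)" and "y = sphere_base \<or> t = 0 \<or> t = 1"
  shows "reduced_susp r y t = sphere_base"
  using assms by (auto simp: reduced_susp_def sphere_base_def nsphere fun_eq_iff field_simps)

lemma reduced_susp_in_nsphere:
  assumes y: "y \<in> topspace (nsphere r)"
  shows "reduced_susp r y t \<in> topspace (nsphere (Suc r))"
proof -
  define b where "b = sphere_base"
  define c where "c = cos (2 * pi * t)"
  define s where "s = sin (2 * pi * t)"
  have yn: "(\<Sum>j\<le>r. (y j)\<^sup>2) = 1" and y0: "\<And>i. i > r \<Longrightarrow> y i = 0"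
    using y by (auto simp: nsphere)
  have bn: "(\<Sum>j\<le>r. (b j)\<^sup>2) = 1"
    by (simp add: b_def sphere_base_def if_distrib[of "\<lambda>x. x\<^sup>2"] cong: if_cong)
  have cs: "s\<^sup>2 = 1 - c\<^sup>2"
    by (simp add: c_def s_def sin_squared_eq)
  define D where "D = (\<Sum>j\<le>r. (y j - b j)\<^sup>2)"
  have D0: "D \<ge> 0" unfolding D_def by (simp add: sum_nonneg)
  have Suc_coord: "(reduced_susp r y t (Suc r))\<^sup>2 = s\<^sup>2 * D / 4"
    using D0 by (simp add: reduced_susp_def s_def D_def b_def power_mult_distrib power_divide)
  have "(\<Sum>i\<le>r. (reduced_susp r y t i)\<^sup>2)
      = (\<Sum>i\<le>r. ((b i + y i) / 2 + c * ((b i - y i) / 2))\<^sup>2)"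
    by (rule sum.cong) (auto simp: reduced_susp_def b_def c_def)
  also have "\<dots> = (\<Sum>i\<le>r. ((b i)\<^sup>2 + (y i)\<^sup>2) / 2 - (y i - b i)\<^sup>2 / 4
                         + c * (((b i)\<^sup>2 - (y i)\<^sup>2) / 2) + c\<^sup>2 * ((y i - b i)\<^sup>2 / 4))"
    by (rule sum.cong) (auto simp: power2_eq_square field_simps)
  also have "\<dots> = (1 + 1) / 2 - D / 4 + c * ((1 - 1) / 2) + c\<^sup>2 * (D / 4)"
    by (simp add: sum.distrib sum_subtractf flip: sum_distrib_left sum_divide_distrib
        add: bn yn D_def)
  finally have low: "(\<Sum>i\<le>r. (reduced_susp r y t i)\<^sup>2) = 1 - D / 4 + c\<^sup>2 * (D / 4)"
    by simp
  have "(\<Sum>i\<le>Suc r. (reduced_susp r y t i)\<^sup>2) = 1"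
    using low Suc_coord cs by (simp add: field_simps)
  moreover have "reduced_susp r y t i = 0" if "i > Suc r" for i
    using that y0[of i] by (simp add: reduced_susp_def sphere_base_def)
  ultimately show ?thesis by (simp add: nsphere)
qed

text \<open>
  For \<open>f\<close> on the \<open>n\<close>-cube, the suspension is a map on the \<open>(n+1)\<close>-cube whose last coordinate (index
  \<open>n\<close>) is the suspension parameter; \<open>x(n := 0)\<close> is the projection of \<open>x\<close> to the \<open>n\<close>-cube. For
  \<open>n \<ge> 1\<close> this coordinate differs from the one used in \<^const>\<open>loop_concat\<close>.
\<close>

definition susp_loop ::
    "nat \<Rightarrow> nat \<Rightarrow> ((nat \<Rightarrow> real) \<Rightarrow> nat \<Rightarrow> real) \<Rightarrow> (nat \<Rightarrow> real) \<Rightarrow> nat \<Rightarrow> real" where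
  "susp_loop n r f x = reduced_susp r (f (x(n := 0))) (x n)"

definition suspension_hom ::
    "nat \<Rightarrow> nat \<Rightarrow> ((nat \<Rightarrow> real) \<Rightarrow> nat \<Rightarrow> real) set \<Rightarrow> ((nat \<Rightarrow> real) \<Rightarrow> nat \<Rightarrow> real) set" where
  "suspension_hom n r A =
     (\<Union>f\<in>A. loop_homotopy (Suc n) (nsphere (Suc r)) sphere_base `` {susp_loop n r f})"


section \<open>Sequential colimits of groups\<close>

text \<open>The composite \<open>f (i + d - 1) \<circ> \<dots> \<circ> f i\<close> from stage \<open>i\<close> to stage \<open>i + d\<close>.\<close>

primrec seq_transport :: "(nat \<Rightarrow> 'a \<Rightarrow> 'a) \<Rightarrow> nat \<Rightarrow> nat \<Rightarrow> 'a \<Rightarrow> 'a" where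
  "seq_transport f i 0 x = x"
| "seq_transport f i (Suc d) x = f (i + d) (seq_transport f i d x)"

definition seq_colim_rel ::
    "(nat \<Rightarrow> 'a monoid) \<Rightarrow> (nat \<Rightarrow> 'a \<Rightarrow> 'a) \<Rightarrow> ((nat \<times> 'a) \<times> (nat \<times> 'a)) set" where
  "seq_colim_rel G f =
     {((i, x), (j, y)). x \<in> carrier (G i) \<and> y \<in> carrier (G j) \<and>
        (\<exists>d e. i + d = j + e \<and> seq_transport f i d x = seq_transport f j e y)}"

text \<open>
  The colimit of \<open>G 0 \<rightarrow> G 1 \<rightarrow> \<dots>\<close> along homomorphisms \<open>f i : G i \<rightarrow> G (i + 1)\<close>: the disjoint union of
  the carriers modulo eventual equality. Two classes are multiplied at a common stage.
\<close>

definition seq_colim ::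
    "(nat \<Rightarrow> 'a monoid) \<Rightarrow> (nat \<Rightarrow> 'a \<Rightarrow> 'a) \<Rightarrow> (nat \<times> 'a) set monoid" where
  "seq_colim G f =
     \<lparr>carrier = (SIGMA i:UNIV. carrier (G i)) // seq_colim_rel G f,
      monoid.mult = (\<lambda>A B. \<Union>(i, x)\<in>A. \<Union>(j, y)\<in>B. seq_colim_rel G f ``
         {(i + j, seq_transport f i j x \<otimes>\<^bsub>G (i + j)\<^esub> seq_transport f j i y)}),
      one = seq_colim_rel G f `` {(0, \<one>\<^bsub>G 0\<^esub>)}\<rparr>"

text \<open>
  The \<open>k\<close>-th stable stem. Stage \<open>i\<close> of the sequence is \<open>r = i + 1\<close>, so that every term, including those
  for \<open>k = 0\<close>, is a homotopy group in positive degree.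
\<close>

definition stable_stem ::
    "nat \<Rightarrow> (nat \<times> ((nat \<Rightarrow> real) \<Rightarrow> nat \<Rightarrow> real) set) set monoid" where
  "stable_stem k =
     seq_colim (\<lambda>i. sphere_homotopy_group (k + Suc i) (Suc i))
               (\<lambda>i. suspension_hom (k + Suc i) (Suc i))"

end

theory Submission
  imports Defs "HOL-Homology.Brouwer_Degree"
begin

text \<open>
  Iterating the reduced suspension gives a relative homeomorphism \<open>\<iota>\<^sub>n\<close> (here \<open>cube_sphere n\<close>) from the cube
  modulo its boundary to the sphere. A loop \<open>f\<close> factors as \<open>f' \<circ> \<iota>\<^sub>n\<close>, and the Brouwer degree of \<open>f'\<close> defines
  a homomorphism from \<open>\<pi>\<^sub>n(S\<^sup>n)\<close> to the integers with \<open>\<iota>\<^sub>n \<mapsto> 1\<close>; additivity holds on small singular chains,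
  because two maps supported in different parts of the sphere add up in homology. It remains to see that \<open>\<iota>\<^sub>n\<close>
  generates. For \<open>n = 1\<close> this is lifting along the exponential map. For the induction step the suspension
  \<open>\<pi>\<^sub>n(S\<^sup>n) \<rightarrow> \<pi>\<^bsub>n+1\<^esub>(S\<^bsup>n+1\<^esup>)\<close>, which maps \<open>\<iota>\<^sub>n\<close> to \<open>\<iota>\<^bsub>n+1\<^esub>\<close>, is onto: the pairs of points
  of the \<open>(n+1)\<close>-cube lying on a common line in the last coordinate direction form an \<open>(n+2)\<close>-dimensional family,
  whereas the pairs of possible poles have dimension \<open>2n+2 > n+2\<close>. So for a Lipschitz approximation some pair of
  poles is not attained on a common line, and a reparametrization of the last coordinate then separates the
  preimages of the poles into the two halves of the cube, which makes the map homotopic to a suspension.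
\<close>

section \<open>Homotopy groups are groups\<close>

text \<open>Surjectivity of the suspension is the heart of the matter; injectivity then follows,
  because the generators have degree 1 in every dimension and suspension carries each to the next.
  Two obstacles shape the argument for surjectivity. A continuous map can raise dimension, so
  counting parameters is meaningful only for a Lipschitz map; but an approximation would move the
  boundary of the cube off the base point. It is therefore faded out near the base point, and the
  poles are sought on rays through \<open>(v, 1)\<close> and \<open>(w, -1)\<close> with slopes in
  \<open>[0, 1]\<close>, whose last coordinate dominates and which stay away from the base point.
  The two poles must vary independently: an antipodal pair has only \<open>n + 1\<close> parameters,
  too few against \<open>n + 2\<close>. Shearing the upper and the lower half space separately
  brings both rays back to the axis. Maps to the sphere are deformed as nowhere vanishing maps to
  Euclidean space and projected radially, so that the work lies in checking that the homotopies
  avoid the origin.\<close>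

lemma cube_space_eq: "cube_space n = top_of_set (cube n)"
  by (simp add: euclidean_product_topology)

lemma cylinder_cube_space_eq:
  "prod_topology (top_of_set {0..1::real}) (cube_space n) = top_of_set ({0..1::real} \<times> cube n)"
  by (simp add: cube_space_eq)

lemma topspace_cube_space [simp]: "topspace (cube_space n) = cube n"
  by (simp add: cube_space_eq)

lemma cube_boundary_subset: "cube_boundary n \<subseteq> cube n"
  by (auto simp: cube_boundary_def)

lemma cubeD: "x \<in> cube n \<Longrightarrow> i < n \<Longrightarrow> 0 \<le> x i \<and> x i \<le> 1"
  by (simp add: cube_def)

lemma cube_upd: "x \<in> cube n \<Longrightarrow> i < n \<Longrightarrow> 0 \<le> t \<Longrightarrow> t \<le> 1 \<Longrightarrow> x(i := t) \<in> cube n"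
  by (auto simp: cube_def)

lemma cube_boundary_upd:
  "x \<in> cube n \<Longrightarrow> i < n \<Longrightarrow> t = 0 \<or> t = 1 \<Longrightarrow> x(i := t) \<in> cube_boundary n"
  by (auto simp: cube_def cube_boundary_def)

lemma cube_boundary_upd':
  "x \<in> cube_boundary n \<Longrightarrow> i < n \<Longrightarrow> 0 \<le> t \<Longrightarrow> t \<le> 1 \<Longrightarrow> x i = 0 \<or> x i = 1 \<longrightarrow> t = 0 \<or> t = 1
    \<Longrightarrow> x(i := t) \<in> cube_boundary n"
  by (auto simp: cube_def cube_boundary_def)

text \<open>This rule matches every function-valued map and would pre-empt the rule for updates below.\<close>

declare continuous_on_coordinatewise_then_product [continuous_intros del]

lemma continuous_on_coord [continuous_intros]:
  "continuous_on S (\<lambda>x. x (i::nat) :: real)" "continuous_on T (\<lambda>z. snd z (i::nat) :: real)"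
  by (auto intro!: continuous_on_product_then_coordinatewise continuous_intros)

lemma continuous_on_fun_upd [continuous_intros]:
  fixes f :: "'a::topological_space \<Rightarrow> nat \<Rightarrow> real"
  assumes "continuous_on S f" "continuous_on S g"
  shows "continuous_on S (\<lambda>x. (f x)(i := g x))"
proof (rule continuous_on_coordinatewise_then_product)
  fix j
  show "continuous_on S (\<lambda>x. ((f x)(i := g x)) j)"
    using assms by (cases "j = i") (auto intro: continuous_on_product_then_coordinatewise)
qed

section \<open>Loops and homotopies of the pair (cube, boundary)\<close>

lemma cube_loopsD:
  assumes "f \<in> cube_loops n X a"
  shows "continuous_map (cube_space n) X f" "\<And>x. x \<in> cube_boundary n \<Longrightarrow> f x = a"
  using assms by (auto simp: cube_loops_def)

lemma loop_homotopy_refl: "f \<in> cube_loops n X a \<Longrightarrow> (f, f) \<in> loop_homotopy n X a"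
  by (meson equiv_loop_homotopy equiv_class_self equivE refl_onD)

lemma loop_homotopy_sym: "(f, g) \<in> loop_homotopy n X a \<Longrightarrow> (g, f) \<in> loop_homotopy n X a"
  by (meson equiv_loop_homotopy equivE symD)

lemma loop_homotopy_trans:
  "(f, g) \<in> loop_homotopy n X a \<Longrightarrow> (g, h) \<in> loop_homotopy n X a \<Longrightarrow> (f, h) \<in> loop_homotopy n X a"
  by (meson equiv_loop_homotopy equivE transD)

lemma loop_homotopy_loops:
  assumes "(f, g) \<in> loop_homotopy n X a"
  shows "f \<in> cube_loops n X a" "g \<in> cube_loops n X a"
  using assms unfolding loop_homotopy_def cube_loops_def
  by (auto dest: homotopic_with_imp_continuous_maps homotopic_with_imp_property)

lemma loop_homotopy_cong:
  assumes "f \<in> cube_loops n X a" "\<And>x. x \<in> cube n \<Longrightarrow> f x = g x"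
  shows "(f, g) \<in> loop_homotopy n X a"
proof -
  have "g x = a" if "x \<in> cube_boundary n" for x
    using assms(2)[of x] that assms(1) by (auto simp: cube_loops_def cube_boundary_def)
  then show ?thesis
    using assms by (auto simp: loop_homotopy_def cube_loops_def intro!: homotopic_with_equal)
qed

lemma loop_homotopyI:
  assumes "continuous_map (top_of_set ({0..1::real} \<times> cube n)) X (\<lambda>(s, x). H s x)"
    and "\<And>s x. s \<in> {0..1} \<Longrightarrow> x \<in> cube_boundary n \<Longrightarrow> H s x = a"
  shows "(H 0, H 1) \<in> loop_homotopy n X a"
  unfolding loop_homotopy_def homotopic_with_def cylinder_cube_space_eq
  using assms by (auto intro!: exI[of _ "\<lambda>(s, x). H s x"])

lemma loop_homotopyE:
  assumes "(f, g) \<in> loop_homotopy n X a"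
  obtains H where "continuous_map (top_of_set ({0..1::real} \<times> cube n)) X (\<lambda>(s, x). H s x)"
    "\<And>s x. s \<in> {0..1} \<Longrightarrow> x \<in> cube_boundary n \<Longrightarrow> H s x = a" "H 0 = f" "H 1 = g"
proof -
  obtain h where h: "continuous_map (top_of_set ({0..1::real} \<times> cube n)) X h" "\<And>x. h (0, x) = f x"
    "\<And>x. h (1, x) = g x" "\<And>s x. s \<in> {0..1} \<Longrightarrow> x \<in> cube_boundary n \<Longrightarrow> h (s, x) = a"
    using assms unfolding loop_homotopy_def homotopic_with_def cylinder_cube_space_eq by auto
  show ?thesis
    by (rule that[of "\<lambda>s x. h (s, x)"]) (use h in \<open>auto simp: fun_eq_iff\<close>)
qed

lemma continuous_map_cylinder_compose:
  assumes "continuous_map (top_of_set S) X f" "continuous_on T \<Phi>" "\<Phi> ` T \<subseteq> S"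
  shows "continuous_map (top_of_set T) X (\<lambda>x. f (\<Phi> x))"
  using continuous_map_compose[of "top_of_set T" "top_of_set S" \<Phi> X f] assms
  by (auto simp: o_def)

text \<open>\<open>f\<close> is precomposed with a deformation of the cube that preserves the
  boundary as a set. Boundary points may move within the boundary, because \<open>f\<close> is
  constant there.\<close>

lemma loop_homotopy_reparam:
  assumes f: "f \<in> cube_loops n X a"
    and \<Phi>: "continuous_on ({0..1::real} \<times> cube n) (\<lambda>(s, x). \<Phi> s x)"
    and cube: "\<And>s x. s \<in> {0..1} \<Longrightarrow> x \<in> cube n \<Longrightarrow> \<Phi> s x \<in> cube n"
    and bdy: "\<And>s x. s \<in> {0..1} \<Longrightarrow> x \<in> cube_boundary n \<Longrightarrow> \<Phi> s x \<in> cube_boundary n"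
  shows "((\<lambda>x. f (\<Phi> 0 x)), (\<lambda>x. f (\<Phi> 1 x))) \<in> loop_homotopy n X a"
proof (rule loop_homotopyI[where H = "\<lambda>s x. f (\<Phi> s x)"])
  have "continuous_map (top_of_set ({0..1::real} \<times> cube n)) X (\<lambda>z. f ((\<lambda>(s, x). \<Phi> s x) z))"
    by (rule continuous_map_cylinder_compose[of "cube n"])
       (use f \<Phi> cube in \<open>auto simp: cube_loops_def cube_space_eq\<close>)
  then show "continuous_map (top_of_set ({0..1::real} \<times> cube n)) X (\<lambda>(s, x). f (\<Phi> s x))"
    by (simp add: case_prod_unfold)
qed (use f bdy in \<open>auto simp: cube_loops_def\<close>)

text \<open>Straight-line interpolation between \<sigma> and \<tau> in one coordinate. The condition
  concerns only the two faces of that coordinate; the other faces are respected since the remaining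
  coordinates do not move. The new value may depend on all of \<open>x\<close>, as it does when the
  poles are separated.\<close>

lemma loop_homotopy_reparam_coord:
  assumes f: "f \<in> cube_loops n X a" and k: "k < n"
    and \<sigma>: "continuous_on (cube n) \<sigma>" "\<And>x. x \<in> cube n \<Longrightarrow> \<sigma> x \<in> {0..1}"
    and \<tau>: "continuous_on (cube n) \<tau>" "\<And>x. x \<in> cube n \<Longrightarrow> \<tau> x \<in> {0..1}"
    and eq: "\<And>x. x \<in> cube n \<Longrightarrow> x k = 0 \<or> x k = 1 \<Longrightarrow> \<sigma> x = \<tau> x \<and> (\<sigma> x = 0 \<or> \<sigma> x = 1)"
  shows "((\<lambda>x. f (x(k := \<sigma> x))), (\<lambda>x. f (x(k := \<tau> x)))) \<in> loop_homotopy n X a"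
proof -
  define \<Phi> where "\<Phi> s x = x(k := (1 - s) * \<sigma> x + s * \<tau> x)" for s :: real and x :: "nat \<Rightarrow> real"
  have rng: "(1 - s) * \<sigma> x + s * \<tau> x \<in> {0..1}" if "s \<in> {0..1}" "x \<in> cube n" for s x
    using \<sigma>(2)[OF that(2)] \<tau>(2)[OF that(2)] that(1)
      convex_bound_le[of "\<sigma> x" 1 "\<tau> x" "1 - s" s] by auto
  have "((\<lambda>x. f (\<Phi> 0 x)), (\<lambda>x. f (\<Phi> 1 x))) \<in> loop_homotopy n X a"
  proof (rule loop_homotopy_reparam[OF f])
    show "continuous_on ({0..1} \<times> cube n) (\<lambda>(s, x). \<Phi> s x)"
      unfolding \<Phi>_def case_prod_unfold
      by (intro continuous_intros continuous_on_compose2[OF \<sigma>(1)] continuous_on_compose2[OF \<tau>(1)]) auto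
    show "\<Phi> s x \<in> cube n" if "s \<in> {0..1}" "x \<in> cube n" for s x
      using rng[OF that] that k by (auto simp: \<Phi>_def intro!: cube_upd)
    show "\<Phi> s x \<in> cube_boundary n" if "s \<in> {0..1}" "x \<in> cube_boundary n" for s x
    proof -
      have x: "x \<in> cube n" using that(2) cube_boundary_subset by blast
      show ?thesis unfolding \<Phi>_def
        using that rng[OF that(1) x] k eq[OF x]
        by (intro cube_boundary_upd') (auto simp: algebra_simps)
    qed
  qed
  then show ?thesis by (simp add: \<Phi>_def)
qed

text \<open>The two end values may coincide: cancelling a loop against its inverse uses
  \<open>\<bar>2 * t - 1\<bar>\<close>, which is 1 at both ends.\<close>

lemma loop_homotopy_reparam0:
  assumes f: "f \<in> cube_loops n X a" and n: "n \<ge> 1"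
    and \<phi>: "continuous_on {0..1} \<phi>" "\<And>t. t \<in> {0..1} \<Longrightarrow> \<phi> t \<in> {0..1}"
    and \<psi>: "continuous_on {0..1} \<psi>" "\<And>t. t \<in> {0..1} \<Longrightarrow> \<psi> t \<in> {0..1}"
    and eq: "\<phi> 0 = \<psi> 0" "\<phi> 1 = \<psi> 1" "\<phi> 0 \<in> {0, 1}" "\<phi> 1 \<in> {0, 1::real}"
  shows "((\<lambda>x. f (x(0 := \<phi> (x 0)))), (\<lambda>x. f (x(0 := \<psi> (x 0))))) \<in> loop_homotopy n X a"
proof (rule loop_homotopy_reparam_coord[OF f])
  have I: "x 0 \<in> {0..1}" if "x \<in> cube n" for x using that n by (auto simp: cube_def)
  show "continuous_on (cube n) (\<lambda>x. \<phi> (x 0))" "continuous_on (cube n) (\<lambda>x. \<psi> (x 0))"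
    by (rule continuous_on_compose2[OF \<phi>(1)] continuous_on_compose2[OF \<psi>(1)];
        use I in \<open>auto intro!: continuous_intros\<close>)+
qed (use eq \<phi> \<psi> n in \<open>auto simp: cube_def\<close>)

section \<open>Concatenation and the group laws\<close>

lemma const_loop: "a \<in> topspace X \<Longrightarrow> (\<lambda>_. a) \<in> cube_loops n X a"
  by (simp add: cube_loops_def)

text \<open>The halves are pasted along \<open>x 0 = 1/2\<close>, where both are evaluated on a face
  of the cube and equal \<open>a\<close>. With the homotopy parameter \<open>s\<close> carried
  along, the statement yields compatibility with homotopy and, for constant homotopies, closure
  under concatenation.\<close>

lemma continuous_map_loop_concat:
  assumes n: "n \<ge> 1"
    and F: "continuous_map (top_of_set ({0..1::real} \<times> cube n)) X (\<lambda>(s, x). F s x)"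
    and G: "continuous_map (top_of_set ({0..1::real} \<times> cube n)) X (\<lambda>(s, x). G s x)"
    and bF: "\<And>s x. s \<in> {0..1} \<Longrightarrow> x \<in> cube_boundary n \<Longrightarrow> F s x = a"
    and bG: "\<And>s x. s \<in> {0..1} \<Longrightarrow> x \<in> cube_boundary n \<Longrightarrow> G s x = a"
  shows "continuous_map (top_of_set ({0..1::real} \<times> cube n)) X (\<lambda>(s, x). loop_concat (F s) (G s) x)"
proof -
  let ?T = "{0..1} \<times> cube n :: (real \<times> (nat \<Rightarrow> real)) set"
  have "continuous_map (top_of_set ?T) X
     (\<lambda>z. if snd z 0 \<le> 1/2 then (\<lambda>(s, x). F s x) (fst z, (snd z)(0 := 2 * snd z 0))
          else (\<lambda>(s, x). G s x) (fst z, (snd z)(0 := 2 * snd z 0 - 1)))"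
  proof (rule continuous_map_cases_le)
    show "continuous_map (top_of_set ?T) euclideanreal (\<lambda>z. snd z 0)"
      by (auto intro!: continuous_intros)
    show "continuous_map (subtopology (top_of_set ?T) {z \<in> topspace (top_of_set ?T). snd z 0 \<le> 1/2}) X
       (\<lambda>z. (\<lambda>(s, x). F s x) (fst z, (snd z)(0 := 2 * snd z 0)))"
      unfolding subtopology_subtopology
      by (rule continuous_map_cylinder_compose[OF F])
         (use n in \<open>auto intro!: continuous_intros cube_upd dest: cubeD[of _ _ 0]\<close>)
    show "continuous_map (subtopology (top_of_set ?T) {z \<in> topspace (top_of_set ?T). 1/2 \<le> snd z 0}) X
       (\<lambda>z. (\<lambda>(s, x). G s x) (fst z, (snd z)(0 := 2 * snd z 0 - 1)))"
      unfolding subtopology_subtopology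
      by (rule continuous_map_cylinder_compose[OF G])
         (use n in \<open>auto intro!: continuous_intros cube_upd dest: cubeD[of _ _ 0]\<close>)
  qed (use bF bG n in \<open>auto simp: cube_boundary_upd\<close>)
  then show ?thesis
    by (rule continuous_map_eq) (auto simp: loop_concat_def)
qed

lemma loop_concat_boundary:
  assumes "\<And>x. x \<in> cube_boundary n \<Longrightarrow> f x = a" "\<And>x. x \<in> cube_boundary n \<Longrightarrow> g x = a"
    "x \<in> cube_boundary n" "n \<ge> 1"
  shows "loop_concat f g x = a"
proof -
  have "0 \<le> x 0" "x 0 \<le> 1"
    using assms(3,4) by (auto simp: cube_boundary_def cube_def)
  then show ?thesis
    using assms unfolding loop_concat_def
    by (auto intro!: assms(1,2) cube_boundary_upd')
qed

lemma loop_concat_homotopy: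
  assumes "n \<ge> 1" "(f, f') \<in> loop_homotopy n X a" "(g, g') \<in> loop_homotopy n X a"
  shows "(loop_concat f g, loop_concat f' g') \<in> loop_homotopy n X a"
proof -
  obtain F where F: "continuous_map (top_of_set ({0..1::real} \<times> cube n)) X (\<lambda>(s, x). F s x)"
    "\<And>s x. s \<in> {0..1} \<Longrightarrow> x \<in> cube_boundary n \<Longrightarrow> F s x = a" "F 0 = f" "F 1 = f'"
    using loop_homotopyE[OF assms(2)] by blast
  obtain G where G: "continuous_map (top_of_set ({0..1::real} \<times> cube n)) X (\<lambda>(s, x). G s x)"
    "\<And>s x. s \<in> {0..1} \<Longrightarrow> x \<in> cube_boundary n \<Longrightarrow> G s x = a" "G 0 = g" "G 1 = g'"
    using loop_homotopyE[OF assms(3)] by blast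
  have "((\<lambda>s. loop_concat (F s) (G s)) 0, (\<lambda>s. loop_concat (F s) (G s)) 1) \<in> loop_homotopy n X a"
    by (rule loop_homotopyI)
       (use continuous_map_loop_concat[OF assms(1) F(1) G(1) F(2) G(2)]
            loop_concat_boundary[OF F(2) G(2) _ assms(1)] in auto)
  then show ?thesis using F G by simp
qed

lemma loop_concat_loops:
  "n \<ge> 1 \<Longrightarrow> f \<in> cube_loops n X a \<Longrightarrow> g \<in> cube_loops n X a \<Longrightarrow> loop_concat f g \<in> cube_loops n X a"
  using loop_concat_homotopy loop_homotopy_refl loop_homotopy_loops(1) by metis

abbreviation loop_class :: "nat \<Rightarrow> 'a topology \<Rightarrow> 'a \<Rightarrow> ((nat \<Rightarrow> real) \<Rightarrow> 'a) \<Rightarrow> ((nat \<Rightarrow> real) \<Rightarrow> 'a) set" where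
  "loop_class n X a f \<equiv> loop_homotopy n X a `` {f}"

lemma loop_class_eqI: "(f, g) \<in> loop_homotopy n X a \<Longrightarrow> loop_class n X a f = loop_class n X a g"
  by (rule equiv_class_eq[OF equiv_loop_homotopy])

lemma loop_class_in_carrier:
  "f \<in> cube_loops n X a \<Longrightarrow> loop_class n X a f \<in> carrier (homotopy_group n X a)"
  by (auto simp: homotopy_group_def quotient_def)

lemma carrier_homotopy_groupE:
  assumes "A \<in> carrier (homotopy_group n X a)"
  obtains f where "f \<in> cube_loops n X a" "A = loop_class n X a f"
  using assms by (auto simp: homotopy_group_def quotient_def)

lemma mult_loop_class:
  assumes "n \<ge> 1" "f \<in> cube_loops n X a" "g \<in> cube_loops n X a"
  shows "loop_class n X a f \<otimes>\<^bsub>homotopy_group n X a\<^esub> loop_class n X a g = loop_class n X a (loop_concat f g)"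
proof -
  have "congruent2 (loop_homotopy n X a) (loop_homotopy n X a)
          (\<lambda>f g. loop_class n X a (loop_concat f g))"
    using assms(1) by (auto simp: congruent2_def intro!: loop_class_eqI loop_concat_homotopy)
  then show ?thesis
    using UN_equiv_class2[OF equiv_loop_homotopy equiv_loop_homotopy _ assms(2,3)]
    by (simp add: homotopy_group_def)
qed

lemma one_homotopy_group: "\<one>\<^bsub>homotopy_group n X a\<^esub> = loop_class n X a (\<lambda>_. a)"
  by (simp add: homotopy_group_def)

lemma loop_homotopy_id_reparam0:
  assumes "f \<in> cube_loops n X a" "n \<ge> 1"
    and "continuous_on {0..1} \<phi>" "\<And>t. t \<in> {0..1} \<Longrightarrow> \<phi> t \<in> {0..1}" "\<phi> 0 = 0" "\<phi> 1 = (1::real)"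
  shows "((\<lambda>x. f (x(0 := \<phi> (x 0)))), f) \<in> loop_homotopy n X a"
  using loop_homotopy_reparam0[OF assms(1-4), of "\<lambda>t. t"] assms(5,6) by simp

lemma loop_concat_assoc:
  assumes n: "n \<ge> 1" and l: "f \<in> cube_loops n X a" "g \<in> cube_loops n X a" "h \<in> cube_loops n X a"
  shows "(loop_concat (loop_concat f g) h, loop_concat f (loop_concat g h)) \<in> loop_homotopy n X a"
proof -
  \<comment> \<open>Concave, hence the minimum of its linear pieces, which have slopes 2, 1 and 1/2.
    It takes the break points 1/4 and 1/2 of the left bracketing to the break points 1/2 and 3/4 of
    the right one.\<close>
  let ?\<phi> = "\<lambda>t::real. min (2 * t) (min (t + 1/4) ((t + 1) / 2))"
  have "((\<lambda>x. loop_concat f (loop_concat g h) (x(0 := ?\<phi> (x 0)))), loop_concat f (loop_concat g h))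
      \<in> loop_homotopy n X a"
    by (rule loop_homotopy_id_reparam0) (use n l in \<open>auto simp: min_le_iff_disj intro!: continuous_intros loop_concat_loops\<close>)
  moreover have "(\<lambda>x. loop_concat f (loop_concat g h) (x(0 := ?\<phi> (x 0)))) = loop_concat (loop_concat f g) h"
  proof
    fix x :: "nat \<Rightarrow> real"
    consider "x 0 \<le> 1/4" | "1/4 < x 0" "x 0 \<le> 1/2" | "x 0 > 1/2" by linarith
    then show "loop_concat f (loop_concat g h) (x(0 := ?\<phi> (x 0))) = loop_concat (loop_concat f g) h x"
      by cases (simp_all add: loop_concat_def min_def algebra_simps add_divide_distrib diff_divide_distrib)
  qed
  ultimately show ?thesis by simp
qed

text \<open>\<open>max 0 (2 * t - 1)\<close> rests at the face \<open>x 0 = 0\<close> during the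
  first half and then runs through \<open>f\<close>. The reparametrized loop is compared with the
  concatenation on the cube only, hence the appeal to \<open>loop_homotopy_cong\<close>.\<close>

lemma loop_concat_const_left:
  assumes n: "n \<ge> 1" and f: "f \<in> cube_loops n X a"
  shows "(loop_concat (\<lambda>_. a) f, f) \<in> loop_homotopy n X a"
proof -
  have h: "((\<lambda>x. f (x(0 := max 0 (2 * x 0 - 1)))), f) \<in> loop_homotopy n X a"
    by (rule loop_homotopy_id_reparam0[OF f n]) (auto intro!: continuous_intros)
  show ?thesis
  proof (rule loop_homotopy_trans[OF loop_homotopy_sym h], rule loop_homotopy_cong)
    show "(\<lambda>x. f (x(0 := max 0 (2 * x 0 - 1)))) \<in> cube_loops n X a"
      using loop_homotopy_loops(1)[OF h] .
    show "f (x(0 := max 0 (2 * x 0 - 1))) = loop_concat (\<lambda>_. a) f x" if "x \<in> cube n" for x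
      using n that
      by (auto simp: loop_concat_def max_def intro!: cube_loopsD(2)[OF f] cube_boundary_upd)
  qed
qed

lemma loop_concat_const_right:
  assumes n: "n \<ge> 1" and f: "f \<in> cube_loops n X a"
  shows "(loop_concat f (\<lambda>_. a), f) \<in> loop_homotopy n X a"
proof -
  have h: "((\<lambda>x. f (x(0 := min 1 (2 * x 0)))), f) \<in> loop_homotopy n X a"
    by (rule loop_homotopy_id_reparam0[OF f n]) (auto intro!: continuous_intros)
  show ?thesis
  proof (rule loop_homotopy_trans[OF loop_homotopy_sym h], rule loop_homotopy_cong)
    show "(\<lambda>x. f (x(0 := min 1 (2 * x 0)))) \<in> cube_loops n X a"
      using loop_homotopy_loops(1)[OF h] .
    show "f (x(0 := min 1 (2 * x 0))) = loop_concat f (\<lambda>_. a) x" if "x \<in> cube n" for x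
    proof (cases "x 0 \<le> 1/2")
      case False
      then show ?thesis
        using n that cube_loopsD(2)[OF f cube_boundary_upd[OF that, of 0 1]]
        by (simp add: loop_concat_def min_def)
    qed (simp add: loop_concat_def min_absorb2)
  qed
qed

lemma loop_concat_inverse:
  assumes n: "n \<ge> 1" and f: "f \<in> cube_loops n X a"
  shows "(\<lambda>x. f (x(0 := 1 - x 0))) \<in> cube_loops n X a"
    "(loop_concat (\<lambda>x. f (x(0 := 1 - x 0))) f, \<lambda>_. a) \<in> loop_homotopy n X a"
proof -
  have "((\<lambda>x. f (x(0 := 1 - x 0))), (\<lambda>x. f (x(0 := 1 - x 0)))) \<in> loop_homotopy n X a"
    by (rule loop_homotopy_reparam0[OF f n]) (auto intro!: continuous_intros)
  then show "(\<lambda>x. f (x(0 := 1 - x 0))) \<in> cube_loops n X a"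
    by (rule loop_homotopy_loops)
  \<comment> \<open>\<open>\<bar>2 * t - 1\<bar>\<close> runs from 1 down to 0 and back, which is
    the inverse followed by \<open>f\<close>. It shares its end values with the constant 1, and
    \<open>x(0 := 1)\<close> lies on the boundary.\<close>
  have h: "((\<lambda>x. f (x(0 := \<bar>2 * x 0 - 1\<bar>))), (\<lambda>x. f (x(0 := 1)))) \<in> loop_homotopy n X a"
    by (rule loop_homotopy_reparam0[OF f n]) (auto intro!: continuous_intros)
  have 1: "((\<lambda>x. f (x(0 := 1))), (\<lambda>_. a)) \<in> loop_homotopy n X a"
    by (rule loop_homotopy_cong[OF loop_homotopy_loops(2)[OF h]])
       (use n in \<open>auto intro!: cube_loopsD(2)[OF f] cube_boundary_upd\<close>)
  have "(\<lambda>x. f (x(0 := \<bar>2 * x 0 - 1\<bar>))) = loop_concat (\<lambda>x. f (x(0 := 1 - x 0))) f"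
  proof
    fix x :: "nat \<Rightarrow> real"
    show "f (x(0 := \<bar>2 * x 0 - 1\<bar>)) = loop_concat (\<lambda>x. f (x(0 := 1 - x 0))) f x"
      by (cases "x 0 \<le> 1/2") (simp_all add: loop_concat_def)
  qed
  then show "(loop_concat (\<lambda>x. f (x(0 := 1 - x 0))) f, \<lambda>_. a) \<in> loop_homotopy n X a"
    using loop_homotopy_trans[OF h 1] by simp
qed

theorem group_homotopy_group:
  assumes n: "n \<ge> 1" and a: "a \<in> topspace X"
  shows "group (homotopy_group n X a)"
proof (rule groupI)
  let ?G = "homotopy_group n X a"
  fix A B C
  assume A: "A \<in> carrier ?G" 
  obtain f where f: "f \<in> cube_loops n X a" "A = loop_class n X a f"
    using carrier_homotopy_groupE[OF A] .
  show "\<one>\<^bsub>?G\<^esub> \<otimes>\<^bsub>?G\<^esub> A = A"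
    using n f a const_loop[OF a, of n]
    by (simp add: one_homotopy_group mult_loop_class loop_class_eqI loop_concat_const_left)
  show "\<exists>B\<in>carrier ?G. B \<otimes>\<^bsub>?G\<^esub> A = \<one>\<^bsub>?G\<^esub>"
    by (rule bexI[of _ "loop_class n X a (\<lambda>x. f (x(0 := 1 - x 0)))"])
       (use n f loop_concat_inverse[OF n f(1)] in
        \<open>simp_all add: one_homotopy_group mult_loop_class loop_class_eqI loop_class_in_carrier\<close>)
  assume B: "B \<in> carrier ?G"
  obtain g where g: "g \<in> cube_loops n X a" "B = loop_class n X a g"
    using carrier_homotopy_groupE[OF B] .
  show "A \<otimes>\<^bsub>?G\<^esub> B \<in> carrier ?G"
    using n f g by (simp add: mult_loop_class loop_class_in_carrier loop_concat_loops)
  assume C: "C \<in> carrier ?G"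
  obtain h where h: "h \<in> cube_loops n X a" "C = loop_class n X a h"
    using carrier_homotopy_groupE[OF C] .
  show "A \<otimes>\<^bsub>?G\<^esub> B \<otimes>\<^bsub>?G\<^esub> C = A \<otimes>\<^bsub>?G\<^esub> (B \<otimes>\<^bsub>?G\<^esub> C)"
    using n f g h by (simp add: mult_loop_class loop_concat_loops loop_class_eqI loop_concat_assoc)
next
  show "\<one>\<^bsub>homotopy_group n X a\<^esub> \<in> carrier (homotopy_group n X a)"
    using const_loop[OF a] by (simp add: one_homotopy_group loop_class_in_carrier)
qed

section \<open>Degree\<close>

text \<open>A constant map factors through a point, whose homology vanishes in nonzero
  degree.\<close>

lemma hom_induced_const:
  assumes "p \<noteq> 0" "b \<in> topspace Y" "c \<in> carrier (homology_group p X)"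
  shows "hom_induced p X {} Y {} (\<lambda>_. b) c = \<one>\<^bsub>homology_group p Y\<^esub>"
proof -
  let ?P = "discrete_topology {()}"
  have 1: "hom_induced p X {} Y {} ((\<lambda>_. b) \<circ> (\<lambda>_. ())) =
        hom_induced p ?P {} Y {} (\<lambda>_. b) \<circ> hom_induced p X {} ?P {} (\<lambda>_. ())"
    by (rule hom_induced_compose) (use assms in auto)
  have "trivial_group (homology_group p ?P)"
    by (rule homology_dimension_axiom) (use assms in auto)
  then have 2: "hom_induced p X {} ?P {} (\<lambda>_. ()) c = \<one>\<^bsub>homology_group p ?P\<^esub>"
    using hom_induced_carrier[of p X "{}" ?P "{}" "\<lambda>_. ()" c] by (auto simp: trivial_group_def)
  interpret group_hom "homology_group p ?P" "homology_group p Y" "hom_induced p ?P {} Y {} (\<lambda>_. b)"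
    by (simp add: group_hom_def group_hom_axioms_def hom_induced_empty_hom)
  show ?thesis using 1 2 by (simp add: o_def fun_eq_iff)
qed

text \<open>A simplex inside \<open>L\<close> is carried by \<open>h2\<close> to a constant simplex
  and not to zero, so the identity on small chains has a constant map added to \<open>h\<close>.
  That term vanishes in homology because \<open>p\<close> is nonzero. On the overlap of
  \<open>L\<close> and \<open>R\<close> all three maps equal \<open>b\<close>.\<close>

lemma hom_induced_split:
  assumes p: "p \<noteq> 0" and L: "openin X L" and R: "openin X R" and LR: "topspace X \<subseteq> L \<union> R"
    and b: "b \<in> topspace Y"
    and cont: "continuous_map X Y h" "continuous_map X Y h1" "continuous_map X Y h2"
    and hL: "\<And>x. x \<in> L \<Longrightarrow> h x = h1 x \<and> h2 x = b"
    and hR: "\<And>x. x \<in> R \<Longrightarrow> h x = h2 x \<and> h1 x = b"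
    and c: "c \<in> carrier (homology_group (int p) X)"
  shows "hom_induced p X {} Y {} h c
       = hom_induced p X {} Y {} h1 c \<otimes>\<^bsub>homology_group (int p) Y\<^esub> hom_induced p X {} Y {} h2 c"
proof -
  obtain z where z: "singular_relcycle p X {} z" "c = homologous_rel_set p X {} z"
    using c by (auto simp: carrier_relative_homology_group)
  obtain z' where z': "singular_relcycle p X {} z'" "homologous_rel p X {} z z'"
    and small: "\<And>f. f \<in> Poly_Mapping.keys z' \<Longrightarrow> \<exists>V\<in>{L, R}. f \<in> standard_simplex p \<rightarrow> V"
    by (rule small_homologous_rel_relcycle_exists[of "{L, R}" X p "{}" z]) (use L R LR z in auto)
  have c': "c = homologous_rel_set p X {} z'"
    using z z' by (simp add: homologous_rel_set_eq)
  let ?k = "\<lambda>_. b"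
  have "Poly_Mapping.keys z' \<subseteq> {f. \<exists>V\<in>{L, R}. f \<in> standard_simplex p \<rightarrow> V}"
    using small by blast
  then have "chain_map p h z' + chain_map p ?k z' = chain_map p h1 z' + chain_map p h2 z'"
  proof (induction z' rule: frag_induction)
    case (one f)
    have eq: "simplex_map p u f = simplex_map p v f"
      if "f \<in> standard_simplex p \<rightarrow> V" "\<And>x. x \<in> V \<Longrightarrow> u x = v x" for u v V
      using that by (auto simp: simplex_map_def fun_eq_iff restrict_def)
    from one consider "f \<in> standard_simplex p \<rightarrow> L" | "f \<in> standard_simplex p \<rightarrow> R" by auto
    then show ?case
    proof cases
      case 1
      with eq[OF 1, of h h1] eq[OF 1, of h2 ?k] hL show ?thesis by simp
    next
      case 2
      with eq[OF 2, of h h2] eq[OF 2, of h1 ?k] hR show ?thesis by simp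
    qed
  next
    case (diff a b)
    then show ?case by (simp add: chain_map_diff algebra_simps)
  qed auto
  then have "hom_induced p X {} Y {} h c \<otimes>\<^bsub>homology_group (int p) Y\<^esub> hom_induced p X {} Y {} ?k c
       = hom_induced p X {} Y {} h1 c \<otimes>\<^bsub>homology_group (int p) Y\<^esub> hom_induced p X {} Y {} h2 c"
  proof -
    have mult: "hom_induced p X {} Y {} u c \<otimes>\<^bsub>homology_group (int p) Y\<^esub> hom_induced p X {} Y {} v c
        = homologous_rel_set p Y {} (chain_map p u z' + chain_map p v z')"
      if u: "continuous_map X Y u" and v: "continuous_map X Y v" for u v
    proof -
      have "homologous_rel_set p Y {} a \<otimes>\<^bsub>homology_group (int p) Y\<^esub> homologous_rel_set p Y {} b'
        = homologous_rel_set p Y {} (a + b')" for a b'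
      proof -
        \<comment> \<open>Cosets multiply as sets of sums of chains: any \<open>x\<close> homologous
          to \<open>a + b'\<close> is the sum of \<open>a\<close> and \<open>x - a\<close>, and the
          latter is homologous to \<open>b'\<close>.\<close>
        have "\<exists>r s. homologous_rel p Y {} a r \<and> homologous_rel p Y {} b' s \<and> x = r + s"
          if "homologous_rel p Y {} (a + b') x" for x
          using that homologous_rel_refl[of p Y "{}" a]
          by (intro exI[of _ a] exI[of _ "x - a"]) (simp add: homologous_rel_def algebra_simps)
        then show ?thesis
          by (auto simp: mult_relative_homology_group homologous_rel_add)
      qed
      then show ?thesis
        using u v z'(1) by (simp add: c' hom_induced_chain_map)
    qed
    assume "chain_map p h z' + chain_map p ?k z' = chain_map p h1 z' + chain_map p h2 z'"
    then show ?thesis using cont b by (simp add: mult)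
  qed
  moreover have "hom_induced p X {} Y {} ?k c = \<one>\<^bsub>homology_group (int p) Y\<^esub>"
    by (rule hom_induced_const) (use p b c in auto)
  moreover interpret group "homology_group (int p) Y" by simp
  have "hom_induced p X {} Y {} h c \<in> carrier (homology_group (int p) Y)"
    by (rule hom_induced_carrier)
  ultimately show ?thesis by (simp del: one_relative_homology_group)
qed

lemma Brouwer_degree2_split:
  assumes p: "p \<noteq> 0" and L: "openin (nsphere p) L" and R: "openin (nsphere p) R"
    and LR: "topspace (nsphere p) \<subseteq> L \<union> R" and b: "b \<in> topspace (nsphere p)"
    and cont: "continuous_map (nsphere p) (nsphere p) h" "continuous_map (nsphere p) (nsphere p) h1"
      "continuous_map (nsphere p) (nsphere p) h2"
    and hL: "\<And>x. x \<in> L \<Longrightarrow> h x = h1 x \<and> h2 x = b"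
    and hR: "\<And>x. x \<in> R \<Longrightarrow> h x = h2 x \<and> h1 x = b"
  shows "Brouwer_degree2 p h = Brouwer_degree2 p h1 + Brouwer_degree2 p h2"
proof (rule Brouwer_degree2_unique)
  let ?G = "reduced_homology_group (int p) (nsphere p)"
  have G: "?G = homology_group (int p) (nsphere p)"
    using p by (simp add: un_reduced_homology_group)
  interpret group ?G by simp
  fix x assume x: "x \<in> carrier ?G"
  show "hom_induced (int p) (nsphere p) {} (nsphere p) {} h x
      = x [^]\<^bsub>?G\<^esub> (Brouwer_degree2 p h1 + Brouwer_degree2 p h2)"
    using hom_induced_split[OF p L R LR b cont hL hR] x
    by (simp add: int_pow_mult flip: G Brouwer_degree2)
qed (rule cont)

section \<open>The cube modulo its boundary is a sphere\<close>

lemma nsphere_eq: "nsphere n = top_of_set {x. (\<Sum>i\<le>n. x i ^ 2) = 1 \<and> (\<forall>i>n. x i = 0)}"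
  by (simp add: nsphere euclidean_product_topology)

lemma topspace_nsphere: "topspace (nsphere n) = {x. (\<Sum>i\<le>n. x i ^ 2) = 1 \<and> (\<forall>i>n. x i = 0)}"
  by (simp add: nsphere_eq)

lemma continuous_map_nsphere_iff:
  "continuous_map (top_of_set S) (nsphere n) f \<longleftrightarrow> continuous_on S f \<and> f ` S \<subseteq> topspace (nsphere n)"
  by (auto simp: nsphere_eq)

lemma sphere_base_in_nsphere [simp]: "sphere_base \<in> topspace (nsphere n)"
  by (simp add: topspace_nsphere sphere_base_def if_distrib[of "\<lambda>x. x\<^sup>2"] cong: if_cong)

text \<open>Stated for arbitrary \<open>y\<close>, since it is applied both to points of the
  \<open>n\<close>-sphere and to the first coordinates of a point one dimension higher. On the
  sphere it gives \<open>2 - 2 * y 0\<close>, so that the first coordinate alone detects the base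
  point.\<close>

lemma sum_power2_diff_sphere_base:
  "(\<Sum>i\<le>n. (y i - sphere_base i)\<^sup>2) = (\<Sum>i\<le>n. (y i)\<^sup>2) - 2 * y 0 + 1"
proof -
  have "(\<Sum>i\<le>n. (y i - sphere_base i)\<^sup>2) = (\<Sum>i\<le>n. (y i)\<^sup>2 + (if i = 0 then 1 - 2 * y 0 else 0))"
    by (rule sum.cong) (auto simp: sphere_base_def power2_eq_square algebra_simps)
  then show ?thesis by (simp add: sum.distrib)
qed

lemma nsphere_coord_0:
  assumes "y \<in> topspace (nsphere n)"
  shows "y 0 \<le> 1" "y 0 = 1 \<longleftrightarrow> y = sphere_base"
proof -
  have D: "(\<Sum>i\<le>n. (y i - sphere_base i)\<^sup>2) = 2 - 2 * y 0"
    using assms by (simp add: sum_power2_diff_sphere_base topspace_nsphere)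
  show "y 0 \<le> 1"
    using D sum_nonneg[of "{..n}" "\<lambda>i. (y i - sphere_base i)\<^sup>2"] by simp
  show "y 0 = 1 \<longleftrightarrow> y = sphere_base"
  proof
    assume "y 0 = 1"
    then have "(\<Sum>i\<le>n. (y i - sphere_base i)\<^sup>2) = 0" using D by simp
    then have "\<forall>i\<in>{..n}. (y i - sphere_base i)\<^sup>2 = 0"
      by (subst (asm) sum_nonneg_eq_0_iff) auto
    moreover have "y i = sphere_base i" if "i > n" for i
      using that assms by (auto simp: topspace_nsphere sphere_base_def)
    ultimately show "y = sphere_base"
      by (metis atMost_iff eq_iff_diff_eq_0 ext leI power_eq_0_iff)
  qed (simp add: sphere_base_def)
qed

section \<open>The reduced suspension off the base point\<close>

lemma continuous_on_reduced_susp: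
  fixes f :: "'a::t2_space \<Rightarrow> nat \<Rightarrow> real"
  assumes f: "continuous_on S f" and g: "continuous_on S g"
  shows "continuous_on S (\<lambda>x. reduced_susp r (f x) (g x))"
proof (rule continuous_on_coordinatewise_then_product)
  fix i
  have fi: "continuous_on S (\<lambda>x. f x j)" for j
    using f by (rule continuous_on_product_then_coordinatewise)
  show "continuous_on S (\<lambda>x. reduced_susp r (f x) (g x) i)"
    unfolding reduced_susp_def using g
    by (cases "i = Suc r") (auto intro!: continuous_intros fi)
qed

text \<open>The nonzero displacement \<open>w\<close> of \<open>z\<close> from the base point determines \<open>y\<close> and \<open>t\<close>: on the sphere
  \<open>2 d\<^sub>0 + |d|\<^sup>2 = 0\<close> for \<open>d = y - b\<close>, so \<open>1 - cos (2 \<pi> t) = - |w|\<^sup>2 / w\<^sub>0\<close>.\<close>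

lemma reduced_susp_minus_base:
  "i \<le> r \<Longrightarrow> reduced_susp r y t i - sphere_base i = (y i - sphere_base i) * ((1 - cos (2 * pi * t)) / 2)"
  by (simp add: reduced_susp_def field_simps)

lemma sin_cos_2pi_inj:
  assumes "0 < s" "s < 1" "0 < t" "t < 1" "cos (2 * pi * s) = cos (2 * pi * t)" "sin (2 * pi * s) = sin (2 * pi * t)"
  shows "s = t"
proof -
  obtain n :: int where "2 * pi * s = 2 * pi * t + 2 * pi * n"
    using sin_cos_eq_iff[of "2 * pi * s" "2 * pi * t"] assms by auto
  then have "2 * pi * (s - t) = 2 * pi * n" by (simp add: algebra_simps)
  then have "s - t = n" by simp
  moreover from this have "n = 0" using assms by linarith
  ultimately show ?thesis by simp
qed

lemma cos_2pi_less_1: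
  assumes "0 < t" "t < 1" shows "cos (2 * pi * t) < 1"
proof -
  have "cos (2 * pi * t) \<noteq> 1"
  proof
    assume "cos (2 * pi * t) = 1"
    then obtain n :: int where "2 * pi * t = n * 2 * pi" by (auto simp: cos_one_2pi_int)
    then have "t = n" by simp
    then show False using assms by simp
  qed
  then show ?thesis using cos_le_one[of "2 * pi * t"] by linarith
qed

text \<open>Besides \<open>D * q\<^sup>2\<close>, the squared length of the displacement in the old
  coordinates, its first entry determines \<open>D * q\<close>, because
  \<open>D = 2 * (1 - y 0)\<close>. Cancelling gives \<open>q = q'\<close> and then
  \<open>y = y'\<close>; the new coordinate, which carries the nonzero factor \<open>sqrt D\<close>,
  recovers the sine.\<close>

lemma reduced_susp_inj:
  assumes y: "y \<in> topspace (nsphere r)" "y \<noteq> sphere_base" and t: "0 < t" "t < 1"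
    and y': "y' \<in> topspace (nsphere r)" "y' \<noteq> sphere_base" and t': "0 < t'" "t' < 1"
    and eq: "reduced_susp r y t = reduced_susp r y' t'"
  shows "y = y' \<and> t = t'"
proof -
  define q q' where "q = (1 - cos (2 * pi * t)) / 2" and "q' = (1 - cos (2 * pi * t')) / 2"
  have q: "q > 0" "q' > 0" using cos_2pi_less_1 t t' by (auto simp: q_def q'_def)
  have w: "(y i - sphere_base i) * q = (y' i - sphere_base i) * q'" if "i \<le> r" for i
    using reduced_susp_minus_base[OF that, of y t] reduced_susp_minus_base[OF that, of y' t'] eq
    by (simp add: q_def q'_def)
  define D D' where "D = (\<Sum>i\<le>r. (y i - sphere_base i)\<^sup>2)" and "D' = (\<Sum>i\<le>r. (y' i - sphere_base i)\<^sup>2)"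
  have D: "D = 2 * (1 - y 0)" "D' = 2 * (1 - y' 0)"
    using y y' by (simp_all add: D_def D'_def sum_power2_diff_sphere_base topspace_nsphere)
  have pos: "D > 0" "D' > 0"
    using nsphere_coord_0[OF y(1)] nsphere_coord_0[OF y'(1)] y y' D by force+
  have "D * q\<^sup>2 = D' * q'\<^sup>2"
    unfolding D_def D'_def sum_distrib_right power_mult_distrib[symmetric]
    by (rule sum.cong) (auto simp: w)
  moreover have Dq: "D * q = D' * q'"
  proof -
    have "(1 - y 0) * q = (1 - y' 0) * q'"
      using w[of 0] by (simp add: sphere_base_def algebra_simps)
    then show ?thesis unfolding D mult.assoc by (rule arg_cong)
  qed
  ultimately have qq: "q = q'"
    using pos q by (metis mult.assoc mult_cancel_left power2_eq_square less_irrefl mult_pos_pos)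
  have "y i = y' i" for i
    using w[of i] q y y' by (cases "i \<le> r") (auto simp: qq topspace_nsphere)
  then have yy: "y = y'" ..
  have "sin (2 * pi * t) * (sqrt D / 2) = sin (2 * pi * t') * (sqrt D' / 2)"
    using fun_cong[OF eq, of "Suc r"] by (simp add: reduced_susp_def D_def D'_def)
  then have "sin (2 * pi * t) = sin (2 * pi * t')"
    using pos by (simp add: yy D_def D'_def)
  moreover have "cos (2 * pi * t) = cos (2 * pi * t')"
    using qq by (simp add: q_def q'_def)
  ultimately show ?thesis using sin_cos_2pi_inj t t' yy by blast
qed

lemma reduced_susp_ne_base:
  assumes y: "y \<in> topspace (nsphere r)" "y \<noteq> sphere_base" and t: "0 < t" "t < 1"
  shows "reduced_susp r y t \<noteq> sphere_base"
proof -
  have "reduced_susp r y t 0 - 1 = (y 0 - 1) * ((1 - cos (2 * pi * t)) / 2)"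
    using reduced_susp_minus_base[of 0 r y t] by (simp add: sphere_base_def)
  moreover have "y 0 - 1 < 0" using nsphere_coord_0[OF y(1)] y(2) by linarith
  ultimately have "reduced_susp r y t 0 \<noteq> 1" using cos_2pi_less_1[OF t] by auto
  then show ?thesis by (auto simp: sphere_base_def)
qed

lemma reduced_susp_surj:
  assumes z: "z \<in> topspace (nsphere (Suc r))" "z \<noteq> sphere_base"
  obtains y t where "y \<in> topspace (nsphere r)" "y \<noteq> sphere_base" "0 < t" "t < 1" "reduced_susp r y t = z"
proof -
  define e W where "e = z (Suc r)" and "W = (\<Sum>i\<le>r. (z i - sphere_base i)\<^sup>2)"
  define u where "u = 1 - z 0"
  have u: "u > 0" using nsphere_coord_0[OF z(1)] z(2) by (auto simp: u_def)
  have sum: "(\<Sum>i\<le>r. (z i)\<^sup>2) = 1 - e\<^sup>2" using z(1) by (simp add: topspace_nsphere e_def)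
  have W: "W = 2 * u - e\<^sup>2" by (simp add: W_def u_def sum_power2_diff_sphere_base sum)
  have "(z 0)\<^sup>2 \<le> (\<Sum>i\<le>r. (z i)\<^sup>2)" by (rule member_le_sum) auto
  then have "e\<^sup>2 \<le> 1 - (z 0)\<^sup>2" using sum by linarith
  also have "\<dots> = 2 * u - u\<^sup>2" by (simp add: u_def power2_eq_square algebra_simps)
  also have "\<dots> < 2 * u" using u by simp
  finally have Wpos: "W > 0" using W by simp
  \<comment> \<open>The intended value of \<open>1 - cos (2 * pi * t)\<close>: minus the squared
    displacement \<open>W\<close> divided by its first entry \<open>- u\<close>. The displacement of
    \<open>y\<close> will be that of \<open>z\<close> enlarged by \<open>2 / Q\<close>.\<close>
  define Q where "Q = W / u"
  have Q: "Q > 0" using Wpos u by (simp add: Q_def)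
  have Qe: "2 - Q = e\<^sup>2 / u" using u by (simp add: Q_def W field_simps)
  define y where "y = (\<lambda>i. if i \<le> r then sphere_base i + 2 * (z i - sphere_base i) / Q else 0)"
  have yi: "y i - sphere_base i = (2 / Q) * (z i - sphere_base i)" if "i \<le> r" for i
    using that by (simp add: y_def)
  have yi2: "(y i - sphere_base i)\<^sup>2 = 4 * (z i - sphere_base i)\<^sup>2 / Q\<^sup>2" if "i \<le> r" for i
    unfolding yi[OF that] power_mult_distrib power_divide by simp
  have dy: "(\<Sum>i\<le>r. (y i - sphere_base i)\<^sup>2) = 4 * W / Q\<^sup>2"
    unfolding W_def sum_distrib_left sum_divide_distrib
    by (rule sum.cong) (simp_all add: yi2)
  have y0: "y 0 = 1 - 2 * u / Q" using Q by (simp add: y_def sphere_base_def u_def field_simps)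
  have "(\<Sum>i\<le>r. (y i)\<^sup>2) = 1"
    using dy Q u Wpos unfolding sum_power2_diff_sphere_base y0
    by (simp add: Q_def power2_eq_square field_simps)
  then have y: "y \<in> topspace (nsphere r)" by (simp add: topspace_nsphere y_def)
  have "y 0 \<noteq> 1" using y0 u Q by simp
  then have yb: "y \<noteq> sphere_base" by (auto simp: sphere_base_def)
  \<comment> \<open>The sine is forced by the new coordinate: \<open>e\<close> must be the sine
    times \<open>sqrt W / Q\<close>, half the distance from \<open>y\<close> to the base point. That
    this sine and the cosine \<open>1 - Q\<close> lie on the unit circle supplies the angle.\<close>
  have "(1 - Q)\<^sup>2 + (e * Q / sqrt W)\<^sup>2 = 1"
  proof -
    have "(e * Q / sqrt W)\<^sup>2 = Q\<^sup>2 * (2 - Q) * u / W"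
      using Wpos u unfolding Qe by (simp add: power_mult_distrib power_divide)
    also have "\<dots> = Q * (2 - Q)"
      using Wpos u by (simp add: Q_def power2_eq_square)
    finally show ?thesis by (simp add: power2_eq_square algebra_simps)
  qed
  then obtain \<theta> where \<theta>: "0 \<le> \<theta>" "\<theta> < 2 * pi" "1 - Q = cos \<theta>" "e * Q / sqrt W = sin \<theta>"
    using sincos_total_2pi by metis
  define t where "t = \<theta> / (2 * pi)"
  have t: "2 * pi * t = \<theta>" by (simp add: t_def)
  have "\<theta> \<noteq> 0" using \<theta>(3) Q by auto
  then have t01: "0 < t" "t < 1" using \<theta>(1,2) by (auto simp: t_def field_simps)
  have "reduced_susp r y t i = z i" for i
  proof -
    consider "i = Suc r" | "i \<le> r" | "i > Suc r" by linarith
    then show ?thesis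
    proof cases
      case 1
      have "reduced_susp r y t i = e * Q / sqrt W * (sqrt (4 * W / Q\<^sup>2) / 2)"
        by (simp add: reduced_susp_def 1 t \<theta>(4) dy)
      also have "\<dots> = e" using Wpos Q by (simp add: real_sqrt_divide real_sqrt_mult)
      finally show ?thesis by (simp add: e_def 1)
    next
      case 2
      have "reduced_susp r y t i - sphere_base i = 2 * (z i - sphere_base i) / Q * (Q / 2)"
        unfolding reduced_susp_minus_base[OF 2] yi[OF 2] t \<theta>(3)[symmetric] by simp
      then show ?thesis using Q by simp
    next
      case 3
      then show ?thesis using z(1) y by (simp add: reduced_susp_def topspace_nsphere sphere_base_def)
    qed
  qed
  then show ?thesis using that y yb t01 by blast
qed

text \<open>The 0-cube is a point with empty boundary, so it goes to the point of the 0-sphere other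
  than the base point. Its suspension is then the standard loop around the circle.\<close>

primrec cube_sphere :: "nat \<Rightarrow> (nat \<Rightarrow> real) \<Rightarrow> nat \<Rightarrow> real" where
  "cube_sphere 0 = (\<lambda>_ i. if i = 0 then - 1 else 0)"
| "cube_sphere (Suc n) = susp_loop n n (cube_sphere n)"

lemma cube_Suc_proj: "x \<in> cube (Suc n) \<Longrightarrow> x(n := 0) \<in> cube n"
  by (auto simp: cube_def)

lemma cube_Suc_upd: "x \<in> cube n \<Longrightarrow> 0 \<le> t \<Longrightarrow> t \<le> 1 \<Longrightarrow> x(n := t) \<in> cube (Suc n)"
  by (auto simp: cube_def)

lemma cube_boundary_Suc:
  "x \<in> cube_boundary (Suc n) \<longleftrightarrow>
    x \<in> cube (Suc n) \<and> (x(n := 0) \<in> cube_boundary n \<or> x n = 0 \<or> x n = 1)"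
  by (auto simp: cube_boundary_def cube_def less_Suc_eq)

lemma continuous_on_susp_loop:
  assumes "continuous_on (cube n) f"
  shows "continuous_on (cube (Suc n)) (susp_loop n r f)"
  unfolding susp_loop_def[abs_def]
  by (intro continuous_on_reduced_susp continuous_on_compose2[OF assms])
     (auto intro!: continuous_intros cube_Suc_proj)

text \<open>The properties of a relative homeomorphism are proved in one induction, since
  injectivity for \<open>Suc n\<close> uses both injectivity and the description of the boundary for
  \<open>n\<close>. Surjectivity is claimed away from the base point, which is not attained when
  \<open>n = 0\<close>.\<close>

lemma cube_sphere:
  shows "continuous_on (cube n) (cube_sphere n)"
    and "x \<in> cube n \<Longrightarrow> cube_sphere n x \<in> topspace (nsphere n)"
    and "x \<in> cube n \<Longrightarrow> cube_sphere n x = sphere_base \<longleftrightarrow> x \<in> cube_boundary n"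
    and "x \<in> cube n - cube_boundary n \<Longrightarrow> y \<in> cube n - cube_boundary n
      \<Longrightarrow> cube_sphere n x = cube_sphere n y \<Longrightarrow> x = y"
    and "z \<in> topspace (nsphere n) \<Longrightarrow> z \<noteq> sphere_base \<Longrightarrow> \<exists>x\<in>cube n. cube_sphere n x = z"
proof (induction n arbitrary: x y z)
  case 0
  {
    case 1
    show ?case by (simp add: continuous_on_const)
  next
    case (2 x)
    show ?case by (simp add: topspace_nsphere)
  next
    case (3 x)
    show ?case by (auto simp: cube_boundary_def sphere_base_def fun_eq_iff intro!: exI[of _ 0])
  next
    case (4 x y)
    then show ?case by (auto simp: cube_def)
  next
    case (5 z)
    then have "z 0 = 1 \<or> z 0 = -1" "\<forall>i>0. z i = 0"
      by (auto simp: topspace_nsphere power2_eq_1_iff)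
    then have "z = cube_sphere 0 (\<lambda>_. 0)"
      using nsphere_coord_0(2)[OF 5(1)] 5(2) by (auto simp: fun_eq_iff)
    then show ?case by (auto simp: cube_def)
  }
next
  case (Suc n)
  have pr: "cube_sphere (Suc n) x = reduced_susp n (cube_sphere n (x(n := 0))) (x n)" for x
    by (simp add: susp_loop_def)
  have S: "cube_sphere n x \<in> topspace (nsphere n)" if "x \<in> cube n" for x
    using that by (rule Suc(2))
  have B: "cube_sphere n x = sphere_base \<longleftrightarrow> x \<in> cube_boundary n" if "x \<in> cube n" for x
    using that by (rule Suc(3))
  have int: "x(n := 0) \<in> cube n - cube_boundary n \<and> 0 < x n \<and> x n < 1"
    if "x \<in> cube (Suc n) - cube_boundary (Suc n)" for x
    using that cubeD[of x "Suc n" n] by (auto simp: cube_boundary_Suc cube_Suc_proj)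
  {
    case 1
    show ?case using Suc(1) by (simp add: continuous_on_susp_loop)
  next
    case (2 x)
    then show ?case unfolding pr by (intro reduced_susp_in_nsphere S cube_Suc_proj)
  next
    case (3 x)
    show ?case
    proof (cases "x \<in> cube_boundary (Suc n)")
      case True
      then have "cube_sphere n (x(n := 0)) = sphere_base \<or> x n = 0 \<or> x n = 1"
        using B[OF cube_Suc_proj[OF 3]] unfolding cube_boundary_Suc by blast
      then have "reduced_susp n (cube_sphere n (x(n := 0))) (x n) = sphere_base"
        by (rule reduced_susp_collapse[OF S[OF cube_Suc_proj[OF 3]]])
      then show ?thesis unfolding pr using True by blast
    next
      case False
      then have i: "x(n := 0) \<in> cube n - cube_boundary n \<and> 0 < x n \<and> x n < 1"
        using int 3 by blast
      then show ?thesis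
        unfolding pr using False S[of "x(n := 0)"] B[of "x(n := 0)"] by (simp add: reduced_susp_ne_base)
    qed
  next
    case (4 x y)
    have "cube_sphere n (x(n := 0)) = cube_sphere n (y(n := 0)) \<and> x n = y n"
      using 4(3) int[OF 4(1)] int[OF 4(2)] S[of "x(n := 0)"] B[of "x(n := 0)"] S[of "y(n := 0)"] B[of "y(n := 0)"]
      unfolding pr by (intro reduced_susp_inj) auto
    moreover from this have "x(n := 0) = y(n := 0)"
      using Suc(4) int[OF 4(1)] int[OF 4(2)] by blast
    ultimately show ?case by (metis fun_upd_triv fun_upd_upd)
  next
    case (5 z)
    obtain y t where y: "y \<in> topspace (nsphere n)" "y \<noteq> sphere_base" "0 < t" "t < 1"
      "reduced_susp n y t = z"
      using reduced_susp_surj[OF 5] by blast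
    obtain x where x: "x \<in> cube n" "cube_sphere n x = y"
      using Suc(5)[OF y(1,2)] by blast
    have "x(n := t) \<in> cube (Suc n)" using x y by (intro cube_Suc_upd) auto
    moreover have "x(n := 0) = x" using x by (auto simp: cube_def)
    ultimately show ?case unfolding pr using x y by (intro bexI[of _ "x(n := t)"]) auto
  }
qed

lemma cube_sphere_loop: "cube_sphere n \<in> cube_loops n (nsphere n) sphere_base"
  using cube_sphere(1-3) cube_boundary_subset[of n]
  by (auto simp: cube_loops_def cube_space_eq continuous_map_nsphere_iff image_subset_iff)

lemma compact_cube: "compact (cube n)"
proof -
  have "cube n = PiE UNIV (\<lambda>i. if i < n then {0..1} else {0::real})"
    by (force simp: cube_def PiE_def Pi_def not_less)
  then have "compactin (powertop_real UNIV) (cube n)"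
    by (simp only:) (auto simp: compactin_PiE)
  then show ?thesis by (simp add: euclidean_product_topology flip: compactin_euclidean_iff)
qed

lemma cube_sphere_image:
  assumes "n \<ge> 1"
  shows "cube_sphere n ` cube n = topspace (nsphere n)"
proof -
  have "(\<lambda>_. 0) \<in> cube_boundary n" using assms by (auto simp: cube_boundary_def cube_def intro!: exI[of _ 0])
  then have "sphere_base \<in> cube_sphere n ` cube n"
    using cube_sphere(3) cube_boundary_subset by (metis image_eqI subsetD)
  moreover have "z \<in> cube_sphere n ` cube n" if "z \<in> topspace (nsphere n)" "z \<noteq> sphere_base" for z
    using cube_sphere(5)[OF that] by blast
  ultimately show ?thesis using cube_sphere(2) by blast
qed

section \<open>Loops as maps of the sphere\<close>

definition sphere_factor :: "nat \<Rightarrow> ((nat \<Rightarrow> real) \<Rightarrow> 'a) \<Rightarrow> (nat \<Rightarrow> real) \<Rightarrow> 'a" where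
  "sphere_factor n f y = f (SOME x. x \<in> cube n \<and> cube_sphere n x = y)"

text \<open>The fibre of \<open>cube_sphere n\<close> over the base point is the boundary, where
  \<open>f\<close> is constant, and every other fibre has at most one point; so the chosen preimage
  does not matter.\<close>

lemma sphere_factor_cube_sphere:
  assumes f: "\<And>x. x \<in> cube_boundary n \<Longrightarrow> f x = a" and x: "x \<in> cube n"
  shows "sphere_factor n f (cube_sphere n x) = f x"
proof -
  define x' where "x' = (SOME x'. x' \<in> cube n \<and> cube_sphere n x' = cube_sphere n x)"
  have "x' \<in> cube n \<and> cube_sphere n x' = cube_sphere n x"
    unfolding x'_def by (rule someI[of _ x]) (use x in simp)
  then have x': "x' \<in> cube n" "cube_sphere n x' = cube_sphere n x" by auto
  have "f x' = f x"
  proof (cases "x \<in> cube_boundary n")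
    case True
    then have "x' \<in> cube_boundary n" using x x' cube_sphere(3) by metis
    then show ?thesis using True f by simp
  next
    case False
    then have "x' \<notin> cube_boundary n" using x x' cube_sphere(3) by metis
    then show ?thesis using False x x' cube_sphere(4) by (metis DiffI)
  qed
  then show ?thesis by (simp add: sphere_factor_def x'_def)
qed

text \<open>A continuous surjection from a compact space to a Hausdorff space is a quotient map.
  Including the interval lets whole homotopies descend to the sphere.\<close>

lemma quotient_map_cylinder_cube_sphere:
  assumes "n \<ge> 1"
  shows "quotient_map (top_of_set ({0..1::real} \<times> cube n)) (prod_topology (top_of_set {0..1}) (nsphere n))
           (\<lambda>(s, x). (s, cube_sphere n x))"
proof (rule T1_Spaces.continuous_imp_quotient_map)
  have "continuous_on ({0..1::real} \<times> cube n) (\<lambda>z. (fst z, cube_sphere n (snd z)))"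
    by (intro continuous_intros continuous_on_compose2[OF cube_sphere(1)]) auto
  then show "continuous_map (top_of_set ({0..1::real} \<times> cube n)) (prod_topology (top_of_set {0..1}) (nsphere n))
           (\<lambda>(s, x). (s, cube_sphere n x))"
    using cube_sphere(2) by (auto simp: nsphere_eq case_prod_unfold topspace_nsphere)
  show "compact_space (top_of_set ({0..1::real} \<times> cube n))"
    by (intro compact_space_subtopology) (simp add: compact_Times compact_cube)
  show "Hausdorff_space (prod_topology (top_of_set {0..1::real}) (nsphere n))"
    by (simp add: nsphere_eq Hausdorff_space_subtopology)
  show "(\<lambda>(s, x). (s, cube_sphere n x)) ` topspace (top_of_set ({0..1::real} \<times> cube n))
      = topspace (prod_topology (top_of_set {0..1}) (nsphere n))"
    by (simp add: image_paired_Times cube_sphere_image[OF assms])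
qed

text \<open>Each stage of the homotopy is factored separately; joint continuity comes from the
  quotient map on the cylinder. A free homotopy is enough for the Brouwer degree, and the reflexive
  case gives continuity of a factored loop.\<close>

lemma sphere_factor_homotopic:
  assumes n: "n \<ge> 1" and fg: "(f, g) \<in> loop_homotopy n X a"
  shows "homotopic_with (\<lambda>_. True) (nsphere n) X (sphere_factor n f) (sphere_factor n g)"
proof -
  obtain H where H: "continuous_map (top_of_set ({0..1::real} \<times> cube n)) X (\<lambda>(s, x). H s x)"
    "\<And>s x. s \<in> {0..1} \<Longrightarrow> x \<in> cube_boundary n \<Longrightarrow> H s x = a" "H 0 = f" "H 1 = g"
    using loop_homotopyE[OF fg] by blast
  let ?h = "\<lambda>(s, y). sphere_factor n (H s) y"
  have "continuous_map (top_of_set ({0..1::real} \<times> cube n)) X (?h \<circ> (\<lambda>(s, x). (s, cube_sphere n x)))"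
    by (rule continuous_map_eq[OF H(1)]) (use sphere_factor_cube_sphere[OF H(2)] in auto)
  then have "continuous_map (prod_topology (top_of_set {0..1}) (nsphere n)) X ?h"
    using continuous_compose_quotient_map_eq[OF quotient_map_cylinder_cube_sphere[OF n]] by blast
  then show ?thesis
    unfolding homotopic_with_def using H(3,4) by (intro exI[of _ ?h]) auto
qed

lemma continuous_map_sphere_factor:
  assumes "n \<ge> 1" "f \<in> cube_loops n X a"
  shows "continuous_map (nsphere n) X (sphere_factor n f)"
  using sphere_factor_homotopic[OF assms(1) loop_homotopy_refl[OF assms(2)]]
    homotopic_with_imp_continuous_maps by blast

section \<open>The degree of a loop and its additivity\<close>

abbreviation loop_degree :: "nat \<Rightarrow> ((nat \<Rightarrow> real) \<Rightarrow> nat \<Rightarrow> real) \<Rightarrow> int" where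
  "loop_degree n f \<equiv> Brouwer_degree2 n (sphere_factor n f)"

lemma loop_degree_homotopy:
  assumes "n \<ge> 1" "(f, g) \<in> loop_homotopy n (nsphere n) sphere_base"
  shows "loop_degree n f = loop_degree n g"
  by (rule Brouwer_degree2_homotopic[OF sphere_factor_homotopic[OF assms]])

lemma loop_degree_cube_sphere:
  assumes "n \<ge> 1" shows "loop_degree n (cube_sphere n) = 1"
proof -
  have "loop_degree n (cube_sphere n) = Brouwer_degree2 n id"
  proof (rule Brouwer_degree2_eq)
    fix y assume "y \<in> topspace (nsphere n)"
    then obtain x where "x \<in> cube n" "y = cube_sphere n x" using cube_sphere_image[OF assms] by blast
    then show "sphere_factor n (cube_sphere n) y = id y"
      using sphere_factor_cube_sphere[of n "cube_sphere n" sphere_base x] cube_loopsD(2)[OF cube_sphere_loop]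
      by simp
  qed
  then show ?thesis by simp
qed

text \<open>Each coordinate is stretched by the clamped affine map taking \<open>[1/6, 5/6]\<close>
  onto \<open>[0, 1]\<close>, which fixes 0 and 1 and so deforms linearly to the identity through
  maps of the pair. The margin is there to enclose the supports of the two halves of a concatenation
  in disjoint compact sets off the boundary.\<close>

lemma loop_shrink_support:
  assumes f: "f \<in> cube_loops n X a"
  obtains F where "(F, f) \<in> loop_homotopy n X a"
    "\<And>x. x \<in> cube n \<Longrightarrow> F x \<noteq> a \<Longrightarrow> \<forall>i<n. 1/6 < x i \<and> x i < 5/6"
proof -
  define C :: "(nat \<Rightarrow> real) \<Rightarrow> nat \<Rightarrow> real"
    where "C x = (\<lambda>i. if i < n then min 1 (max 0 (3/2 * x i - 1/4)) else 0)" for x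
  define \<Phi> where "\<Phi> s x = (\<lambda>i. (1 - s) * C x i + s * x i)" for s :: real and x :: "nat \<Rightarrow> real"
  have C01: "0 \<le> C x i" "C x i \<le> 1" for x i by (auto simp: C_def)
  have cube: "\<Phi> s x \<in> cube n" if "s \<in> {0..1}" "x \<in> cube n" for s x
  proof -
    have "0 \<le> \<Phi> s x i \<and> \<Phi> s x i \<le> 1" if "i < n" for i
      using \<open>s \<in> {0..1}\<close> C01[of x i] cubeD[OF \<open>x \<in> cube n\<close> that]
        convex_bound_le[of "C x i" 1 "x i" "1 - s" s] by (auto simp: \<Phi>_def)
    moreover have "\<Phi> s x i = 0" if "i \<ge> n" for i
      using that \<open>x \<in> cube n\<close> by (simp add: \<Phi>_def C_def cube_def)
    ultimately show ?thesis by (simp add: cube_def)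
  qed
  have "((\<lambda>x. f (\<Phi> 0 x)), (\<lambda>x. f (\<Phi> 1 x))) \<in> loop_homotopy n X a"
  proof (rule loop_homotopy_reparam[OF f])
    show "continuous_on ({0..1} \<times> cube n) (\<lambda>(s, x). \<Phi> s x)"
    proof (rule continuous_on_coordinatewise_then_product)
      fix i
      show "continuous_on ({0..1} \<times> cube n) (\<lambda>z. (case z of (s, x) \<Rightarrow> \<Phi> s x) i)"
        unfolding \<Phi>_def C_def case_prod_unfold by (cases "i < n") (auto intro!: continuous_intros)
    qed
    show "\<Phi> s x \<in> cube_boundary n" if sx: "s \<in> {0..1}" "x \<in> cube_boundary n" for s x
    proof -
      obtain i where i: "i < n" "x i = 0 \<or> x i = 1" using sx(2) by (auto simp: cube_boundary_def)
      then have "\<Phi> s x i = x i" by (auto simp: \<Phi>_def C_def)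
      then show ?thesis using i cube[OF sx(1)] sx(2) by (auto simp: cube_boundary_def)
    qed
  qed (rule cube)
  then have 1: "((\<lambda>x. f (C x)), f) \<in> loop_homotopy n X a" by (simp add: \<Phi>_def)
  have 2: "\<forall>i<n. 1/6 < x i \<and> x i < 5/6" if "x \<in> cube n" "f (C x) \<noteq> a" for x
  proof (intro allI impI)
    fix i assume i: "i < n"
    have "C x \<in> cube n" using C01 by (auto simp: cube_def) (simp add: C_def)
    then have "C x i \<noteq> 0 \<and> C x i \<noteq> 1"
      using that cube_loopsD(2)[OF f, of "C x"] i by (auto simp: cube_boundary_def)
    then show "1/6 < x i \<and> x i < 5/6" using i by (auto simp: C_def min_def max_def split: if_splits)
  qed
  show ?thesis using that[OF 1 2] .
qed

lemma loop_degree_concat: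
  assumes n: "n \<ge> 1"
    and fg: "f \<in> cube_loops n (nsphere n) sphere_base" "g \<in> cube_loops n (nsphere n) sphere_base"
  shows "loop_degree n (loop_concat f g) = loop_degree n f + loop_degree n g"
proof -
  let ?S = "nsphere n" and ?b = sphere_base
  have base: "?b \<in> topspace ?S" by simp
  obtain F where F: "(F, f) \<in> loop_homotopy n ?S ?b"
      "\<And>x. x \<in> cube n \<Longrightarrow> F x \<noteq> ?b \<Longrightarrow> \<forall>i<n. 1/6 < x i \<and> x i < 5/6"
    using loop_shrink_support[OF fg(1)] by blast
  obtain G where G: "(G, g) \<in> loop_homotopy n ?S ?b"
      "\<And>x. x \<in> cube n \<Longrightarrow> G x \<noteq> ?b \<Longrightarrow> \<forall>i<n. 1/6 < x i \<and> x i < 5/6"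
    using loop_shrink_support[OF fg(2)] by blast
  note FG = loop_homotopy_loops(1)[OF F(1)] loop_homotopy_loops(1)[OF G(1)] const_loop[OF base, of n]
  define h where "h = loop_concat F G"
  define h1 where "h1 = loop_concat F (\<lambda>_. ?b)"
  define h2 where "h2 = loop_concat (\<lambda>_. ?b) G"
  have loops: "h \<in> cube_loops n ?S ?b" "h1 \<in> cube_loops n ?S ?b" "h2 \<in> cube_loops n ?S ?b"
    using FG n by (simp_all add: h_def h1_def h2_def loop_concat_loops)
  \<comment> \<open>Closed boxes around the two supports: the range \<open>1/6 < t < 5/6\<close> of
    coordinate 0 becomes \<open>1/12 < x 0 < 5/12\<close> in the left half and
    \<open>7/12 < x 0 < 11/12\<close> in the right half. The boxes miss the boundary, so their
    images in the sphere are closed and disjoint, and the complements of the images form the open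
    cover.\<close>
  define KL where "KL = {x \<in> cube n. (\<forall>i\<in>{..<n}. 1/12 \<le> x i \<and> x i \<le> 11/12) \<and> x 0 \<le> 5/12}"
  define KR where "KR = {x \<in> cube n. (\<forall>i\<in>{..<n}. 1/12 \<le> x i \<and> x i \<le> 11/12) \<and> 7/12 \<le> x 0}"
  have "closed {x :: nat \<Rightarrow> real. (\<forall>i\<in>{..<n}. 1/12 \<le> x i \<and> x i \<le> 11/12) \<and> x 0 \<le> 5/12}"
    "closed {x :: nat \<Rightarrow> real. (\<forall>i\<in>{..<n}. 1/12 \<le> x i \<and> x i \<le> 11/12) \<and> 7/12 \<le> x 0}"
    unfolding Ball_def
    by (intro closed_Collect_conj closed_Collect_all closed_Collect_imp open_Collect_const closed_Collect_le continuous_intros)+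
  then have "compact (cube n \<inter> {x. (\<forall>i\<in>{..<n}. 1/12 \<le> x i \<and> x i \<le> 11/12) \<and> x 0 \<le> 5/12})"
    "compact (cube n \<inter> {x. (\<forall>i\<in>{..<n}. 1/12 \<le> x i \<and> x i \<le> 11/12) \<and> 7/12 \<le> x 0})"
    by (auto intro!: compact_Int_closed compact_cube)
  then have comp: "compact KL" "compact KR" by (simp_all add: KL_def KR_def Int_def)
  have sub: "KL \<subseteq> cube n - cube_boundary n" "KR \<subseteq> cube n - cube_boundary n"
  proof -
    have "x i \<noteq> 0 \<and> x i \<noteq> 1" if x: "x \<in> KL \<union> KR" and "i < n" for x i
    proof -
      have "\<forall>i\<in>{..<n}. 1/12 \<le> x i \<and> x i \<le> 11/12" using x by (auto simp: KL_def KR_def)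
      from bspec[OF this, of i] show ?thesis using \<open>i < n\<close> by auto
    qed
    then show "KL \<subseteq> cube n - cube_boundary n" "KR \<subseteq> cube n - cube_boundary n"
      by (auto simp: KL_def KR_def cube_boundary_def)
  qed
  have closed: "closedin ?S (cube_sphere n ` K)" if "compact K" "K \<subseteq> cube n" for K
    unfolding nsphere_eq
  proof (rule closed_subset)
    show "cube_sphere n ` K \<subseteq> {x. (\<Sum>i\<le>n. (x i)\<^sup>2) = 1 \<and> (\<forall>i>n. x i = 0)}"
      using cube_sphere(2)[of _ n] that(2) by (auto simp: topspace_nsphere)
    show "closed (cube_sphere n ` K)"
      by (intro compact_imp_closed compact_continuous_image continuous_on_subset[OF cube_sphere(1)] that)
  qed
  have factor: "sphere_factor n u (cube_sphere n x) = u x" if "u \<in> cube_loops n ?S ?b" "x \<in> cube n" for u x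
    by (rule sphere_factor_cube_sphere[OF cube_loopsD(2)[OF that(1)] that(2)])
  have split: "loop_degree n h = loop_degree n h1 + loop_degree n h2"
  proof (rule Brouwer_degree2_split)
    show "openin ?S (topspace ?S - cube_sphere n ` KR)" "openin ?S (topspace ?S - cube_sphere n ` KL)"
      using closed[OF comp(1)] closed[OF comp(2)] sub by (auto intro!: openin_diff)
    show "topspace ?S \<subseteq> (topspace ?S - cube_sphere n ` KR) \<union> (topspace ?S - cube_sphere n ` KL)"
    proof -
      have "cube_sphere n x \<noteq> cube_sphere n y" if "x \<in> KL" "y \<in> KR" for x y
      proof
        assume "cube_sphere n x = cube_sphere n y"
        then have "x = y" using cube_sphere(4) sub that by blast
        then show False using that by (auto simp: KL_def KR_def)
      qed
      then have "cube_sphere n ` KL \<inter> cube_sphere n ` KR = {}" by (auto simp: disjoint_iff)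
      then show ?thesis by (auto simp: disjoint_iff)
    qed
    show "sphere_factor n h y = sphere_factor n h1 y \<and> sphere_factor n h2 y = ?b"
      if y: "y \<in> topspace ?S - cube_sphere n ` KR" for y
    proof -
      obtain x where x: "x \<in> cube n" "y = cube_sphere n x" using y cube_sphere_image[OF n] by blast
      then have xK: "x \<notin> KR" using y by blast
      have "h x = h1 x \<and> h2 x = ?b"
      proof (cases "x 0 \<le> 1/2")
        case False
        have x': "x(0 := 2 * x 0 - 1) \<in> cube n"
          using False x n cubeD[OF x(1), of 0] by (auto intro!: cube_upd)
        have "G (x(0 := 2 * x 0 - 1)) = ?b"
        proof (rule ccontr)
          assume "G (x(0 := 2 * x 0 - 1)) \<noteq> ?b"
          then have *: "\<forall>i<n. 1/6 < (x(0 := 2 * x 0 - 1)) i \<and> (x(0 := 2 * x 0 - 1)) i < 5/6"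
            using G(2) x' by blast
          then have "1/6 < 2 * x 0 - 1 \<and> 2 * x 0 - 1 < 5/6" using n by (metis fun_upd_same less_le_trans zero_less_one)
          moreover have "1/6 < x i \<and> x i < 5/6" if "i < n" "i \<noteq> 0" for i using * that by auto
          ultimately have "x \<in> KR" using x(1) by (force simp: KR_def)
          then show False using xK by simp
        qed
        then show ?thesis using False by (simp add: h_def h1_def h2_def loop_concat_def)
      qed (simp add: h_def h1_def h2_def loop_concat_def)
      then show ?thesis unfolding x(2) using factor[OF _ x(1)] loops by metis
    qed
    show "sphere_factor n h y = sphere_factor n h2 y \<and> sphere_factor n h1 y = ?b"
      if y: "y \<in> topspace ?S - cube_sphere n ` KL" for y
    proof -
      obtain x where x: "x \<in> cube n" "y = cube_sphere n x" using y cube_sphere_image[OF n] by blast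
      then have xK: "x \<notin> KL" using y by blast
      have "h x = h2 x \<and> h1 x = ?b"
      proof (cases "x 0 \<le> 1/2")
        case True
        have x': "x(0 := 2 * x 0) \<in> cube n"
          using True x n cubeD[OF x(1), of 0] by (auto intro!: cube_upd)
        have "F (x(0 := 2 * x 0)) = ?b"
        proof (rule ccontr)
          assume "F (x(0 := 2 * x 0)) \<noteq> ?b"
          then have *: "\<forall>i<n. 1/6 < (x(0 := 2 * x 0)) i \<and> (x(0 := 2 * x 0)) i < 5/6"
            using F(2) x' by blast
          then have "1/6 < 2 * x 0 \<and> 2 * x 0 < 5/6" using n by (metis fun_upd_same less_le_trans zero_less_one)
          moreover have "1/6 < x i \<and> x i < 5/6" if "i < n" "i \<noteq> 0" for i using * that by auto
          ultimately have "x \<in> KL" using x(1) by (force simp: KL_def)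
          then show False using xK by simp
        qed
        then show ?thesis using True by (simp add: h_def h1_def h2_def loop_concat_def)
      qed (simp add: h_def h1_def h2_def loop_concat_def)
      then show ?thesis unfolding x(2) using factor[OF _ x(1)] loops by metis
    qed
  qed (use n loops in \<open>simp_all add: continuous_map_sphere_factor\<close>)
  have "(h, loop_concat f g) \<in> loop_homotopy n ?S ?b"
    unfolding h_def by (rule loop_concat_homotopy[OF n F(1) G(1)])
  moreover have "(h1, f) \<in> loop_homotopy n ?S ?b"
    unfolding h1_def using loop_homotopy_trans[OF loop_concat_const_right[OF n FG(1)] F(1)] .
  moreover have "(h2, g) \<in> loop_homotopy n ?S ?b"
    unfolding h2_def using loop_homotopy_trans[OF loop_concat_const_left[OF n FG(2)] G(1)] .
  ultimately show ?thesis using split by (simp add: loop_degree_homotopy[OF n])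
qed

definition sphere_degree :: "nat \<Rightarrow> ((nat \<Rightarrow> real) \<Rightarrow> nat \<Rightarrow> real) set \<Rightarrow> int" where
  "sphere_degree n A = loop_degree n (SOME f. f \<in> A)"

lemma sphere_degree_class:
  assumes "n \<ge> 1" "f \<in> cube_loops n (nsphere n) sphere_base"
  shows "sphere_degree n (loop_class n (nsphere n) sphere_base f) = loop_degree n f"
proof -
  have "f \<in> loop_class n (nsphere n) sphere_base f" using loop_homotopy_refl[OF assms(2)] by simp
  then have "(f, SOME g. g \<in> loop_class n (nsphere n) sphere_base f) \<in> loop_homotopy n (nsphere n) sphere_base"
    by (metis Image_singleton_iff someI)
  then show ?thesis unfolding sphere_degree_def using loop_degree_homotopy[OF assms(1)] by metis
qed

lemma sphere_degree_hom:
  assumes n: "n \<ge> 1"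
  shows "sphere_degree n \<in> hom (sphere_homotopy_group n n) integer_group"
proof (rule homI)
  fix A B assume A: "A \<in> carrier (sphere_homotopy_group n n)" and B: "B \<in> carrier (sphere_homotopy_group n n)"
  obtain f where f: "f \<in> cube_loops n (nsphere n) sphere_base" "A = loop_class n (nsphere n) sphere_base f"
    using carrier_homotopy_groupE[OF A] .
  obtain g where g: "g \<in> cube_loops n (nsphere n) sphere_base" "B = loop_class n (nsphere n) sphere_base g"
    using carrier_homotopy_groupE[OF B] .
  show "sphere_degree n (A \<otimes>\<^bsub>sphere_homotopy_group n n\<^esub> B)
      = sphere_degree n A \<otimes>\<^bsub>integer_group\<^esub> sphere_degree n B"
    using f g n by (simp add: mult_loop_class sphere_degree_class loop_concat_loops loop_degree_concat)
qed simp

section \<open>General position by counting\<close>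

lemma card_PiE_const: "finite I \<Longrightarrow> card (PiE I (\<lambda>_. A)) = card A ^ card I"
  by (simp add: card_PiE)

text \<open>Pigeonhole: with mesh \<open>1/R\<close> the target has \<open>R^e\<close> grid points, and distinct ones can only be reached from
  distinct cells of a suitable subdivision of the source into \<open>O(R^d)\<close> cells.\<close>

lemma lipschitz_relation_misses_point:
  fixes Rel :: "(nat \<Rightarrow> real) \<Rightarrow> (nat \<Rightarrow> real) \<Rightarrow> bool"
  assumes de: "d < e"
    and lip: "\<And>x y v w \<eta>. x \<in> cube d \<Longrightarrow> y \<in> cube d \<Longrightarrow> v \<in> cube e \<Longrightarrow> w \<in> cube e \<Longrightarrow> Rel x v \<Longrightarrow> Rel y w
       \<Longrightarrow> (\<And>i. i < d \<Longrightarrow> \<bar>x i - y i\<bar> \<le> \<eta>) \<Longrightarrow> 0 < \<eta> \<Longrightarrow> \<forall>i<e. \<bar>v i - w i\<bar> \<le> L * \<eta>"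
  obtains v where "v \<in> cube e" "\<And>x. x \<in> cube d \<Longrightarrow> \<not> Rel x v"
proof -
  have "\<exists>v\<in>cube e. \<forall>x\<in>cube d. \<not> Rel x v"
  proof (rule ccontr)
    assume "\<not> ?thesis"
    then obtain X where X: "\<And>v. v \<in> cube e \<Longrightarrow> X v \<in> cube d \<and> Rel (X v) v" by metis
    obtain C :: nat where C: "L < real C" using reals_Archimedean2 by blast
    \<comment> \<open>Since \<open>C' > L\<close> and \<open>K = C' * R\<close>, two parameters in
      one cell of side \<open>1 / K\<close> cannot reach grid points that are \<open>1 / R\<close>
      apart. \<open>R\<close> exceeds \<open>(C' + 1) ^ d\<close>, so that the
      \<open>(K + 1) ^ d\<close> cells are fewer than \<open>R ^ Suc d\<close>, which is at most the
      number \<open>R ^ e\<close> of grid points.\<close>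
    define C' where "C' = Suc C"
    define R where "R = Suc ((C' + 1) ^ d)"
    define K where "K = C' * R"
    have R: "R > 0" and K: "K > 0" by (simp_all add: R_def K_def C'_def)
    define gr where "gr j = (\<lambda>i. if i < e then real (j i) / real R else 0)" for j :: "nat \<Rightarrow> nat"
    define J where "J = PiE {..<e} (\<lambda>_. {..<R})"
    \<comment> \<open>The index in each direction runs up to \<open>K\<close> inclusive, since
      coordinate 1 falls on \<open>K\<close>; hence \<open>K + 1\<close> cells per
      direction.\<close>
    define cell where "cell j = restrict (\<lambda>i. nat \<lfloor>K * X (gr j) i\<rfloor>) {..<d}" for j
    have gr: "gr j \<in> cube e" if "j \<in> J" for j
    proof -
      have "j i < R" if "i < e" for i using that \<open>j \<in> J\<close> by (auto simp: J_def)
      then show ?thesis using R by (fastforce simp: gr_def cube_def)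
    qed
    have "cell ` J \<subseteq> PiE {..<d} (\<lambda>_. {..K})"
    proof clarsimp
      fix j assume j: "j \<in> J"
      have "nat \<lfloor>K * X (gr j) i\<rfloor> \<le> K" if "i < d" for i
      proof -
        have "real K * X (gr j) i \<le> real K * 1"
          using X[OF gr[OF j]] that K by (intro mult_left_mono) (auto simp: cube_def)
        then have "\<lfloor>real K * X (gr j) i\<rfloor> \<le> int K" by (simp add: floor_le_iff)
        then show ?thesis by linarith
      qed
      then show "cell j \<in> PiE {..<d} (\<lambda>_. {..K})" by (auto simp: cell_def)
    qed
    moreover have "card (PiE {..<d} (\<lambda>_. {..K})) < card J"
    proof -
      have "K + 1 \<le> (C' + 1) * R" using R by (simp add: K_def)
      then have "(K + 1) ^ d \<le> ((C' + 1) * R) ^ d" by (rule power_mono) simp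
      also have "\<dots> = (C' + 1) ^ d * R ^ d" by (rule power_mult_distrib)
      also have "\<dots> < R * R ^ d" using R by (intro mult_strict_right_mono) (auto simp: R_def)
      also have "\<dots> = R ^ Suc d" by simp
      also have "\<dots> \<le> R ^ e" using de R by (intro power_increasing) auto
      finally show ?thesis by (simp add: J_def card_PiE_const)
    qed
    ultimately have "\<not> inj_on cell J"
      by (meson card_inj_on_le finite_PiE finite_atMost finite_lessThan not_less)
    then obtain j j' where jj: "j \<in> J" "j' \<in> J" "j \<noteq> j'" "cell j = cell j'" by (auto simp: inj_on_def)
    have close: "\<bar>X (gr j) i - X (gr j') i\<bar> \<le> 1 / K" if i: "i < d" for i
    proof -
      have "nat \<lfloor>K * X (gr j) i\<rfloor> = nat \<lfloor>K * X (gr j') i\<rfloor>"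
        using fun_cong[OF jj(4), of i] i by (simp add: cell_def)
      moreover have "0 \<le> K * X (gr j) i" "0 \<le> K * X (gr j') i"
        using X[OF gr[OF jj(1)]] X[OF gr[OF jj(2)]] i by (auto simp: cube_def)
      ultimately have "\<bar>K * X (gr j) i - K * X (gr j') i\<bar> \<le> 1" by linarith
      then have "K * \<bar>X (gr j) i - X (gr j') i\<bar> \<le> 1"
        by (simp add: abs_mult flip: right_diff_distrib)
      then show ?thesis using K by (simp add: field_simps)
    qed
    have "\<forall>i<e. \<bar>gr j i - gr j' i\<bar> \<le> L * (1 / K)"
      by (rule lip[of "X (gr j)" "X (gr j')"]) (use X gr jj close K in auto)
    moreover obtain i where i: "i < e" "j i \<noteq> j' i"
      using jj by (metis J_def PiE_ext lessThan_iff)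
    ultimately have "\<bar>real (j i) - real (j' i)\<bar> / R \<le> L / K"
      by (auto simp: gr_def simp flip: diff_divide_distrib)
    moreover have "1 \<le> \<bar>real (j i) - real (j' i)\<bar>" using i(2) by linarith
    ultimately have "1 / R \<le> L / (C' * R)"
      using R by (simp add: K_def) (smt (verit) divide_right_mono of_nat_0_le_iff)
    moreover have "real C' * real R > 0" using R by (simp add: C'_def)
    ultimately have "1 / R * (C' * R) \<le> L" by (simp only: pos_le_divide_eq of_nat_mult)
    then have "C' \<le> L" using R by simp
    then show False using C by (simp add: C'_def)
  qed
  then show ?thesis using that by blast
qed

section \<open>Lipschitz approximation on the cube\<close>

definition lipschitz_cube :: "nat \<Rightarrow> ((nat \<Rightarrow> real) \<Rightarrow> real) \<Rightarrow> bool" where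
  "lipschitz_cube d g \<longleftrightarrow> continuous_on (cube d) g \<and>
     (\<exists>L\<ge>0. \<forall>x\<in>cube d. \<forall>y\<in>cube d. \<bar>g x - g y\<bar> \<le> L * (\<Sum>i<d. \<bar>x i - y i\<bar>))"

text \<open>Stone-Weierstrass is applied to the algebra of Lipschitz functions itself. Products stay
  Lipschitz because continuous functions on the compact cube are bounded, and the coordinate
  functions separate points.\<close>

lemma function_ring_lipschitz: "function_ring_on (Collect (lipschitz_cube d)) (cube d)"
proof
  fix f g assume "f \<in> Collect (lipschitz_cube d)" "g \<in> Collect (lipschitz_cube d)"
  then obtain L M where
    L: "continuous_on (cube d) f" "L \<ge> 0" "\<And>x y. x \<in> cube d \<Longrightarrow> y \<in> cube d \<Longrightarrow> \<bar>f x - f y\<bar> \<le> L * (\<Sum>i<d. \<bar>x i - y i\<bar>)" and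
    M: "continuous_on (cube d) g" "M \<ge> 0" "\<And>x y. x \<in> cube d \<Longrightarrow> y \<in> cube d \<Longrightarrow> \<bar>g x - g y\<bar> \<le> M * (\<Sum>i<d. \<bar>x i - y i\<bar>)"
    by (auto simp: lipschitz_cube_def)
  have "\<bar>(f x + g x) - (f y + g y)\<bar> \<le> (L + M) * (\<Sum>i<d. \<bar>x i - y i\<bar>)" if "x \<in> cube d" "y \<in> cube d" for x y
    using L(3)[OF that] M(3)[OF that] unfolding distrib_right by linarith
  then show "(\<lambda>x. f x + g x) \<in> Collect (lipschitz_cube d)"
    using L M by (auto simp: lipschitz_cube_def intro!: continuous_intros exI[of _ "L + M"])
  obtain A where A: "A > 0" "\<And>x. x \<in> cube d \<Longrightarrow> \<bar>f x\<bar> \<le> A"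
    using compact_imp_bounded[OF compact_continuous_image[OF L(1) compact_cube]]
    by (auto simp: bounded_pos)
  obtain B where B: "B > 0" "\<And>x. x \<in> cube d \<Longrightarrow> \<bar>g x\<bar> \<le> B"
    using compact_imp_bounded[OF compact_continuous_image[OF M(1) compact_cube]]
    by (auto simp: bounded_pos)
  have "\<bar>f x * g x - f y * g y\<bar> \<le> (A * M + B * L) * (\<Sum>i<d. \<bar>x i - y i\<bar>)"
    if xy: "x \<in> cube d" "y \<in> cube d" for x y
  proof -
    let ?D = "\<Sum>i<d. \<bar>x i - y i\<bar>"
    have D: "?D \<ge> 0" by (simp add: sum_nonneg)
    have "\<bar>f x * g x - f y * g y\<bar> = \<bar>f x * (g x - g y) + g y * (f x - f y)\<bar>" by (simp add: algebra_simps)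
    also have "\<dots> \<le> \<bar>f x\<bar> * \<bar>g x - g y\<bar> + \<bar>g y\<bar> * \<bar>f x - f y\<bar>"
      by (metis abs_mult abs_triangle_ineq)
    also have "\<dots> \<le> A * (M * ?D) + B * (L * ?D)"
      using A B L M xy D by (intro add_mono mult_mono) auto
    finally show ?thesis by (simp add: algebra_simps)
  qed
  then show "(\<lambda>x. f x * g x) \<in> Collect (lipschitz_cube d)"
    using L M A B by (auto simp: lipschitz_cube_def intro!: continuous_intros exI[of _ "A * M + B * L"])
next
  fix x y :: "nat \<Rightarrow> real" assume xy: "x \<in> cube d" "y \<in> cube d" "x \<noteq> y"
  then obtain i where i: "x i \<noteq> y i" by blast
  then have "i < d" using xy by (metis (mono_tags, lifting) cube_def mem_Collect_eq not_le)
  then have "\<bar>u i - v i\<bar> \<le> 1 * (\<Sum>i<d. \<bar>u i - v i\<bar>)" for u v :: "nat \<Rightarrow> real"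
    using member_le_sum[of i "{..<d}" "\<lambda>i. \<bar>u i - v i\<bar>"] by simp
  then have "lipschitz_cube d (\<lambda>x. x i)"
    unfolding lipschitz_cube_def by (intro conjI exI[of _ 1] continuous_intros) auto
  then show "\<exists>f\<in>Collect (lipschitz_cube d). f x \<noteq> f y" using i by auto
qed (auto simp: lipschitz_cube_def compact_cube sum_nonneg intro!: continuous_intros exI[of _ 0])

lemma lipschitz_cube_approx:
  assumes "continuous_on (cube d) f" "\<epsilon> > 0"
  obtains g where "lipschitz_cube d g" "\<And>x. x \<in> cube d \<Longrightarrow> \<bar>f x - g x\<bar> < \<epsilon>"
  using function_ring_on.Stone_Weierstrass_basic[OF function_ring_lipschitz assms] by auto

section \<open>Surjectivity of the suspension\<close>

definition vnormalize :: "nat \<Rightarrow> (nat \<Rightarrow> real) \<Rightarrow> nat \<Rightarrow> real" where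
  "vnormalize m z = (\<lambda>i. if i \<le> m then z i / sqrt (\<Sum>j\<le>m. (z j)\<^sup>2) else 0)"

lemma sum_power2_pos: "i \<le> (m::nat) \<Longrightarrow> z i \<noteq> (0::real) \<Longrightarrow> (\<Sum>j\<le>m. (z j)\<^sup>2) > 0"
  by (rule sum_pos2[of _ i]) auto

lemma vnormalize_in_nsphere:
  assumes "\<exists>i\<le>m. z i \<noteq> 0"
  shows "vnormalize m z \<in> topspace (nsphere m)"
proof -
  have pos: "(\<Sum>j\<le>m. (z j)\<^sup>2) > 0" using assms sum_power2_pos by blast
  have "(\<Sum>i\<le>m. (vnormalize m z i)\<^sup>2) = (\<Sum>i\<le>m. (z i)\<^sup>2) / (\<Sum>j\<le>m. (z j)\<^sup>2)"
    unfolding sum_divide_distrib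
    by (rule sum.cong) (use pos in \<open>auto simp: vnormalize_def power_divide\<close>)
  then show ?thesis using pos by (simp add: topspace_nsphere vnormalize_def)
qed

lemma vnormalize_nsphere: "z \<in> topspace (nsphere m) \<Longrightarrow> vnormalize m z = z"
  by (auto simp: vnormalize_def topspace_nsphere fun_eq_iff)

lemma continuous_on_vnormalize:
  fixes h :: "'a::topological_space \<Rightarrow> nat \<Rightarrow> real"
  assumes h: "continuous_on S h" and nz: "\<And>x. x \<in> S \<Longrightarrow> \<exists>i\<le>m. h x i \<noteq> 0"
  shows "continuous_on S (\<lambda>x. vnormalize m (h x))"
proof (rule continuous_on_coordinatewise_then_product)
  fix i
  have hi: "continuous_on S (\<lambda>x. h x j)" for j
    using h by (rule continuous_on_product_then_coordinatewise)
  have "sqrt (\<Sum>j\<le>m. (h x j)\<^sup>2) \<noteq> 0" if "x \<in> S" for x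
    using nz[OF that] sum_power2_pos by force
  then show "continuous_on S (\<lambda>x. vnormalize m (h x) i)"
    unfolding vnormalize_def by (cases "i \<le> m") (auto intro!: continuous_intros hi)
qed

text \<open>The common tool for deformations into the sphere: a homotopy in Euclidean space
  qualifies as soon as it avoids the origin and equals the base point over the boundary. The
  coordinates of \<open>H\<close> beyond \<open>m\<close> are arbitrary; \<open>?H\<close> sets them
  to 0, since continuity into functions on \<open>nat\<close> concerns every coordinate.\<close>

lemma vnormalize_homotopy:
  assumes H: "\<And>i. i \<le> m \<Longrightarrow> continuous_on ({0..1} \<times> cube n) (\<lambda>z. H (fst z) (snd z) i)"
    and nz: "\<And>s x. 0 \<le> s \<Longrightarrow> s \<le> 1 \<Longrightarrow> x \<in> cube n \<Longrightarrow> \<exists>i\<le>m. H s x i \<noteq> 0"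
    and b: "\<And>s x i. 0 \<le> s \<Longrightarrow> s \<le> 1 \<Longrightarrow> x \<in> cube_boundary n \<Longrightarrow> i \<le> m \<Longrightarrow> H s x i = sphere_base i"
  shows "((\<lambda>x. vnormalize m (H (0::real) x)), (\<lambda>x. vnormalize m (H 1 x)))
      \<in> loop_homotopy n (nsphere m) sphere_base"
proof (rule loop_homotopyI[where H = "\<lambda>s x. vnormalize m (H s x)"])
  let ?H = "\<lambda>z i. if i \<le> m then H (fst z) (snd z) i else 0"
  have eq: "vnormalize m (H s x) = vnormalize m (?H (s, x))" for s x
    by (auto simp: vnormalize_def fun_eq_iff)
  have "continuous_on ({0..1} \<times> cube n) (\<lambda>z. vnormalize m (?H z))"
  proof (rule continuous_on_vnormalize)
    show "continuous_on ({0..1} \<times> cube n) ?H"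
    proof (rule continuous_on_coordinatewise_then_product)
      show "continuous_on ({0..1} \<times> cube n) (\<lambda>z. ?H z i)" for i
        using H[of i] by (cases "i \<le> m") auto
    qed
    show "\<exists>i\<le>m. ?H z i \<noteq> 0" if "z \<in> {0..1} \<times> cube n" for z
      using nz[of "fst z" "snd z"] that by auto
  qed
  moreover have img: "vnormalize m (?H (s, x)) \<in> topspace (nsphere m)" if "s \<in> {0..1}" "x \<in> cube n" for s x
    using vnormalize_in_nsphere[OF nz[of s x]] that by (simp only: eq atLeastAtMost_iff)
  ultimately show "continuous_map (top_of_set ({0..1} \<times> cube n)) (nsphere m) (\<lambda>(s, x). vnormalize m (H s x))"
    unfolding continuous_map_nsphere_iff case_prod_unfold eq
    by (auto cong: if_cong)
  show "vnormalize m (H s x) = sphere_base" if "s \<in> {0..1}" "x \<in> cube_boundary n" for s x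
  proof -
    have "vnormalize m (H s x) = vnormalize m sphere_base"
      using b[of s x] that by (auto simp: vnormalize_def fun_eq_iff)
    then show ?thesis by (simp add: vnormalize_nsphere)
  qed
qed

lemma continuous_on_nsphere_loop:
  assumes "f \<in> cube_loops n (nsphere m) a"
  shows "continuous_on (cube n) f" "x \<in> cube n \<Longrightarrow> f x \<in> topspace (nsphere m)"
  using cube_loopsD(1)[OF assms] by (auto simp: cube_space_eq continuous_map_nsphere_iff)

text \<open>The last property: no line in the last coordinate direction meets both the preimage of the ray through
  \<open>(v, 1)\<close> and that of the ray through \<open>(w, -1)\<close>.\<close>

lemma loop_general_position:
  assumes n: "n \<ge> 1" and m: "m = Suc n" and f: "f \<in> cube_loops m (nsphere m) sphere_base"
  obtains h v w where "\<And>i. i \<le> m \<Longrightarrow> continuous_on (cube m) (\<lambda>x. h x i)"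
    "\<And>x. x \<in> cube m \<Longrightarrow> \<exists>i\<le>m. h x i \<noteq> 0"
    "\<And>x i. x \<in> cube_boundary m \<Longrightarrow> i \<le> m \<Longrightarrow> h x i = sphere_base i"
    "(f, \<lambda>x. vnormalize m (h x)) \<in> loop_homotopy m (nsphere m) sphere_base"
    "\<And>x y. x \<in> cube m \<Longrightarrow> y \<in> cube m \<Longrightarrow> x(n := 0) = y(n := 0) \<Longrightarrow>
       \<not> (h x m > 0 \<and> (\<forall>i<m. h x i = v i * h x m) \<and> h y m < 0 \<and> (\<forall>i<m. h y i = w i * (- h y m)))"
proof -
  \<comment> \<open>\<open>N\<close> counts the coordinates. An error \<epsilon> in each of them
    changes the scalar product with \<open>f x\<close> by at most
    \<open>\<epsilon> * N = 1/100\<close>, and \<open>c + \<epsilon> \<le> 1 / N\<close> will bound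
    the last coordinate from below on the rays.\<close>
  define N where "N = real m + 1"
  have N: "N \<ge> 3" using n m by (simp add: N_def)
  define \<epsilon> where "\<epsilon> = 1 / (100 * N)"
  have \<epsilon>: "\<epsilon> > 0" "\<epsilon> * N = 1/100" "\<epsilon> \<le> 1/100" using N by (simp_all add: \<epsilon>_def field_simps)
  define c where "c = 1 / (2 * N)"
  have c: "c > 0" using N by (simp add: c_def)
  have fc: "continuous_on (cube m) (\<lambda>x. f x i)" for i
    using continuous_on_nsphere_loop(1)[OF f] by (rule continuous_on_product_then_coordinatewise)
  have fS: "(\<Sum>i\<le>m. (f x i)\<^sup>2) = 1" if "x \<in> cube m" for x
    using continuous_on_nsphere_loop(2)[OF f that] by (simp add: topspace_nsphere)
  have "\<forall>i. \<exists>g. lipschitz_cube m g \<and> (\<forall>x\<in>cube m. \<bar>f x i - g x\<bar> < \<epsilon>)"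
    using lipschitz_cube_approx[OF fc \<epsilon>(1)] by metis
  then obtain P where P: "\<And>i. lipschitz_cube m (P i)" "\<And>i x. x \<in> cube m \<Longrightarrow> \<bar>f x i - P i x\<bar> < \<epsilon>"
    by metis
  \<comment> \<open>A cutoff that is 0 where \<open>f x\<close> is the base point and 1 as soon as
    \<open>f x 0 \<le> 3/4\<close>: \<open>h\<close> keeps the base point over the boundary and
    equals \<open>P\<close> farther away from it.\<close>
  define \<theta> where "\<theta> x = min 1 (4 * (1 - f x 0))" for x
  have \<theta>: "0 \<le> \<theta> x" "\<theta> x \<le> 1" if "x \<in> cube m" for x
    using nsphere_coord_0(1)[OF continuous_on_nsphere_loop(2)[OF f that]] by (auto simp: \<theta>_def)
  define h where "h x i = f x i + \<theta> x * (P i x - f x i)" for x i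
  have near: "\<bar>h x i - f x i\<bar> \<le> \<epsilon>" if "x \<in> cube m" for x i
  proof -
    have "\<bar>h x i - f x i\<bar> = \<theta> x * \<bar>P i x - f x i\<bar>" using \<theta>[OF that] by (simp add: h_def abs_mult)
    also have "\<dots> \<le> 1 * \<epsilon>" using \<theta>[OF that] P(2)[OF that, of i] by (intro mult_mono) auto
    finally show ?thesis by simp
  qed
  have Pc: "continuous_on (cube m) (P i)" for i using P(1) by (simp add: lipschitz_cube_def)
  have hc: "continuous_on (cube m) (\<lambda>x. h x i)" for i
    unfolding h_def \<theta>_def by (intro continuous_intros fc Pc)
  have f1: "\<bar>f x i\<bar> \<le> 1" if "x \<in> cube m" "i \<le> m" for x i
  proof -
    have "(f x i)\<^sup>2 \<le> (\<Sum>i\<le>m. (f x i)\<^sup>2)" using that by (intro member_le_sum) auto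
    then show ?thesis using fS[OF that(1)] by (simp add: abs_square_le_1)
  qed
  have nz: "\<exists>i\<le>m. (1 - s) * f x i + s * h x i \<noteq> 0" if s: "0 \<le> s" "s \<le> 1" and x: "x \<in> cube m" for s x
  proof (rule ccontr)
    assume "\<not> ?thesis"
    then have 0: "(1 - s) * f x i + s * h x i = 0" if "i \<le> m" for i using that by blast
    \<comment> \<open>The scalar product of \<open>f x\<close> with the supposedly vanishing vector
      would be at least \<open>1 - \<epsilon> * N\<close>.\<close>
    have "1 = (\<Sum>i\<le>m. (f x i)\<^sup>2 - f x i * ((1 - s) * f x i + s * h x i))" using 0 fS[OF x] by simp
    also have "\<dots> \<le> (\<Sum>i\<le>m. \<epsilon>)"
    proof (rule sum_mono)
      fix i assume i: "i \<in> {..m}"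
      have "(f x i)\<^sup>2 - f x i * ((1 - s) * f x i + s * h x i) = s * (f x i * (f x i - h x i))"
        by (simp add: power2_eq_square algebra_simps)
      also have "\<dots> \<le> \<bar>s\<bar> * (\<bar>f x i\<bar> * \<bar>f x i - h x i\<bar>)"
        by (simp flip: abs_mult)
      also have "\<dots> \<le> 1 * (1 * \<epsilon>)"
        using s f1[OF x] near[OF x, of i] i by (intro mult_mono) (auto simp: abs_minus_commute)
      finally show "(f x i)\<^sup>2 - f x i * ((1 - s) * f x i + s * h x i) \<le> \<epsilon>" by simp
    qed
    also have "\<dots> = \<epsilon> * N" by (simp add: N_def algebra_simps)
    finally show False using \<epsilon> by simp
  qed
  have bdy: "h x i = sphere_base i" if "x \<in> cube_boundary m" for x i
    using cube_loopsD(2)[OF f that] by (simp add: h_def \<theta>_def sphere_base_def)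
  have "((\<lambda>x. vnormalize m (\<lambda>i. (1 - 0) * f x i + 0 * h x i)), (\<lambda>x. vnormalize m (\<lambda>i. (1 - 1) * f x i + 1 * h x i)))
      \<in> loop_homotopy m (nsphere m) sphere_base"
  proof (rule vnormalize_homotopy[where H = "\<lambda>s x i. (1 - s) * f x i + s * h x i"])
    show "continuous_on ({0..1} \<times> cube m) (\<lambda>z. (1 - fst z) * f (snd z) i + fst z * h (snd z) i)" for i
      by (intro continuous_intros continuous_on_compose2[OF fc] continuous_on_compose2[OF hc]) auto
    show "(1 - s) * f x i + s * h x i = sphere_base i" if "x \<in> cube_boundary m" for s x i
      using cube_loopsD(2)[OF f that] bdy[OF that] by (simp add: algebra_simps)
  qed (rule nz)
  then have fh: "((\<lambda>x. vnormalize m (f x)), (\<lambda>x. vnormalize m (h x))) \<in> loop_homotopy m (nsphere m) sphere_base"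
    by simp
  have "(f, (\<lambda>x. vnormalize m (f x))) \<in> loop_homotopy m (nsphere m) sphere_base"
    by (rule loop_homotopy_cong[OF f]) (simp add: vnormalize_nsphere[OF continuous_on_nsphere_loop(2)[OF f]])
  then have hom: "(f, (\<lambda>x. vnormalize m (h x))) \<in> loop_homotopy m (nsphere m) sphere_base"
    by (rule loop_homotopy_trans[OF _ fh])
  \<comment> \<open>On such a ray \<open>h\<close> agrees with the Lipschitz map \<open>P\<close>: the correction \<open>\<theta>\<close> only acts near the base point.\<close>
  have ray: "P i x = h x i \<and> c \<le> \<bar>h x m\<bar>"
    if x: "x \<in> cube m" and a: "h x m \<noteq> 0" and u: "\<And>i. i < m \<Longrightarrow> \<bar>h x i\<bar> \<le> \<bar>h x m\<bar>"
      and u0: "0 \<le> h x 0" for x i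
  proof -
    have "\<theta> x = 1"
    proof (rule ccontr)
      assume "\<theta> x \<noteq> 1"
      then have f0: "f x 0 > 3/4" by (auto simp: \<theta>_def min_def split: if_splits)
      \<comment> \<open>Domination by the last coordinate would make both \<open>f x 0\<close> and
        \<open>f x m\<close> large in absolute value, but
        \<open>(3/4)\<^sup>2 + (7/10)\<^sup>2 > 1\<close>.\<close>
      have "h x 0 \<le> \<bar>h x m\<bar>" using u[of 0] m by simp
      then have fm: "\<bar>f x m\<bar> > 7/10" using near[OF x, of 0] near[OF x, of m] f0 \<epsilon>(3) by linarith
      have "(f x 0)\<^sup>2 + (f x m)\<^sup>2 = (\<Sum>i\<in>{0, m}. (f x i)\<^sup>2)" using m by simp
      also have "\<dots> \<le> (\<Sum>i\<le>m. (f x i)\<^sup>2)" by (rule sum_mono2) auto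
      finally have "(f x 0)\<^sup>2 + (f x m)\<^sup>2 \<le> 1" using fS[OF x] by simp
      moreover have "(3/4)\<^sup>2 < (f x 0)\<^sup>2" using f0 by (intro power_strict_mono) auto
      moreover have "(7/10)\<^sup>2 < \<bar>f x m\<bar>\<^sup>2" using fm by (intro power_strict_mono) auto
      ultimately show False by (simp add: power2_eq_square)
    qed
    moreover have "c \<le> \<bar>h x m\<bar>"
    proof (rule ccontr)
      \<comment> \<open>As the last coordinate dominates, all \<open>N\<close> coordinates of
        \<open>f x\<close> would be at most \<open>1 / N\<close> in absolute value, too small for a
        unit vector.\<close>
      assume "\<not> c \<le> \<bar>h x m\<bar>"
      then have "\<bar>f x i\<bar> \<le> 1 / N" if "i \<le> m" for i
      proof -
        have "\<bar>h x i\<bar> \<le> \<bar>h x m\<bar>" using u[of i] that by (cases "i = m") auto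
        moreover have "c + \<epsilon> \<le> 1 / N" using N by (simp add: c_def \<epsilon>_def field_simps)
        ultimately show ?thesis using near[OF x, of i] \<open>\<not> c \<le> \<bar>h x m\<bar>\<close> by linarith
      qed
      then have "(f x i)\<^sup>2 \<le> (1 / N)\<^sup>2" if "i \<le> m" for i
        using that power_mono[of "\<bar>f x i\<bar>" "1 / N" 2] by simp
      then have "(\<Sum>i\<le>m. (f x i)\<^sup>2) \<le> (\<Sum>i\<le>m. (1 / N)\<^sup>2)" by (intro sum_mono) auto
      also have "\<dots> = N * (1 / N)\<^sup>2" by (simp add: N_def)
      also have "\<dots> = 1 / N" using N by (simp add: power2_eq_square)
      finally show False using fS[OF x] N by (simp add: field_simps)
    qed
    ultimately show ?thesis by (simp add: h_def)
  qed
  obtain L where L: "\<And>i. L i \<ge> 0" "\<And>i x y. x \<in> cube m \<Longrightarrow> y \<in> cube m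
      \<Longrightarrow> \<bar>P i x - P i y\<bar> \<le> L i * (\<Sum>j<m. \<bar>x j - y j\<bar>)"
    using P(1) unfolding lipschitz_cube_def by metis
  define \<Lambda> where "\<Lambda> = (\<Sum>i\<le>m. L i) * m"
  have lip: "\<bar>P i x - P i y\<bar> \<le> \<Lambda> * \<eta>"
    if x: "x \<in> cube m" and y: "y \<in> cube m" and i: "i \<le> m" and \<eta>: "0 < \<eta>"
      and xy: "\<And>j. j < m \<Longrightarrow> \<bar>x j - y j\<bar> \<le> \<eta>" for i x y \<eta>
  proof -
    have "\<bar>P i x - P i y\<bar> \<le> L i * (\<Sum>j<m. \<bar>x j - y j\<bar>)" by (rule L(2)[OF x y])
    also have "\<dots> \<le> (\<Sum>i\<le>m. L i) * (\<Sum>j<m. \<eta>)"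
      using L(1) i xy \<eta> by (intro mult_mono sum_mono member_le_sum sum_nonneg) auto
    finally show ?thesis by (simp add: \<Lambda>_def)
  qed
  \<comment> \<open>A pair of points on a line in direction \<open>n\<close> is encoded by one point
    \<open>z\<close> of the cube of dimension \<open>n + 2\<close>: the coordinates below
    \<open>n\<close> are shared, and \<open>z n\<close> and \<open>z m\<close> are the two
    heights.\<close>
  define X Y :: "(nat \<Rightarrow> real) \<Rightarrow> nat \<Rightarrow> real"
    where "X z = z(m := 0)" and "Y z = z(n := z m, m := 0)" for z
  have XY: "X z \<in> cube m" "Y z \<in> cube m" if "z \<in> cube (Suc m)" for z
    using that m by (auto simp: X_def Y_def cube_def)
  \<comment> \<open>The slopes of both rays form one point \<open>u\<close> of the cube of dimension
    \<open>2 * m\<close>. The relation uses \<open>P\<close>, for which a Lipschitz bound is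
    available, and the bound \<open>c\<close> on the denominators makes the slopes Lipschitz in
    \<open>z\<close>.\<close>
  define Rel where "Rel z u \<longleftrightarrow>
      c \<le> P m (X z) \<and> (\<forall>i<m. P i (X z) = u i * P m (X z)) \<and>
      c \<le> - P m (Y z) \<and> (\<forall>i<m. P i (Y z) = u (m + i) * (- P m (Y z)))" for z u :: "nat \<Rightarrow> real"
  obtain u where u: "u \<in> cube (2 * m)" "\<And>z. z \<in> cube (Suc m) \<Longrightarrow> \<not> Rel z u"
  proof (rule lipschitz_relation_misses_point[of "Suc m" "2 * m" Rel "2 * \<Lambda> / c"])
    show "Suc m < 2 * m" using n m by simp
    fix z z' u u' :: "nat \<Rightarrow> real" and \<eta> :: real
    assume z: "z \<in> cube (Suc m)" "z' \<in> cube (Suc m)" and u: "u \<in> cube (2 * m)" "u' \<in> cube (2 * m)"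
      and R: "Rel z u" "Rel z' u'" and \<eta>: "\<And>i. i < Suc m \<Longrightarrow> \<bar>z i - z' i\<bar> \<le> \<eta>" "0 < \<eta>"
    \<comment> \<open>A quotient rule for the slopes \<open>a = p / q\<close>: in
      \<open>(a - a') * q = (p - p') - a' * (q - q')\<close> the slope \<open>a'\<close> is at most
      1 and \<open>q\<close> is at least \<open>c\<close>, whence the constant
      \<open>2 * \<Lambda> / c\<close>.\<close>
    have est: "\<bar>a - a'\<bar> \<le> 2 * \<Lambda> / c * \<eta>"
      if "p = a * q" "p' = a' * q'" "c \<le> q" "\<bar>p - p'\<bar> \<le> \<Lambda> * \<eta>" "\<bar>q - q'\<bar> \<le> \<Lambda> * \<eta>" "0 \<le> a'" "a' \<le> 1"
      for a a' p p' q q'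
    proof -
      have "\<bar>a - a'\<bar> * c \<le> \<bar>a - a'\<bar> * q" using that by (intro mult_left_mono) auto
      also have "\<dots> = \<bar>(a - a') * q\<bar>" using that c by (simp add: abs_mult)
      also have "(a - a') * q = (p - p') - a' * (q - q')" using that by (simp add: algebra_simps)
      also have "\<bar>(p - p') - a' * (q - q')\<bar> \<le> \<bar>p - p'\<bar> + \<bar>a'\<bar> * \<bar>q - q'\<bar>"
        by (metis abs_mult abs_triangle_ineq4)
      also have "\<dots> \<le> \<Lambda> * \<eta> + 1 * (\<Lambda> * \<eta>)" using that by (intro add_mono mult_mono) auto
      finally show ?thesis using c by (simp add: field_simps)
    qed
    have close: "\<bar>X z j - X z' j\<bar> \<le> \<eta>" "\<bar>Y z j - Y z' j\<bar> \<le> \<eta>" if "j < m" for j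
      using \<eta> that m by (auto simp: X_def Y_def)
    have dX: "\<bar>P i (X z) - P i (X z')\<bar> \<le> \<Lambda> * \<eta>" if "i \<le> m" for i
      by (rule lip) (use XY z that \<eta> close in auto)
    have dY: "\<bar>P i (Y z) - P i (Y z')\<bar> \<le> \<Lambda> * \<eta>" if "i \<le> m" for i
      by (rule lip) (use XY z that \<eta> close in auto)
    show "\<forall>i<2 * m. \<bar>u i - u' i\<bar> \<le> 2 * \<Lambda> / c * \<eta>"
    proof (intro allI impI)
      fix i assume i: "i < 2 * m"
      then have u': "0 \<le> u' i" "u' i \<le> 1" using u(2) by (auto simp: cube_def)
      show "\<bar>u i - u' i\<bar> \<le> 2 * \<Lambda> / c * \<eta>"
      proof (cases "i < m")
        case True
        show ?thesis
          by (rule est[of "P i (X z)" _ "P m (X z)" "P i (X z')" _ "P m (X z')"])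
             (use True R u' dX[of i] dX[of m] in \<open>auto simp: Rel_def\<close>)
      next
        case False
        then obtain j where j: "i = m + j" "j < m" using i by (metis add_less_cancel_left le_add_diff_inverse mult_2 not_less)
        show ?thesis
          by (rule est[of "P j (Y z)" _ "- P m (Y z)" "P j (Y z')" _ "- P m (Y z')"])
             (use j R u' dY[of j] dY[of m] in \<open>auto simp: Rel_def abs_minus_commute\<close>)
      qed
    qed
  qed blast
  have u01: "0 \<le> u i" "u i \<le> 1" if "i < 2 * m" for i using u(1) that by (auto simp: cube_def)
  have avoid: "\<not> (h x m > 0 \<and> (\<forall>i<m. h x i = u i * h x m) \<and> h y m < 0 \<and> (\<forall>i<m. h y i = u (m + i) * (- h y m)))"
    if x: "x \<in> cube m" and y: "y \<in> cube m" and xy: "x(n := 0) = y(n := 0)" for x y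
  proof
    assume *: "h x m > 0 \<and> (\<forall>i<m. h x i = u i * h x m) \<and> h y m < 0 \<and> (\<forall>i<m. h y i = u (m + i) * (- h y m))"
    \<comment> \<open>Slopes in \<open>[0, 1]\<close> give exactly the two inequalities under which
      \<open>h\<close> and \<open>P\<close> agree.\<close>
    have hx: "P i x = h x i \<and> c \<le> \<bar>h x m\<bar>" for i
    proof (rule ray[OF x])
      show "\<bar>h x i\<bar> \<le> \<bar>h x m\<bar>" if "i < m" for i
        using * that u01[of i] mult_right_mono[of "u i" 1 "h x m"] by (simp add: abs_mult)
      show "0 \<le> h x 0" using * m u01[of 0] by (simp add: zero_le_mult_iff)
    qed (use * in auto)
    have hy: "P i y = h y i \<and> c \<le> \<bar>h y m\<bar>" for i
    proof (rule ray[OF y])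
      show "\<bar>h y i\<bar> \<le> \<bar>h y m\<bar>" if "i < m" for i
        using * that u01[of "m + i"] mult_right_mono[of "u (m + i)" 1 "- h y m"] by (simp add: abs_mult)
      show "0 \<le> h y 0" using * m u01[of m] by (auto simp: mult_le_0_iff)
    qed (use * in auto)
    \<comment> \<open>\<open>x m = 0\<close>, so slot \<open>m\<close> is free to hold the height of
      \<open>y\<close>; since \<open>x\<close> and \<open>y\<close> differ at most in coordinate
      \<open>n\<close>, this recovers \<open>y\<close> as \<open>Y z\<close>.\<close>
    define z where "z = x(m := y n)"
    have z: "z \<in> cube (Suc m)" using x y m by (auto simp: z_def cube_def)
    have Xz: "X z = x" using x by (auto simp: X_def z_def cube_def)
    have "Y z = x(n := y n, m := 0)" using m by (auto simp: Y_def z_def fun_eq_iff)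
    also have "x(n := y n) = y" using xy by (metis fun_upd_triv fun_upd_upd)
    also have "y(m := 0) = y" using y by (auto simp: cube_def)
    finally have Yz: "Y z = y" .
    have "Rel z u" using * hx hy unfolding Rel_def Xz Yz by auto
    then show False using u(2)[OF z] by blast
  qed
  have nz1: "\<exists>i\<le>m. h x i \<noteq> 0" if "x \<in> cube m" for x
    using nz[of 1 x] that by auto
  show ?thesis
    by (rule that[of h u "\<lambda>i. u (m + i)"]) (use hc nz1 bdy hom avoid in auto)
qed

text \<open>A shear on each of the half spaces moves the two rays to the coordinate axis.\<close>

lemma loop_avoid_common_poles:
  assumes n: "n \<ge> 1" and m: "m = Suc n" and f: "f \<in> cube_loops m (nsphere m) sphere_base"
  obtains k where "\<And>i. i \<le> m \<Longrightarrow> continuous_on (cube m) (\<lambda>x. k x i)"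
    "\<And>x. x \<in> cube m \<Longrightarrow> \<exists>i\<le>m. k x i \<noteq> 0"
    "\<And>x i. x \<in> cube_boundary m \<Longrightarrow> i \<le> m \<Longrightarrow> k x i = sphere_base i"
    "(f, \<lambda>x. vnormalize m (k x)) \<in> loop_homotopy m (nsphere m) sphere_base"
    "\<And>x y. x \<in> cube m \<Longrightarrow> y \<in> cube m \<Longrightarrow> x(n := 0) = y(n := 0) \<Longrightarrow>
       \<not> (k x m > 0 \<and> (\<forall>i<m. k x i = 0) \<and> k y m < 0 \<and> (\<forall>i<m. k y i = 0))"
proof -
  obtain h v w where h: "\<And>i. i \<le> m \<Longrightarrow> continuous_on (cube m) (\<lambda>x. h x i)"
    "\<And>x. x \<in> cube m \<Longrightarrow> \<exists>i\<le>m. h x i \<noteq> 0"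
    "\<And>x i. x \<in> cube_boundary m \<Longrightarrow> i \<le> m \<Longrightarrow> h x i = sphere_base i"
    "(f, \<lambda>x. vnormalize m (h x)) \<in> loop_homotopy m (nsphere m) sphere_base"
    "\<And>x y. x \<in> cube m \<Longrightarrow> y \<in> cube m \<Longrightarrow> x(n := 0) = y(n := 0) \<Longrightarrow>
       \<not> (h x m > 0 \<and> (\<forall>i<m. h x i = v i * h x m) \<and> h y m < 0 \<and> (\<forall>i<m. h y i = w i * (- h y m)))"
    using loop_general_position[OF assms] by blast
  \<comment> \<open>The last coordinate is kept and the shear is trivial where it vanishes, so the
    origin is avoided for every \<open>s\<close>. At \<open>s = 1\<close> the points over the two
    rays are exactly those over the two half axes.\<close>
  define H where "H s x i = (if i = m then h x m
      else h x i - s * (v i * max 0 (h x m) + w i * max 0 (- h x m)))" for s :: real and x i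
  have nz: "\<exists>i\<le>m. H s x i \<noteq> 0" if "x \<in> cube m" for s x
  proof (cases "h x m = 0")
    case True
    then obtain i where "i \<le> m" "h x i \<noteq> 0" using h(2) \<open>x \<in> cube m\<close> by blast
    then show ?thesis using True by (intro exI[of _ i]) (auto simp: H_def)
  qed (auto simp: H_def)
  have bdy: "H s x i = sphere_base i" if "x \<in> cube_boundary m" "i \<le> m" for s x i
  proof -
    have "h x m = 0" using h(3)[OF that(1), of m] m by (simp add: sphere_base_def)
    then show ?thesis using h(3)[OF that] by (auto simp: H_def)
  qed
  have cont: "continuous_on ({0..1} \<times> cube m) (\<lambda>z. H (fst z) (snd z) i)" if "i \<le> m" for i
    unfolding H_def using that
    by (cases "i = m") (auto intro!: continuous_intros continuous_on_compose2[OF h(1)])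
  have H0: "H 0 = h" by (auto simp: H_def fun_eq_iff)
  have "((\<lambda>x. vnormalize m (H 0 x)), (\<lambda>x. vnormalize m (H 1 x))) \<in> loop_homotopy m (nsphere m) sphere_base"
    by (rule vnormalize_homotopy) (use cont nz bdy in auto)
  then have "(f, \<lambda>x. vnormalize m (H 1 x)) \<in> loop_homotopy m (nsphere m) sphere_base"
    unfolding H0 by (rule loop_homotopy_trans[OF h(4)])
  moreover have "continuous_on (cube m) (\<lambda>x. H 1 x i)" if "i \<le> m" for i
    unfolding H_def using that by (cases "i = m") (auto intro!: continuous_intros h(1))
  moreover have "\<not> (H 1 x m > 0 \<and> (\<forall>i<m. H 1 x i = 0) \<and> H 1 y m < 0 \<and> (\<forall>i<m. H 1 y i = 0))"
    if "x \<in> cube m" "y \<in> cube m" "x(n := 0) = y(n := 0)" for x y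
    using h(5)[OF that] by (auto simp: H_def max_def split: if_splits)
  ultimately show ?thesis using nz bdy by (intro that[of "H 1"]) auto
qed

lemma continuous_on_components:
  fixes k :: "'a::topological_space \<Rightarrow> nat \<Rightarrow> real"
  assumes "\<And>i. i \<le> m \<Longrightarrow> continuous_on S (\<lambda>x. k x i)"
  shows "continuous_on S (\<lambda>x i. if i \<le> m then k x i else 0)"
proof (rule continuous_on_coordinatewise_then_product)
  show "continuous_on S (\<lambda>x. if i \<le> m then k x i else 0)" for i
    using assms[of i] by (cases "i \<le> m") auto
qed

text \<open>Reparametrizing the last coordinate: over the projection of the preimage of the south pole the
  map is squeezed into the upper half of the cube, over that of the north pole into the lower half.\<close>

lemma loop_separate_poles:
  assumes n: "n \<ge> 1" and m: "m = Suc n" and f: "f \<in> cube_loops m (nsphere m) sphere_base"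
  obtains k where "\<And>i. i \<le> m \<Longrightarrow> continuous_on (cube m) (\<lambda>x. k x i)"
    "\<And>x. x \<in> cube m \<Longrightarrow> \<exists>i\<le>m. k x i \<noteq> 0"
    "\<And>x i. x \<in> cube_boundary m \<Longrightarrow> i \<le> m \<Longrightarrow> k x i = sphere_base i"
    "(f, \<lambda>x. vnormalize m (k x)) \<in> loop_homotopy m (nsphere m) sphere_base"
    "\<And>x. x \<in> cube m \<Longrightarrow> \<forall>i<m. k x i = 0 \<Longrightarrow> x n \<le> 1/2 \<Longrightarrow> k x m > 0"
    "\<And>x. x \<in> cube m \<Longrightarrow> \<forall>i<m. k x i = 0 \<Longrightarrow> x n \<ge> 1/2 \<Longrightarrow> k x m < 0"
proof -
  obtain k where k: "\<And>i. i \<le> m \<Longrightarrow> continuous_on (cube m) (\<lambda>x. k x i)"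
    "\<And>x. x \<in> cube m \<Longrightarrow> \<exists>i\<le>m. k x i \<noteq> 0"
    "\<And>x i. x \<in> cube_boundary m \<Longrightarrow> i \<le> m \<Longrightarrow> k x i = sphere_base i"
    "(f, \<lambda>x. vnormalize m (k x)) \<in> loop_homotopy m (nsphere m) sphere_base"
    "\<And>x y. x \<in> cube m \<Longrightarrow> y \<in> cube m \<Longrightarrow> x(n := 0) = y(n := 0) \<Longrightarrow>
       \<not> (k x m > 0 \<and> (\<forall>i<m. k x i = 0) \<and> k y m < 0 \<and> (\<forall>i<m. k y i = 0))"
    using loop_avoid_common_poles[OF assms] by blast
  define pr :: "(nat \<Rightarrow> real) \<Rightarrow> nat \<Rightarrow> real" where "pr x = x(n := 0)" for x
  have pr: "pr x \<in> cube n" if "x \<in> cube m" for x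
    using that m by (simp add: pr_def cube_Suc_proj)
  have prc: "continuous_on S pr" for S unfolding pr_def by (intro continuous_intros)
  \<comment> \<open>The preimages of the two half axes, for \<sigma> = 1 and \<sigma> = -1. The weak
    inequality makes them closed; it is in fact strict because \<open>k\<close> does not
    vanish.\<close>
  define A where "A \<sigma> = {x \<in> cube m. (\<forall>i<m. k x i = 0) \<and> 0 \<le> \<sigma> * k x m}" for \<sigma> :: real
  have comp: "compact (A \<sigma>)" for \<sigma>
  proof -
    have "closedin (top_of_set (cube m)) (A \<sigma>)"
    proof -
      have "A \<sigma> = (\<Inter>i\<in>{..<m}. {x \<in> cube m. k x i = 0}) \<inter> {x \<in> cube m. 0 \<le> \<sigma> * k x m}"
        using m by (auto simp: A_def)
      also have "closedin (top_of_set (cube m)) \<dots>"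
      proof (intro closedin_Int closedin_INT)
        show "closedin (top_of_set (cube m)) {x \<in> cube m. k x i = 0}" if "i \<in> {..<m}" for i
          using that continuous_closedin_preimage_constant[OF k(1)[of i], of 0] by simp
        show "closedin (top_of_set (cube m)) {x \<in> cube m. 0 \<le> \<sigma> * k x m}"
          using continuous_closedin_preimage[of "cube m" "\<lambda>x. \<sigma> * k x m" "{0..}"] k(1)[of m]
          by (simp add: vimage_def Int_def continuous_on_mult_left)
      qed (use m in auto)
      finally show ?thesis .
    qed
    then show ?thesis using compact_cube closedin_compact by blast
  qed
  have sign: "0 < \<sigma> * k x m" if "x \<in> A \<sigma>" "\<sigma> \<noteq> 0" for x \<sigma>
  proof -
    have "k x m \<noteq> 0" using that k(2)[of x] by (auto simp: A_def le_less)
    then show ?thesis using that by (auto simp: A_def less_le)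
  qed
  \<comment> \<open>Having no common line means that the two preimages have disjoint projections, so
    a Urysohn function on the \<open>n\<close>-cube can choose between two
    reparametrizations.\<close>
  have disj: "pr ` A 1 \<inter> pr ` A (-1) = {}"
  proof -
    have False if "x \<in> A 1" "y \<in> A (-1)" "pr x = pr y" for x y
      using k(5)[of x y] sign[OF that(1)] sign[OF that(2)] that by (simp add: A_def pr_def) blast
    then show ?thesis by blast
  qed
  have cl: "closedin (top_of_set (cube n)) (pr ` A \<sigma>)" for \<sigma>
  proof (rule closed_subset)
    show "pr ` A \<sigma> \<subseteq> cube n" using pr by (auto simp: A_def)
    show "closed (pr ` A \<sigma>)" by (intro compact_imp_closed compact_continuous_image prc comp)
  qed
  obtain \<phi> where \<phi>: "continuous_map (top_of_set (cube n)) (top_of_set {0..1::real}) \<phi>"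
    "\<phi> ` (pr ` A 1) \<subseteq> {0}" "\<phi> ` (pr ` A (-1)) \<subseteq> {1}"
  proof (rule Urysohn_lemma[of "top_of_set (cube n)" "pr ` A 1" "pr ` A (-1)" 0 1])
    show "normal_space (top_of_set (cube n))"
      by (intro compact_Hausdorff_or_regular_imp_normal_space compact_space_subtopology)
         (auto simp: compact_cube Hausdorff_space_subtopology)
    show "closedin (top_of_set (cube n)) (pr ` A 1)" "closedin (top_of_set (cube n)) (pr ` A (-1))"
      by (rule cl)+
  qed (use disj in \<open>auto simp: disjnt_def\<close>)
  have \<phi>c: "continuous_on (cube n) \<phi>" and \<phi>01: "\<And>x. x \<in> cube n \<Longrightarrow> 0 \<le> \<phi> x \<and> \<phi> x \<le> 1"
    using \<phi>(1) by (auto simp: continuous_map_in_subtopology)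
  \<comment> \<open>Where \<phi> is 0, the segment is traversed for \<open>x n \<le> 1/2\<close> and
    the end 1 is held afterwards; where \<phi> is 1, the end 0 is held before the segment is
    traversed for \<open>x n \<ge> 1/2\<close>.\<close>
  define \<tau> where "\<tau> x = \<phi> (pr x) * max 0 (2 * x n - 1) + (1 - \<phi> (pr x)) * min 1 (2 * x n)" for x
  have \<tau>01: "\<tau> x \<in> {0..1}" if "x \<in> cube m" for x
  proof -
    have x: "0 \<le> x n" "x n \<le> 1" using that m by (auto simp: cube_def)
    note p = \<phi>01[OF pr[OF that]]
    have "\<tau> x \<le> \<phi> (pr x) * 1 + (1 - \<phi> (pr x)) * 1"
      unfolding \<tau>_def using x p by (intro add_mono mult_left_mono) auto
    then show ?thesis using x p by (auto simp: \<tau>_def)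
  qed
  have \<tau>c: "continuous_on (cube m) \<tau>"
    unfolding \<tau>_def using pr by (intro continuous_intros continuous_on_compose2[OF \<phi>c prc]) auto
  have \<tau>e: "\<tau> x = x n" if "x n = 0 \<or> x n = 1" for x using that by (auto simp: \<tau>_def)
  define T where "T x = x(n := \<tau> x)" for x
  have T: "T x \<in> cube m" if "x \<in> cube m" for x
    using that \<tau>01[OF that] m by (auto simp: T_def intro!: cube_upd)
  have Tb: "T x \<in> cube_boundary m" if "x \<in> cube_boundary m" for x
    using that \<tau>01[of x] \<tau>e[of x] cube_boundary_subset m unfolding T_def
    by (intro cube_boundary_upd') auto
  have Tc: "continuous_on (cube m) T" unfolding T_def by (intro continuous_intros \<tau>c)
  have prT: "pr (T x) = pr x" for x by (simp add: pr_def T_def)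
  \<comment> \<open>On the faces \<open>x n = 0\<close> and \<open>x n = 1\<close> the map is the
    base point, whose coordinate 0 is 1. So no pole is attained where \<tau> holds an end.\<close>
  have end_b: "k (x(n := t)) 0 \<noteq> 0" if "x \<in> cube m" "t = 0 \<or> t = 1" for x t
    using k(3)[of "x(n := t)" 0] cube_boundary_upd[OF that(1), of n t] that(2) m by (simp add: sphere_base_def)
  have north: "k (T x) m > 0" if x: "x \<in> cube m" and 0: "\<forall>i<m. k (T x) i = 0" and h: "x n \<le> 1/2" for x
  proof (rule ccontr)
    assume "\<not> k (T x) m > 0"
    then have "T x \<in> A (-1)" using T[OF x] 0 by (simp add: A_def)
    then have "\<phi> (pr (T x)) = 1" using \<phi>(3) by blast
    then have "\<tau> x = 0" using h by (simp add: \<tau>_def prT)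
    then show False using 0 end_b[OF x, of 0] m by (simp add: T_def)
  qed
  have south: "k (T x) m < 0" if x: "x \<in> cube m" and 0: "\<forall>i<m. k (T x) i = 0" and h: "x n \<ge> 1/2" for x
  proof (rule ccontr)
    assume "\<not> k (T x) m < 0"
    then have "T x \<in> A 1" using T[OF x] 0 by (simp add: A_def)
    then have "\<phi> (pr (T x)) = 0" using \<phi>(2) by blast
    then have "\<tau> x = 1" using h by (simp add: \<tau>_def prT)
    then show False using 0 end_b[OF x, of 1] m by (simp add: T_def)
  qed
  have "((\<lambda>x. (\<lambda>x. vnormalize m (k x)) (x(n := x n))), (\<lambda>x. (\<lambda>x. vnormalize m (k x)) (x(n := \<tau> x))))
      \<in> loop_homotopy m (nsphere m) sphere_base"
    by (rule loop_homotopy_reparam_coord[OF loop_homotopy_loops(2)[OF k(4)]])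
       (use m \<tau>c \<tau>01 \<tau>e in \<open>auto simp: cube_def intro!: continuous_intros\<close>)
  then have "((\<lambda>x. vnormalize m (k x)), (\<lambda>x. vnormalize m (k (T x)))) \<in> loop_homotopy m (nsphere m) sphere_base"
    by (simp add: T_def)
  then have "(f, (\<lambda>x. vnormalize m (k (T x)))) \<in> loop_homotopy m (nsphere m) sphere_base"
    by (rule loop_homotopy_trans[OF k(4)])
  moreover have "continuous_on (cube m) (\<lambda>x. k (T x) i)" if "i \<le> m" for i
    using T by (intro continuous_on_compose2[OF k(1)[OF that] Tc]) auto
  ultimately show ?thesis
    using k(2)[OF T] k(3)[OF Tb] north south by (intro that[of "\<lambda>x. k (T x)"]) auto
qed

section \<open>Comparison with a suspension\<close>

lemma reduced_susp_half: "y \<in> topspace (nsphere r) \<Longrightarrow> reduced_susp r y (1/2) = y"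
  by (auto simp: reduced_susp_def topspace_nsphere fun_eq_iff field_simps)

lemma susp_loop_in_nsphere:
  "f \<in> cube_loops n (nsphere r) sphere_base \<Longrightarrow> x \<in> cube (Suc n) \<Longrightarrow> susp_loop n r f x \<in> topspace (nsphere (Suc r))"
  unfolding susp_loop_def
  by (rule reduced_susp_in_nsphere[OF continuous_on_nsphere_loop(2)[OF _ cube_Suc_proj]])

lemma susp_loop_boundary:
  assumes "f \<in> cube_loops n (nsphere r) sphere_base" "x \<in> cube_boundary (Suc n)"
  shows "susp_loop n r f x = sphere_base"
proof -
  have x: "x \<in> cube (Suc n)" using assms(2) cube_boundary_subset by blast
  show ?thesis unfolding susp_loop_def
    by (rule reduced_susp_collapse[OF continuous_on_nsphere_loop(2)[OF assms(1) cube_Suc_proj[OF x]]])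
       (use assms cube_loopsD(2)[OF assms(1)] in \<open>auto simp: cube_boundary_Suc\<close>)
qed

lemma susp_loop_loops:
  assumes f: "f \<in> cube_loops n (nsphere r) sphere_base"
  shows "susp_loop n r f \<in> cube_loops (Suc n) (nsphere (Suc r)) sphere_base"
  unfolding cube_loops_def cube_space_eq continuous_map_nsphere_iff
  using continuous_on_susp_loop[OF continuous_on_nsphere_loop(1)[OF f]] susp_loop_in_nsphere[OF f]
    susp_loop_boundary[OF f] by auto

text \<open>The equator corresponds to the slice \<open>x n = 1/2\<close>. Separation of the poles
  allows the last coordinate to be given the sign of \<open>1 - 2 * x n\<close>. The resulting map
  is joined by straight lines to the suspension of its restriction to the slice: in the interior off
  the slice the last coordinates never have opposite signs, and on the slice the two maps are
  positively proportional.\<close>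

lemma loop_homotopic_to_susp_loop:
  assumes n: "n \<ge> 1" and f: "f \<in> cube_loops (Suc n) (nsphere (Suc n)) sphere_base"
  obtains g where "g \<in> cube_loops n (nsphere n) sphere_base"
    "(f, susp_loop n n g) \<in> loop_homotopy (Suc n) (nsphere (Suc n)) sphere_base"
proof -
  define m where "m = Suc n"
  obtain k where k: "\<And>i. i \<le> m \<Longrightarrow> continuous_on (cube m) (\<lambda>x. k x i)"
    "\<And>x. x \<in> cube m \<Longrightarrow> \<exists>i\<le>m. k x i \<noteq> 0"
    "\<And>x i. x \<in> cube_boundary m \<Longrightarrow> i \<le> m \<Longrightarrow> k x i = sphere_base i"
    "(f, \<lambda>x. vnormalize m (k x)) \<in> loop_homotopy m (nsphere m) sphere_base"
    "\<And>x. x \<in> cube m \<Longrightarrow> \<forall>i<m. k x i = 0 \<Longrightarrow> x n \<le> 1/2 \<Longrightarrow> k x m > 0"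
    "\<And>x. x \<in> cube m \<Longrightarrow> \<forall>i<m. k x i = 0 \<Longrightarrow> x n \<ge> 1/2 \<Longrightarrow> k x m < 0"
    using loop_separate_poles[OF n m_def] f unfolding m_def by blast
  \<comment> \<open>A bump that on the cube is positive exactly in the interior: it keeps the new
    last coordinate nonzero off the slice even where \<open>k x m = 0\<close>, without disturbing
    the boundary.\<close>
  define \<xi> where "\<xi> x = (\<Prod>i<m. x i * (1 - x i))" for x :: "nat \<Rightarrow> real"
  have \<xi>0: "\<xi> x = 0" if "x \<in> cube_boundary m" for x
    using that by (auto simp: \<xi>_def cube_boundary_def)
  have \<xi>pos: "\<xi> x > 0" if "x \<in> cube m" "x \<notin> cube_boundary m" for x
    unfolding \<xi>_def using that by (intro prod_pos) (force simp: cube_boundary_def cube_def less_le)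
  have \<xi>nn: "\<xi> x \<ge> 0" if "x \<in> cube m" for x
    using \<xi>pos[OF that] \<xi>0[of x] by force
  have \<xi>c: "continuous_on S \<xi>" for S unfolding \<xi>_def by (intro continuous_intros)
  define H where "H s x i = (if i < m then k x i
      else (1 - s) * k x m + s * ((1 - 2 * x n) * (\<bar>k x m\<bar> + \<xi> x)))" for s x i
  define Q where "Q x i = (if i < m then k x i else (1 - 2 * x n) * (\<bar>k x m\<bar> + \<xi> x))" for x i
  have kc: "continuous_on T (\<lambda>z. k (g z) i)" if "continuous_on T g" "g ` T \<subseteq> cube m" "i \<le> m"
    for T :: "'z::topological_space set" and g i
    by (rule continuous_on_compose2[OF k(1)[OF that(3)] that(1)]) (use that in auto)
  have Hc: "continuous_on ({0..1} \<times> cube m) (\<lambda>z. H (fst z) (snd z) i)" if "i \<le> m" for i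
    using that unfolding H_def
    by (cases "i < m") (auto intro!: continuous_intros kc continuous_on_compose2[OF \<xi>c])
  have km0: "k x m = 0" if "x \<in> cube_boundary m" for x
    using k(3)[OF that, of m] by (simp add: m_def sphere_base_def)
  have Hb: "H s x i = sphere_base i" if "x \<in> cube_boundary m" "i \<le> m" for s x i
    using k(3)[OF that] km0[OF that(1)] \<xi>0[OF that(1)] that(2) by (auto simp: H_def m_def sphere_base_def)
  have Hnz: "\<exists>i\<le>m. H s x i \<noteq> 0" if s: "0 \<le> s" "s \<le> 1" and x: "x \<in> cube m" for s x
  proof (cases "\<forall>i<m. k x i = 0")
    case True
    \<comment> \<open>At \<open>x n = 1/2\<close> the two sign conditions on \<open>k x m\<close>
      contradict each other.\<close>
    consider "x n < 1/2" | "x n > 1/2" using k(5,6)[OF x True] by fastforce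
    then show ?thesis
    proof cases
      case 1
      then have km: "k x m > 0" using k(5)[OF x True] by simp
      have *: "(1 - 2 * x n) * (\<bar>k x m\<bar> + \<xi> x) > 0" using 1 km \<xi>nn[OF x] by (intro mult_pos_pos) auto
      have "H s x m > 0"
        using s km * by (cases "s = 1") (auto simp: H_def intro!: add_pos_nonneg)
      then show ?thesis by (intro exI[of _ m]) simp
    next
      case 2
      then have km: "k x m < 0" using k(6)[OF x True] by simp
      have *: "(1 - 2 * x n) * (\<bar>k x m\<bar> + \<xi> x) < 0" using 2 km \<xi>nn[OF x] by (intro mult_neg_pos) auto
      have "H s x m < 0"
        using s km * by (cases "s = 1") (auto simp: H_def mult_pos_neg mult_nonneg_nonpos intro!: add_neg_nonpos)
      then show ?thesis by (intro exI[of _ m]) simp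
    qed
  next
    case False
    then obtain i where "i < m" "k x i \<noteq> 0" by blast
    then show ?thesis by (intro exI[of _ i]) (simp add: H_def)
  qed
  have "((\<lambda>x. vnormalize m (H 0 x)), (\<lambda>x. vnormalize m (H 1 x))) \<in> loop_homotopy m (nsphere m) sphere_base"
    by (rule vnormalize_homotopy) (use Hc Hnz Hb in auto)
  moreover have "vnormalize m (H 0 x) = vnormalize m (k x)" for x
    by (auto simp: vnormalize_def H_def fun_eq_iff intro!: sum.cong arg_cong[where f = sqrt] arg_cong2[where f = "(/)"])
  moreover have HQ: "H 1 = Q" by (auto simp: H_def Q_def fun_eq_iff)
  ultimately have fQ: "(f, (\<lambda>x. vnormalize m (Q x))) \<in> loop_homotopy m (nsphere m) sphere_base"
    using loop_homotopy_trans[OF k(4)] by simp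
  have Qb: "Q x i = sphere_base i" if "x \<in> cube_boundary m" "i \<le> m" for x i
    using Hb[OF that, of 1] by (simp add: HQ)
  have Qnz: "\<exists>i\<le>m. Q x i \<noteq> 0" if "x \<in> cube m" for x
    using Hnz[of 1 x] that by (simp add: HQ)
  have Qc: "continuous_on (cube m) (\<lambda>x. Q x i)" if "i \<le> m" for i
    using that unfolding Q_def
    by (cases "i < m") (auto intro!: continuous_intros kc continuous_on_compose2[OF \<xi>c])
  \<comment> \<open>On the slice the last coordinate of \<open>Q\<close> is 0, so normalizing the
    remaining ones gives a point of the \<open>n\<close>-sphere.\<close>
  define g where "g y = vnormalize n (Q (y(n := 1/2)))" for y
  have mid: "y(n := 1/2) \<in> cube m" if "y \<in> cube n" for y :: "nat \<Rightarrow> real"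
    using that by (auto simp: m_def intro!: cube_Suc_upd)
  have gnz: "\<exists>i\<le>n. Q (y(n := 1/2)) i \<noteq> 0" if y: "y \<in> cube n" for y
  proof -
    obtain i where i: "i \<le> m" "Q (y(n := 1/2)) i \<noteq> 0" using Qnz[OF mid[OF y]] by blast
    then have "i \<noteq> m" by (auto simp: Q_def)
    then show ?thesis using i by (intro exI[of _ i]) (simp add: m_def)
  qed
  have g: "g \<in> cube_loops n (nsphere n) sphere_base"
  proof -
    have eq: "g y = vnormalize n (\<lambda>i. if i \<le> n then Q (y(n := 1/2)) i else 0)" for y
      by (auto simp: g_def vnormalize_def fun_eq_iff)
    have "continuous_on (cube n) (\<lambda>y. Q (y(n := 1/2)) i)" if "i \<le> n" for i
      using that mid by (intro continuous_on_compose2[OF Qc]) (auto simp: m_def intro!: continuous_intros)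
    then have "continuous_on (cube n) g"
      unfolding eq using gnz by (intro continuous_on_vnormalize continuous_on_components) auto
    moreover have "g y \<in> topspace (nsphere n)" if "y \<in> cube n" for y
      unfolding g_def by (rule vnormalize_in_nsphere[OF gnz[OF that]])
    moreover have "g y = sphere_base" if y: "y \<in> cube_boundary n" for y
    proof -
      have "y \<in> cube n" using y cube_boundary_subset by blast
      then have "y(n := 1/2) \<in> cube_boundary m"
        using y mid unfolding m_def by (force simp: cube_boundary_def)
      then have "g y = vnormalize n sphere_base"
        using Qb by (auto simp: g_def vnormalize_def fun_eq_iff m_def)
      then show ?thesis by (simp add: vnormalize_nsphere)
    qed
    ultimately show ?thesis
      by (auto simp: cube_loops_def cube_space_eq continuous_map_nsphere_iff)
  qed
  define S where "S = susp_loop n n g"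
  have S: "S \<in> cube_loops m (nsphere m) sphere_base"
    unfolding S_def m_def by (rule susp_loop_loops[OF g])
  note Sin = continuous_on_nsphere_loop(2)[OF S]
  have Sc: "continuous_on (cube m) (\<lambda>x. S x i)" for i
    by (rule continuous_on_product_then_coordinatewise[OF continuous_on_nsphere_loop(1)[OF S]])
  have Sm: "S x m = sin (2 * pi * x n) * (sqrt (\<Sum>j\<le>n. (g (x(n := 0)) j - sphere_base j)\<^sup>2) / 2)" for x
    by (simp add: S_def susp_loop_def reduced_susp_def m_def)
  have SQnz: "\<exists>i\<le>m. (1 - s) * Q x i + s * S x i \<noteq> 0"
    if s: "0 \<le> s" "s \<le> 1" and x: "x \<in> cube m" for s x
  proof -
    \<comment> \<open>At \<open>s = 1\<close> only the unit vector \<open>S x\<close> is left. This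
      value is treated apart because \<open>S x m\<close> may vanish off the slice, where strictness
      comes from \<open>Q\<close> alone.\<close>
    have nz1: ?thesis if "s = 1"
    proof -
      have "S x \<in> topspace (nsphere m)" by (rule Sin[OF x])
      then have "(\<Sum>i\<le>m. (S x i)\<^sup>2) \<noteq> 0" by (simp add: topspace_nsphere)
      then have "\<exists>i\<le>m. S x i \<noteq> 0" by (metis (mono_tags, lifting) atMost_iff power_zero_numeral sum.neutral)
      then show ?thesis using that by simp
    qed
    have xn: "0 \<le> x n" "x n \<le> 1" using x by (auto simp: cube_def m_def)
    consider "x \<in> cube_boundary m" | "x \<notin> cube_boundary m" "x n < 1/2" | "x \<notin> cube_boundary m" "x n > 1/2" | "x n = 1/2"
      by linarith
    then show ?thesis
    proof cases
      case 1
      have "(1 - s) * Q x 0 + s * S x 0 = 1"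
        using Qb[OF 1, of 0] cube_loopsD(2)[OF S 1] by (simp add: sphere_base_def)
      then show ?thesis by (intro exI[of _ 0]) simp
    next
      case 2
      have "Q x m > 0" using 2 \<xi>pos[OF x] by (auto simp: Q_def intro!: mult_pos_pos add_nonneg_pos)
      moreover have "S x m \<ge> 0"
        unfolding Sm using 2 xn by (intro mult_nonneg_nonneg sin_ge_zero) (auto intro!: sum_nonneg)
      ultimately have "s \<noteq> 1 \<Longrightarrow> (1 - s) * Q x m + s * S x m > 0"
        using s by (intro add_pos_nonneg mult_pos_pos) auto
      then show ?thesis using nz1 by (cases "s = 1") (auto intro!: exI[of _ m])
    next
      case 3
      have "Q x m < 0" using 3 \<xi>pos[OF x] by (auto simp: Q_def intro!: mult_neg_pos add_nonneg_pos)
      moreover have "S x m \<le> 0"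
      proof -
        have "x n \<noteq> 1" using 3 x by (auto simp: cube_boundary_def m_def)
        then have "sin (2 * pi * x n) \<le> 0" using 3 xn by (intro sin_le_zero) auto
        then show ?thesis unfolding Sm by (intro mult_nonpos_nonneg) (auto intro!: sum_nonneg)
      qed
      ultimately have "s \<noteq> 1 \<Longrightarrow> (1 - s) * Q x m + s * S x m < 0"
        using s by (intro add_neg_nonpos mult_pos_neg mult_nonneg_nonpos) auto
      then show ?thesis using nz1 by (cases "s = 1") (auto intro!: exI[of _ m])
    next
      case 4
      define y where "y = x(n := 0)"
      have y: "y \<in> cube n" using x by (simp add: y_def m_def cube_Suc_proj)
      have yx: "y(n := 1/2) = x" using 4 by (auto simp: y_def)
      obtain i where i: "i \<le> n" "Q x i \<noteq> 0" using gnz[OF y] yx by auto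
      define r where "r = sqrt (\<Sum>j\<le>n. (Q x j)\<^sup>2)"
      have r: "r > 0" using sum_power2_pos[of i n "Q x"] i by (simp add: r_def)
      \<comment> \<open>The suspension circle of \<open>g y\<close> passes through
        \<open>g y\<close> itself at parameter 1/2, so that \<open>S x\<close> is a positive
        multiple of \<open>Q x\<close>.\<close>
      have "S x = g y"
        unfolding S_def susp_loop_def 4 y_def[symmetric]
        by (rule reduced_susp_half[OF continuous_on_nsphere_loop(2)[OF g y]])
      then have "S x i = Q x i / r" using i(1) by (simp add: g_def yx vnormalize_def r_def)
      then have "(1 - s) * Q x i + s * S x i = ((1 - s) + s / r) * Q x i" by (simp add: algebra_simps)
      moreover have "(1 - s) + s / r > 0" using s r by (cases "s = 1") (auto intro!: add_pos_nonneg)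
      ultimately show ?thesis using i by (intro exI[of _ i]) (auto simp: m_def)
    qed
  qed
  have "((\<lambda>x. vnormalize m (\<lambda>i. (1 - 0) * Q x i + 0 * S x i)), (\<lambda>x. vnormalize m (\<lambda>i. (1 - 1) * Q x i + 1 * S x i)))
      \<in> loop_homotopy m (nsphere m) sphere_base"
  proof (rule vnormalize_homotopy[where H = "\<lambda>s x i. (1 - s) * Q x i + s * S x i"])
    show "continuous_on ({0..1} \<times> cube m) (\<lambda>z. (1 - fst z) * Q (snd z) i + fst z * S (snd z) i)" if "i \<le> m" for i
      by (intro continuous_intros continuous_on_compose2[OF Qc[OF that]] continuous_on_compose2[OF Sc]) auto
    show "(1 - s) * Q x i + s * S x i = sphere_base i" if "x \<in> cube_boundary m" "i \<le> m" for s x i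
      using Qb[OF that] cube_loopsD(2)[OF S that(1)] by (simp add: algebra_simps)
  qed (rule SQnz)
  then have QS: "((\<lambda>x. vnormalize m (Q x)), (\<lambda>x. vnormalize m (S x))) \<in> loop_homotopy m (nsphere m) sphere_base"
    by simp
  have SS: "((\<lambda>x. vnormalize m (S x)), S) \<in> loop_homotopy m (nsphere m) sphere_base"
    by (rule loop_homotopy_sym, rule loop_homotopy_cong[OF S]) (simp add: vnormalize_nsphere[OF Sin])
  have "(f, S) \<in> loop_homotopy m (nsphere m) sphere_base"
    by (rule loop_homotopy_trans[OF fQ loop_homotopy_trans[OF QS SS]])
  then show ?thesis using that[OF g] by (simp add: m_def S_def)
qed

section \<open>The suspension homomorphism\<close>

lemma susp_loop_homotopy:
  assumes "(f, g) \<in> loop_homotopy n (nsphere r) sphere_base"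
  shows "(susp_loop n r f, susp_loop n r g) \<in> loop_homotopy (Suc n) (nsphere (Suc r)) sphere_base"
proof -
  obtain H where H: "continuous_map (top_of_set ({0..1::real} \<times> cube n)) (nsphere r) (\<lambda>(s, x). H s x)"
    "\<And>s x. s \<in> {0..1} \<Longrightarrow> x \<in> cube_boundary n \<Longrightarrow> H s x = sphere_base" "H 0 = f" "H 1 = g"
    using loop_homotopyE[OF assms] by blast
  have Hc: "continuous_on ({0..1} \<times> cube n) (\<lambda>(s, x). H s x)"
    and Hin: "\<And>s x. s \<in> {0..1} \<Longrightarrow> x \<in> cube n \<Longrightarrow> H s x \<in> topspace (nsphere r)"
    using H(1) by (auto simp: continuous_map_nsphere_iff image_subset_iff)
  let ?S = "\<lambda>s. susp_loop n r (H s)"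
  have "(?S 0, ?S 1) \<in> loop_homotopy (Suc n) (nsphere (Suc r)) sphere_base"
  proof (rule loop_homotopyI)
    have "continuous_on ({0..1} \<times> cube (Suc n))
        (\<lambda>z. (\<lambda>(s, x). H s x) (fst z, (snd z)(n := 0)))"
      by (rule continuous_on_compose2[OF Hc]) (auto intro!: continuous_intros cube_Suc_proj)
    then have "continuous_on ({0..1} \<times> cube (Suc n)) (\<lambda>z. reduced_susp r (H (fst z) ((snd z)(n := 0))) (snd z n))"
      by (intro continuous_on_reduced_susp continuous_intros) simp
    then show "continuous_map (top_of_set ({0..1} \<times> cube (Suc n))) (nsphere (Suc r)) (\<lambda>(s, x). ?S s x)"
      using Hin by (auto simp: continuous_map_nsphere_iff case_prod_unfold susp_loop_def
          intro!: reduced_susp_in_nsphere Hin cube_Suc_proj)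
    show "?S s x = sphere_base" if s: "s \<in> {0..1}" and x: "x \<in> cube_boundary (Suc n)" for s x
    proof -
      have x': "x(n := 0) \<in> cube n" using x cube_boundary_subset[of "Suc n"] by (auto intro: cube_Suc_proj)
      show ?thesis unfolding susp_loop_def
        by (rule reduced_susp_collapse[OF Hin[OF s x']])
           (use x H(2)[OF s] in \<open>auto simp: cube_boundary_Suc\<close>)
    qed
  qed
  then show ?thesis using H by simp
qed

lemma suspension_hom_class:
  assumes "f \<in> cube_loops n (nsphere r) sphere_base"
  shows "suspension_hom n r (loop_class n (nsphere r) sphere_base f)
       = loop_class (Suc n) (nsphere (Suc r)) sphere_base (susp_loop n r f)"
  unfolding suspension_hom_def
  by (rule UN_equiv_class[OF equiv_loop_homotopy _ assms])
     (auto simp: congruent_def intro!: loop_class_eqI susp_loop_homotopy)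

text \<open>An equality of functions and not merely a homotopy: coordinates 0 and \<open>n\<close>
  are different, so the two updates commute.\<close>

lemma susp_loop_concat:
  "n \<ge> 1 \<Longrightarrow> susp_loop n r (loop_concat f g) = loop_concat (susp_loop n r f) (susp_loop n r g)"
  by (auto simp: susp_loop_def loop_concat_def fun_eq_iff fun_upd_twist)

lemma suspension_hom_hom:
  assumes n: "n \<ge> 1"
  shows "suspension_hom n r \<in> hom (sphere_homotopy_group n r) (sphere_homotopy_group (Suc n) (Suc r))"
proof (rule homI)
  fix A assume A: "A \<in> carrier (sphere_homotopy_group n r)"
  obtain f where f: "f \<in> cube_loops n (nsphere r) sphere_base" "A = loop_class n (nsphere r) sphere_base f"
    using carrier_homotopy_groupE[OF A] .
  then show "suspension_hom n r A \<in> carrier (sphere_homotopy_group (Suc n) (Suc r))"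
    by (simp add: suspension_hom_class loop_class_in_carrier susp_loop_loops)
  fix B assume B: "B \<in> carrier (sphere_homotopy_group n r)"
  obtain g where g: "g \<in> cube_loops n (nsphere r) sphere_base" "B = loop_class n (nsphere r) sphere_base g"
    using carrier_homotopy_groupE[OF B] .
  show "suspension_hom n r (A \<otimes>\<^bsub>sphere_homotopy_group n r\<^esub> B)
      = suspension_hom n r A \<otimes>\<^bsub>sphere_homotopy_group (Suc n) (Suc r)\<^esub> suspension_hom n r B"
    using n f g by (simp add: mult_loop_class suspension_hom_class loop_concat_loops susp_loop_concat susp_loop_loops)
qed

section \<open>The fundamental group of the circle\<close>

definition angle_loop :: "(real \<Rightarrow> real) \<Rightarrow> (nat \<Rightarrow> real) \<Rightarrow> nat \<Rightarrow> real" where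
  "angle_loop \<theta> x = (\<lambda>i. if i = 0 then cos (\<theta> (x 0)) else if i = 1 then sin (\<theta> (x 0)) else 0)"

lemma cube_1: "x \<in> cube 1 \<Longrightarrow> x 0 \<in> {0..1}" "x \<in> cube_boundary 1 \<Longrightarrow> x 0 = 0 \<or> x 0 = 1"
  by (auto simp: cube_def cube_boundary_def)

lemma angle_loop_base: "angle_loop \<theta> x = sphere_base" if "\<theta> (x 0) = 2 * pi * of_int k"
  unfolding angle_loop_def that by (auto simp: sphere_base_def)

text \<open>Lifts with the same ends are interpolated linearly on the real line; at both ends the
  angle stays an integral multiple of the full turn.\<close>

lemma angle_loop_homotopy:
  assumes \<theta>: "continuous_on {0..1} \<theta>" "\<theta> 0 = 0" "\<theta> 1 = 2 * pi * of_int k"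
    and \<psi>: "continuous_on {0..1} \<psi>" "\<psi> 0 = 0" "\<psi> 1 = 2 * pi * of_int k"
  shows "(angle_loop \<theta>, angle_loop \<psi>) \<in> loop_homotopy 1 (nsphere 1) sphere_base"
proof -
  define H where "H s = angle_loop (\<lambda>t. (1 - s) * \<theta> t + s * \<psi> t)" for s
  have "(H 0, H 1) \<in> loop_homotopy 1 (nsphere 1) sphere_base"
  proof (rule loop_homotopyI)
    have c: "continuous_on ({0..1::real} \<times> cube 1) (\<lambda>z. (1 - fst z) * \<theta> (snd z 0) + fst z * \<psi> (snd z 0))"
      by (intro continuous_intros continuous_on_compose2[OF \<theta>(1)] continuous_on_compose2[OF \<psi>(1)])
         (use cube_1 in auto)
    have "continuous_on ({0..1::real} \<times> cube 1) (\<lambda>z. H (fst z) (snd z))"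
    proof (rule continuous_on_coordinatewise_then_product)
      fix i
      show "continuous_on ({0..1::real} \<times> cube 1) (\<lambda>z. H (fst z) (snd z) i)"
        unfolding H_def angle_loop_def
        by (cases "i = 0"; cases "i = 1") (use c in \<open>auto intro!: continuous_on_cos continuous_on_sin\<close>)
    qed
    then show "continuous_map (top_of_set ({0..1} \<times> cube 1)) (nsphere 1) (\<lambda>(s, x). H s x)"
      by (auto simp: continuous_map_nsphere_iff case_prod_unfold topspace_nsphere H_def angle_loop_def)
    show "H s x = sphere_base" if "x \<in> cube_boundary 1" for s x
    proof -
      have "\<exists>j::int. (1 - s) * \<theta> (x 0) + s * \<psi> (x 0) = 2 * pi * of_int j"
        using cube_1(2)[OF that] \<theta> \<psi> by (auto simp: algebra_simps intro: exI[of _ 0] exI[of _ k])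
      then obtain j :: int where j: "(1 - s) * \<theta> (x 0) + s * \<psi> (x 0) = 2 * pi * of_int j" by blast
      show ?thesis unfolding H_def by (rule angle_loop_base[where k = j]) (rule j)
    qed
  qed
  then show ?thesis by (simp add: H_def)
qed

abbreviation winding_loop :: "int \<Rightarrow> (nat \<Rightarrow> real) \<Rightarrow> nat \<Rightarrow> real" where
  "winding_loop k \<equiv> angle_loop (\<lambda>t. 2 * pi * of_int k * t)"

lemma winding_loop_loops: "winding_loop k \<in> cube_loops 1 (nsphere 1) sphere_base"
  using loop_homotopy_loops(1)[OF angle_loop_homotopy[of "\<lambda>t. 2 * pi * of_int k * t" k "\<lambda>t. 2 * pi * of_int k * t"]]
  by (auto intro!: continuous_intros)

lemma winding_loop_concat:
  "(loop_concat (winding_loop k) (winding_loop l), winding_loop (k + l)) \<in> loop_homotopy 1 (nsphere 1) sphere_base"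
proof -
  \<comment> \<open>The clamps let each lift rest while the other runs; on the second half the
    \<open>k\<close> full turns already made drop out of sine and cosine.\<close>
  let ?\<theta> = "\<lambda>t. 2 * pi * of_int k * min 1 (2 * t) + 2 * pi * of_int l * max 0 (2 * t - 1)"
  have "(angle_loop ?\<theta>, winding_loop (k + l)) \<in> loop_homotopy 1 (nsphere 1) sphere_base"
    by (rule angle_loop_homotopy[where k = "k + l"]) (auto intro!: continuous_intros simp: algebra_simps)
  moreover have "angle_loop ?\<theta> = loop_concat (winding_loop k) (winding_loop l)"
  proof
    fix x :: "nat \<Rightarrow> real"
    show "angle_loop ?\<theta> x = loop_concat (winding_loop k) (winding_loop l) x"
      by (cases "x 0 \<le> 1/2")
         (auto simp: angle_loop_def loop_concat_def fun_eq_iff min_absorb2 min_absorb1 cos_add sin_add)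
  qed
  ultimately show ?thesis by simp
qed

text \<open>Links the circle to the induction: the loop of winding number 1 is exactly the generator
  used in all dimensions.\<close>

lemma winding_loop_1: "winding_loop 1 = cube_sphere 1"
  by (auto simp: fun_eq_iff angle_loop_def susp_loop_def reduced_susp_def sphere_base_def)

lemma loop_homotopic_to_winding_loop:
  assumes f: "f \<in> cube_loops 1 (nsphere 1) sphere_base"
  obtains k where "(f, winding_loop k) \<in> loop_homotopy 1 (nsphere 1) sphere_base"
proof -
  define pt where "pt t = (\<lambda>i::nat. if i = 0 then t else 0)" for t :: real
  have pt: "pt t \<in> cube 1" if "t \<in> {0..1}" for t using that by (auto simp: pt_def cube_def)
  have ptx: "pt (x 0) = x" if "x \<in> cube 1" for x using that by (auto simp: pt_def cube_def fun_eq_iff)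
  have ptc: "continuous_on S pt" for S
  proof (rule continuous_on_coordinatewise_then_product)
    show "continuous_on S (\<lambda>t. pt t i)" for i by (cases "i = 0") (auto simp: pt_def)
  qed
  have fc: "continuous_on (cube 1) (\<lambda>x. f x i)" for i
    using continuous_on_nsphere_loop(1)[OF f] by (rule continuous_on_product_then_coordinatewise)
  have fS: "(f x 0)\<^sup>2 + (f x 1)\<^sup>2 = 1 \<and> (\<forall>i>1. f x i = 0)" if "x \<in> cube 1" for x
    using continuous_on_nsphere_loop(2)[OF f that] by (simp add: topspace_nsphere)
  define \<gamma> where "\<gamma> t = Complex (f (pt t) 0) (f (pt t) 1)" for t
  have norm: "cmod (\<gamma> t) = 1" if "t \<in> {0..1}" for t
    using fS[OF pt[OF that]] by (simp add: \<gamma>_def cmod_def)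
  have "continuous_on {0..1} \<gamma>"
    unfolding \<gamma>_def complex_eq using pt
    by (intro continuous_intros continuous_on_compose2[OF fc ptc]) auto
  moreover have "\<gamma> t \<noteq> 0" if "t \<in> {0..1}" for t using norm[OF that] by auto
  moreover have "contractible {0..1::real}" by (intro convex_imp_contractible) simp
  \<comment> \<open>The imaginary part of a logarithm serves as lift; the logarithm exists because
    the interval is contractible.\<close>
  ultimately obtain g where g: "continuous_on {0..1} g" "\<And>t. t \<in> {0..1} \<Longrightarrow> \<gamma> t = exp (g t)"
    using continuous_logarithm_on_contractible[of "{0..1::real}" \<gamma>] by blast
  have ends: "\<exists>n::int. Im (g t) = 2 * pi * of_int n" if "t = 0 \<or> t = 1" for t
  proof -
    have "pt t \<in> cube_boundary 1" using that by (auto simp: pt_def cube_boundary_def cube_def)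
    then have "\<gamma> t = 1" using cube_loopsD(2)[OF f] by (simp add: \<gamma>_def sphere_base_def complex_eq_iff)
    then have "exp (g t) = 1" using g(2)[of t] that by auto
    then show ?thesis unfolding exp_eq_1 by (auto simp: algebra_simps)
  qed
  obtain a b :: int where ab: "Im (g 0) = 2 * pi * of_int a" "Im (g 1) = 2 * pi * of_int b"
    using ends[of 0] ends[of 1] by auto
  \<comment> \<open>Shifting by whole turns makes the lift start at 0, as the comparison of lifts
    requires.\<close>
  define \<theta> where "\<theta> t = Im (g t) - 2 * pi * of_int a" for t
  have \<theta>w: "(angle_loop \<theta>, winding_loop (b - a)) \<in> loop_homotopy 1 (nsphere 1) sphere_base"
    by (rule angle_loop_homotopy[where k = "b - a"]) (auto simp: \<theta>_def ab algebra_simps intro!: continuous_intros g(1))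
  have "(f, angle_loop \<theta>) \<in> loop_homotopy 1 (nsphere 1) sphere_base"
  proof (rule loop_homotopy_cong[OF f])
    fix x assume x: "x \<in> cube 1"
    then have t: "x 0 \<in> {0..1}" by (rule cube_1)
    have "Re (g (x 0)) = 0" using norm[OF t] by (simp add: g(2)[OF t])
    then have "\<gamma> (x 0) = Complex (cos (Im (g (x 0)))) (sin (Im (g (x 0))))"
      using g(2)[OF t] by (simp add: complex_eq_iff Re_exp Im_exp)
    then have "f x 0 = cos (\<theta> (x 0)) \<and> f x 1 = sin (\<theta> (x 0))"
      by (simp add: \<gamma>_def ptx[OF x] \<theta>_def cos_diff sin_diff)
    moreover have "f x i = 0" if "i \<noteq> 0" "i \<noteq> 1" for i using fS[OF x] that by simp
    ultimately show "f x = angle_loop \<theta> x" by (auto simp: angle_loop_def fun_eq_iff)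
  qed
  then show ?thesis by (rule that[OF loop_homotopy_trans[OF _ \<theta>w]])
qed

section \<open>The groups \<open>\<pi>\<^sub>n(S\<^sup>n)\<close>\<close>

abbreviation sphere_gen :: "nat \<Rightarrow> ((nat \<Rightarrow> real) \<Rightarrow> nat \<Rightarrow> real) set" where
  "sphere_gen n \<equiv> loop_class n (nsphere n) sphere_base (cube_sphere n)"

lemma group_sphere_homotopy_group: "n \<ge> 1 \<Longrightarrow> group (sphere_homotopy_group n r)"
  by (rule group_homotopy_group) auto

lemma sphere_gen_carrier: "sphere_gen n \<in> carrier (sphere_homotopy_group n n)"
  by (rule loop_class_in_carrier[OF cube_sphere_loop])

lemma suspension_hom_gen: "suspension_hom n n (sphere_gen n) = sphere_gen (Suc n)"
  by (simp add: suspension_hom_class[OF cube_sphere_loop])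

lemma suspension_hom_gen_pow:
  assumes "n \<ge> 1"
  shows "suspension_hom n n (sphere_gen n [^]\<^bsub>sphere_homotopy_group n n\<^esub> (k::int))
       = sphere_gen (Suc n) [^]\<^bsub>sphere_homotopy_group (Suc n) (Suc n)\<^esub> k"
  unfolding suspension_hom_gen[symmetric]
  by (rule hom_int_pow[OF suspension_hom_hom[OF assms] sphere_gen_carrier])
     (use assms in \<open>auto intro: group_sphere_homotopy_group\<close>)

text \<open>Winding loops are the image of a homomorphism from the integers, so the class with
  winding number \<open>k\<close> is the \<open>k\<close>-th power of the generator; lifting shows
  that every class is of this form.\<close>

lemma circle_homotopy_group_cyclic:
  assumes A: "A \<in> carrier (sphere_homotopy_group 1 1)"
  shows "\<exists>k::int. A = sphere_gen 1 [^]\<^bsub>sphere_homotopy_group 1 1\<^esub> k"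
proof -
  let ?G = "sphere_homotopy_group 1 1"
  let ?w = "\<lambda>k. loop_class 1 (nsphere 1) sphere_base (winding_loop k)"
  have "?w \<in> hom integer_group ?G"
    by (rule homI)
       (simp_all only: mult_loop_class[OF order_refl winding_loop_loops winding_loop_loops] mult_integer_group
         loop_class_eqI[OF winding_loop_concat] loop_class_in_carrier[OF winding_loop_loops])
  then have "?w ((1::int) [^]\<^bsub>integer_group\<^esub> k) = ?w 1 [^]\<^bsub>?G\<^esub> k" for k :: int
    by (intro hom_int_pow) (simp_all add: group_sphere_homotopy_group)
  then have w: "?w k = sphere_gen 1 [^]\<^bsub>?G\<^esub> k" for k
    unfolding winding_loop_1 by simp
  obtain f where f: "f \<in> cube_loops 1 (nsphere 1) sphere_base" "A = loop_class 1 (nsphere 1) sphere_base f"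
    using carrier_homotopy_groupE[OF A] .
  obtain k where "(f, winding_loop k) \<in> loop_homotopy 1 (nsphere 1) sphere_base"
    using loop_homotopic_to_winding_loop[OF f(1)] .
  then have "A = ?w k" unfolding f(2) by (rule loop_class_eqI)
  then show ?thesis using w by metis
qed

lemma sphere_homotopy_group_cyclic:
  assumes "n \<ge> 1" "A \<in> carrier (sphere_homotopy_group n n)"
  shows "\<exists>k::int. A = sphere_gen n [^]\<^bsub>sphere_homotopy_group n n\<^esub> k"
  using assms
proof (induction n arbitrary: A rule: nat_induct_at_least)
  case base
  then show ?case by (rule circle_homotopy_group_cyclic)
next
  case (Suc n)
  obtain f where f: "f \<in> cube_loops (Suc n) (nsphere (Suc n)) sphere_base"
    "A = loop_class (Suc n) (nsphere (Suc n)) sphere_base f"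
    using carrier_homotopy_groupE[OF Suc.prems] .
  obtain g where g: "g \<in> cube_loops n (nsphere n) sphere_base"
    "(f, susp_loop n n g) \<in> loop_homotopy (Suc n) (nsphere (Suc n)) sphere_base"
    using loop_homotopic_to_susp_loop[OF Suc.hyps f(1)] .
  have A: "A = suspension_hom n n (loop_class n (nsphere n) sphere_base g)"
    unfolding f(2) suspension_hom_class[OF g(1)] by (rule loop_class_eqI[OF g(2)])
  obtain k :: int where "loop_class n (nsphere n) sphere_base g = sphere_gen n [^]\<^bsub>sphere_homotopy_group n n\<^esub> k"
    using Suc.IH[OF loop_class_in_carrier[OF g(1)]] by blast
  then have "A = sphere_gen (Suc n) [^]\<^bsub>sphere_homotopy_group (Suc n) (Suc n)\<^esub> k"
    unfolding A by (simp only: suspension_hom_gen_pow[OF Suc.hyps])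
  then show ?case by blast
qed

lemma sphere_degree_gen_pow:
  assumes n: "n \<ge> 1"
  shows "sphere_degree n (sphere_gen n [^]\<^bsub>sphere_homotopy_group n n\<^esub> (k::int)) = k"
proof -
  have "sphere_degree n (sphere_gen n) = 1"
    unfolding sphere_degree_class[OF n cube_sphere_loop] by (rule loop_degree_cube_sphere[OF n])
  then show ?thesis
    using hom_int_pow[OF sphere_degree_hom[OF n] sphere_gen_carrier group_sphere_homotopy_group[OF n] group_integer_group, of k]
    by (simp only: group_int_pow_integer_group mult_1_right)
qed

text \<open>Degree and taking powers of the generator are mutually inverse: cyclicity gives one
  composite, degree 1 of the generator the other.\<close>

lemma sphere_degree_iso:
  assumes n: "n \<ge> 1"
  shows "sphere_degree n \<in> iso (sphere_homotopy_group n n) integer_group"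
proof -
  interpret group "sphere_homotopy_group n n" by (rule group_sphere_homotopy_group[OF n])
  have "bij_betw (sphere_degree n) (carrier (sphere_homotopy_group n n)) UNIV"
  proof (rule bij_betw_byWitness[where f' = "\<lambda>k. sphere_gen n [^]\<^bsub>sphere_homotopy_group n n\<^esub> k"])
    show "\<forall>A\<in>carrier (sphere_homotopy_group n n).
        sphere_gen n [^]\<^bsub>sphere_homotopy_group n n\<^esub> sphere_degree n A = A"
    proof
      fix A assume "A \<in> carrier (sphere_homotopy_group n n)"
      then obtain k :: int where k: "A = sphere_gen n [^]\<^bsub>sphere_homotopy_group n n\<^esub> k"
        using sphere_homotopy_group_cyclic[OF n] by blast
      show "sphere_gen n [^]\<^bsub>sphere_homotopy_group n n\<^esub> sphere_degree n A = A"
        unfolding k sphere_degree_gen_pow[OF n] ..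
    qed
    show "range (\<lambda>k::int. sphere_gen n [^]\<^bsub>sphere_homotopy_group n n\<^esub> k)
        \<subseteq> carrier (sphere_homotopy_group n n)"
      using int_pow_closed[OF sphere_gen_carrier] by blast
  qed (use sphere_degree_gen_pow[OF n] in blast)+
  then show ?thesis
    using sphere_degree_hom[OF n] by (simp add: iso_def)
qed

text \<open>Every class is a power of the generator, and suspension takes it to the same power of
  the next generator.\<close>

lemma sphere_degree_suspension:
  assumes n: "n \<ge> 1" and A: "A \<in> carrier (sphere_homotopy_group n n)"
  shows "sphere_degree (Suc n) (suspension_hom n n A) = sphere_degree n A"
proof -
  obtain k :: int where k: "A = sphere_gen n [^]\<^bsub>sphere_homotopy_group n n\<^esub> k"
    using sphere_homotopy_group_cyclic[OF assms] by blast
  show ?thesis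
    unfolding k suspension_hom_gen_pow[OF n] sphere_degree_gen_pow[OF n]
    by (rule sphere_degree_gen_pow) simp
qed

section \<open>The stable stem\<close>

text \<open>Compatible isomorphisms to \<open>H\<close> turn the colimit relation into equality of
  images: elements at stages \<open>i\<close> and \<open>j\<close> with the same image have, by
  injectivity at stage \<open>i + j\<close>, the same transport there. The classes are therefore the
  fibres of \<delta>, indexed by \<open>H\<close>.\<close>

lemma seq_colim_iso:
  assumes H: "group H" and G: "\<And>i. group (G i)"
    and \<delta>: "\<And>i. \<delta> i \<in> iso (G i) H"
    and f: "\<And>i x. x \<in> carrier (G i) \<Longrightarrow> f i x \<in> carrier (G (Suc i)) \<and> \<delta> (Suc i) (f i x) = \<delta> i x"
  shows "group (seq_colim G f) \<and> seq_colim G f \<cong> H"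
proof -
  have tr: "seq_transport f i d x \<in> carrier (G (i + d)) \<and> \<delta> (i + d) (seq_transport f i d x) = \<delta> i x"
    if "x \<in> carrier (G i)" for i d x
    by (induction d) (use that f in auto)
  have inj: "x = y" if "x \<in> carrier (G i)" "y \<in> carrier (G i)" "\<delta> i x = \<delta> i y" for i x y
    using \<delta>[of i] that by (auto simp: iso_def bij_betw_def inj_on_def)
  have mem: "\<delta> i x \<in> carrier H" if "x \<in> carrier (G i)" for i x
    using \<delta>[of i] that by (auto simp: iso_def bij_betw_def)
  have surj: "\<exists>x\<in>carrier (G i). \<delta> i x = z" if "z \<in> carrier H" for i z
  proof -
    have "\<delta> i ` carrier (G i) = carrier H" using \<delta>[of i] by (simp add: iso_def bij_betw_def)
    then show ?thesis using that by (metis imageE)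
  qed
  have mult: "\<delta> i (x \<otimes>\<^bsub>G i\<^esub> y) = \<delta> i x \<otimes>\<^bsub>H\<^esub> \<delta> i y" if "x \<in> carrier (G i)" "y \<in> carrier (G i)" for i x y
    using \<delta>[of i] that by (auto simp: iso_def hom_def)
  have one: "\<delta> i \<one>\<^bsub>G i\<^esub> = \<one>\<^bsub>H\<^esub>" for i
    using hom_one[of "\<delta> i" "G i" H] \<delta> G H by (auto simp: iso_def)
  define cls where "cls z = {(i, x). x \<in> carrier (G i) \<and> \<delta> i x = z}" for z
  have rel: "seq_colim_rel G f `` {(i, x)} = cls (\<delta> i x)" if x: "x \<in> carrier (G i)" for i x
  proof -
    have "((i, x), (j, y)) \<in> seq_colim_rel G f \<longleftrightarrow> y \<in> carrier (G j) \<and> \<delta> j y = \<delta> i x" for j y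
    proof
      assume "((i, x), (j, y)) \<in> seq_colim_rel G f"
      then obtain d e where y: "y \<in> carrier (G j)" and de: "i + d = j + e"
        "seq_transport f i d x = seq_transport f j e y" by (auto simp: seq_colim_rel_def)
      then show "y \<in> carrier (G j) \<and> \<delta> j y = \<delta> i x" using tr[OF x, of d] tr[OF y, of e] by metis
    next
      assume y: "y \<in> carrier (G j) \<and> \<delta> j y = \<delta> i x"
      have *: "seq_transport f i j x = seq_transport f j i y"
        using inj[of _ "i + j"] tr[OF x, of j] tr[of y j i] y by (metis add.commute)
      have "\<exists>d e. i + d = j + e \<and> seq_transport f i d x = seq_transport f j e y"
        by (rule exI[of _ j], rule exI[of _ i]) (simp add: * add.commute)
      then show "((i, x), (j, y)) \<in> seq_colim_rel G f"
        using x y by (simp add: seq_colim_rel_def)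
    qed
    then show ?thesis by (auto simp: cls_def)
  qed
  have carrier: "carrier (seq_colim G f) = cls ` carrier H"
  proof -
    have C: "carrier (seq_colim G f) = (SIGMA i:UNIV. carrier (G i)) // seq_colim_rel G f"
      by (simp add: seq_colim_def)
    show ?thesis
    proof (intro equalityI subsetI)
      fix c assume "c \<in> carrier (seq_colim G f)"
      then obtain i x where "x \<in> carrier (G i)" "c = seq_colim_rel G f `` {(i, x)}"
        unfolding C by (auto elim!: quotientE)
      then show "c \<in> cls ` carrier H" using rel mem by blast
    next
      fix c assume "c \<in> cls ` carrier H"
      then obtain z where z: "z \<in> carrier H" "c = cls z" by blast
      then obtain x where x: "x \<in> carrier (G 0)" "\<delta> 0 x = z" using surj by blast
      have "seq_colim_rel G f `` {(0, x)} \<in> carrier (seq_colim G f)"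
        unfolding C by (rule quotientI) (simp add: x)
      then show "c \<in> carrier (seq_colim G f)" using rel[OF x(1)] x z by simp
    qed
  qed
  have cls_mult: "cls z \<otimes>\<^bsub>seq_colim G f\<^esub> cls w = cls (z \<otimes>\<^bsub>H\<^esub> w)" if z: "z \<in> carrier H" and w: "w \<in> carrier H" for z w
  proof -
    have "seq_colim_rel G f `` {(i + j, seq_transport f i j x \<otimes>\<^bsub>G (i + j)\<^esub> seq_transport f j i y)}
        = cls (z \<otimes>\<^bsub>H\<^esub> w)" if "(i, x) \<in> cls z" "(j, y) \<in> cls w" for i x j y
    proof -
      have x: "x \<in> carrier (G i)" "\<delta> i x = z" and y: "y \<in> carrier (G j)" "\<delta> j y = w"
        using that by (auto simp: cls_def)
      have tx: "seq_transport f i j x \<in> carrier (G (i + j))" "\<delta> (i + j) (seq_transport f i j x) = z"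
        using tr[OF x(1), of j] x by auto
      have ty: "seq_transport f j i y \<in> carrier (G (i + j))" "\<delta> (i + j) (seq_transport f j i y) = w"
        using tr[OF y(1), of i] y by (auto simp: add.commute)
      interpret Gij: group "G (i + j)" by (rule G)
      show ?thesis using tx ty by (simp add: rel mult)
    qed
    moreover obtain x y where "(0, x) \<in> cls z" "(0, y) \<in> cls w"
      using surj[OF z, of 0] surj[OF w, of 0] by (auto simp: cls_def)
    ultimately show ?thesis by (auto simp: seq_colim_def split_beta)
  qed
  have cls_inj: "inj_on cls (carrier H)"
  proof (rule inj_onI)
    fix z w assume z: "z \<in> carrier H" and eq: "cls z = cls w"
    obtain x where x: "x \<in> carrier (G 0)" "\<delta> 0 x = z" using surj[OF z] by blast
    then have "(0, x) \<in> cls w" unfolding eq[symmetric] by (simp add: cls_def)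
    then show "z = w" using x by (simp add: cls_def)
  qed
  have iso: "cls \<in> iso H (seq_colim G f)"
    using cls_inj cls_mult carrier by (auto simp: iso_def hom_def bij_betw_def)
  interpret G0: group "G 0" by (rule G)
  have "\<one>\<^bsub>seq_colim G f\<^esub> = cls \<one>\<^bsub>H\<^esub>"
    by (simp add: seq_colim_def rel one)
  \<comment> \<open>Transport of structure along \<open>cls\<close> yields a group whose unit is the
    image of the unit of \<open>H\<close>; the unit of the colimit is already that element.\<close>
  then have "seq_colim G f \<lparr>one := cls \<one>\<^bsub>H\<^esub>\<rparr> = seq_colim G f" by (metis monoid.surjective monoid.update_convs(2))
  then show ?thesis
    using group.iso_imp_img_group[OF H iso] group.iso_sym[OF H is_isoI[OF iso]] by simp
qed

theorem mainTheorem1: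
  shows "(\<forall>n::nat. n \<ge> 1 \<longrightarrow> group (sphere_homotopy_group n n) \<and> sphere_homotopy_group n n \<cong> integer_group)
       \<and> (group (stable_stem 0) \<and> stable_stem 0 \<cong> integer_group)"
proof (intro conjI allI impI)
  fix n :: nat assume n: "n \<ge> 1"
  show "group (sphere_homotopy_group n n)" by (rule group_sphere_homotopy_group[OF n])
  show "sphere_homotopy_group n n \<cong> integer_group" by (rule is_isoI[OF sphere_degree_iso[OF n]])
next
  have "group (stable_stem 0) \<and> stable_stem 0 \<cong> integer_group"
    unfolding stable_stem_def
  \<comment> \<open>Stage \<open>i\<close> of the stem is the homotopy group in dimension
    \<open>Suc i\<close>, whence the shift in the index of the degree.\<close>
  proof (rule seq_colim_iso[where \<delta> = "\<lambda>i. sphere_degree (Suc i)"])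
    fix i A assume "A \<in> carrier (sphere_homotopy_group (0 + Suc i) (Suc i))"
    then show "suspension_hom (0 + Suc i) (Suc i) A \<in> carrier (sphere_homotopy_group (0 + Suc (Suc i)) (Suc (Suc i))) \<and>
        sphere_degree (Suc (Suc i)) (suspension_hom (0 + Suc i) (Suc i) A) = sphere_degree (Suc i) A"
      using suspension_hom_hom[of "Suc i" "Suc i"] sphere_degree_suspension[of "Suc i" A]
      by (auto simp: hom_def)
  qed (auto simp: group_sphere_homotopy_group sphere_degree_iso)
  then show "group (stable_stem 0)" "stable_stem 0 \<cong> integer_group" by auto
qed

end
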